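(* Let $d\in\mathbb N$ and let $\mathcal H$ be a complex Hilbert space. There are bijections between the following three classes of objects: (i) transpose-conjugate pairs $B=(B^L,B^R)\in\mathscr L_d(\mathcal H)\times\mathscr R_d(\mathcal H)$ of non-unital free Schur class functions; (ii) transpose-conjugate pairs $H=(H^L,H^R)\in\mathscr L_d^+(\mathcal H)\times\mathscr R_d^+(\mathcal H)$ of free Herglotz-Schur functions; (iii) the positive cone $CP(\mathcal A;\mathcal H)$ of completely positive maps from the free disk operator system $\mathcal A+\mathcal A^*$ into $\mathcal L(\mathcal H)$. The bijection between (i) and (ii) is given by the mutually inverse maps $B\mapsto H_B$, $H_B^L=(I-B^L)^{-1}(I+B^L)$, $H_B^R=T\circ H_B^L$, and $H\mapsto B_H$, $B_H^L=(H^L+I)^{-1}(H^L-I)$, $B_H^R=T\circ B_H^L$. The bijection between (ii) and (iii) (modulo imaginary constants, i.e. $H^L$ and $H^L+iC$ with $C=C^*\in\mathcal L(\mathcal H)$ are identified), $H_B=(H^L_B,H^R_B)\leftrightarrow\phi$, is given by the free Herglotz formulas $$H^L_B(Z)=\phi\big((I-ZL^* )^{-1}(I+ZL^* )\big)+i\,\mathrm{Im}(H_\emptyset),\qquad H^R_B(Z)=T\circ H^L_B(Z),$$ where $H_\emptyset$ is the constant coefficient of $H_B^L$.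
   Context: $\mathcal L(\cdot)$ denotes bounded operators. $\mathbb F^d$ is the free unital semigroup of words in the letters $1,\dots,d$, with unit $\emptyset$; $\alpha^T$ is the reversed word of $\alpha$. $F^2_d$ is the full Fock space over $\mathbb C^d$ with orthonormal basis $\{e_\alpha\}_{\alpha\in\mathbb F^d}$; $L_ke_\alpha=e_{k\alpha}$ are the left creation operators, $L=(L_1,\dots,L_d)$, and $L^\alpha=L_{i_1}\cdots L_{i_n}$, $(L^* )^\alpha=L_{i_1}^*\cdots L_{i_n}^*$ for $\alpha=i_1\cdots i_n$. $\mathcal A$ (the left free disk algebra) is the norm-closed unital algebra generated by $L_1,\dots,L_d$, and $\mathcal A+\mathcal A^*$ means the norm closure of this operator system. Formal power series: $M(Z)=\sum_{\alpha\in\mathbb F^d}Z^\alpha M_\alpha$, with $Z=(Z_1,\dots,Z_d)$ non-commuting variables and $M_\alpha\in\mathcal L(\mathcal H)$. The (left) product is $(MF)_\gamma=\sum_{\alpha\beta=\gamma}M_\alpha F_\beta$ and the right product is $(M\bullet_RF)_\gamma=\sum_{\beta\alpha=\gamma}M_\alpha F_\beta$; here $F$ may also be $\mathcal H$-valued, and $F^2_d\otimes\mathcal H$ is identified with series $\sum Z^\alpha F_\alpha$ via $\sum e_\alpha\otimes F_\alpha$. The transpose is $T\circ M=\sum Z^{\alpha^T}M_\alpha$. $\mathscr L_d(\mathcal H)$ (resp. $\mathscr R_d(\mathcal H)$), the left (resp. right) free Schur class, is the set of formal series $B$ with coefficients in $\mathcal L(\mathcal H)$ such that left (resp. right) multiplication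 by $B(Z)$ is a contraction on $F^2_d\otimes\mathcal H$. A pair $(B^L,B^R)$ (or $(H^L,H^R)$) is transpose-conjugate if $B^R=T\circ B^L$ (resp. $H^R=T\circ H^L$). $\Omega=\coprod_{n\ge1}\Omega_n$, where $\Omega_n$ is the set of $d$-tuples $Z=(Z_1,\dots,Z_d)$ of $n\times n$ complex matrices that are strict row contractions; a series is evaluated at $Z\in\Omega_n$ by $M(Z)=\sum Z^\alpha\otimes M_\alpha$. A transpose-conjugate Schur pair $B$ is non-unital if $I-B^L(Z)$ is invertible for every $Z\in\Omega$; the corresponding condition for $B^R$ is this condition transported by $T$ (inverses for right series are taken with respect to $\bullet_R$). $\mathscr L^+_d(\mathcal H)$, the left free Herglotz-Schur class, is the set of free holomorphic functions on $\Omega$, $H^L(Z)=\sum Z^\alpha H_\alpha$, $H_\alpha\in\mathcal L(\mathcal H)$, whose left free Herglotz kernel $\hat K^L(Z,W)=\frac12\big(H^L(Z)\hat k(Z,W)+\hat k(Z,W)H^L(W)^*\big)$ is positive, where $\hat k(Z,W)=\sum_\alpha Z^\alpha(W^* )^{\alpha^T}$ and $H^L(W)^*=\sum_\alpha(W^* )^{\alpha^T}H_\alpha^*$. Positivity means that the coefficient kernel $\hat K^L_{\alpha,\beta}$ in $\hat K^L(Z,W)=\sum_{\alpha,\beta}Z^\alpha(W^* )^{\beta^T}\hat K^L_{\alpha,\beta}$, namely $\hat K^L_{\alpha,\beta}=\frac12\big(\sum_{\gamma\beta=\alpha}H_\gamma+\sum_{\gamma\alpha=\beta}H_\gamma^*\big)$,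 is a positive $\mathcal L(\mathcal H)$-valued kernel on $\mathbb F^d\times\mathbb F^d$. $\mathscr R_d^+(\mathcal H)$ is defined in the same way with right products, i.e. with coefficient kernel $\frac12\big(\sum_{\beta\gamma=\alpha}H_\gamma+\sum_{\alpha\gamma=\beta}H_\gamma^*\big)$. $(I-ZL^* )^{-1}:=\sum_\alpha Z^\alpha(L^* )^\alpha=\sum_\alpha Z^\alpha(L^{\alpha^T})^*$, $(I-ZL^* )^{-1}(I+ZL^* )=2(I-ZL^* )^{-1}-I$, and $\phi$ is applied coefficientwise. *)

theory Defs
  imports "HOL-Analysis.Analysis" "Jordan_Normal_Form.Matrix"
begin

section \<open>Complex Hilbert spaces\<close>

class complex_inner = real_inner +
  fixes scaleC :: "complex \<Rightarrow> 'a \<Rightarrow> 'a"  (infixr \<open>*\<^sub>C\<close> 75)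
    and cinner :: "'a \<Rightarrow> 'a \<Rightarrow> complex"
  assumes scaleC_add_right: "c *\<^sub>C (x + y) = c *\<^sub>C x + c *\<^sub>C y"
    and scaleC_add_left: "(b + c) *\<^sub>C x = b *\<^sub>C x + c *\<^sub>C x"
    and scaleC_scaleC: "b *\<^sub>C c *\<^sub>C x = (b * c) *\<^sub>C x"
    and scaleC_of_real: "complex_of_real r *\<^sub>C x = r *\<^sub>R x"
    and cinner_commute: "cinner x y = cnj (cinner y x)"
    and cinner_add_left: "cinner (x + y) z = cinner x z + cinner y z"
    and cinner_scaleC_left: "cinner (c *\<^sub>C x) y = c * cinner x y"
    and inner_eq_Re_cinner: "inner x y = Re (cinner x y)"

class chilbert_space = complex_inner + complete_space

instantiation complex :: chilbert_space
begin

definition scaleC_complex :: "complex \<Rightarrow> complex \<Rightarrow> complex"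
  where "scaleC_complex c x = c * x"

definition cinner_complex :: "complex \<Rightarrow> complex \<Rightarrow> complex"
  where "cinner_complex x y = x * cnj y"

instance
  by standard (auto simp: scaleC_complex_def cinner_complex_def algebra_simps inner_complex_def
      scaleR_conv_of_real)

end

lemma norm_sq_eq_inner: "(norm x)\<^sup>2 = inner x x" for x :: "'a::real_inner"
  by (simp add: power2_norm_eq_inner)

lemma cinner_scaleC_right: "cinner x (c *\<^sub>C y) = cnj c * cinner x y"
  by (metis cinner_commute cinner_scaleC_left complex_cnj_mult)

lemma cinner_same: "cinner x x = complex_of_real ((norm x)\<^sup>2)"
  for x :: "'a::complex_inner"
proof (rule complex_eqI)
  show "Im (cinner x x) = Im (complex_of_real ((norm x)\<^sup>2))"
    using arg_cong[OF cinner_commute[of x x], of Im] by simp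
qed (simp add: norm_sq_eq_inner inner_eq_Re_cinner)

lemma norm_scaleC: "norm (c *\<^sub>C x) = cmod c * norm x"
  for x :: "'a::complex_inner"
proof -
  have "complex_of_real ((norm (c *\<^sub>C x))\<^sup>2) = (c * cnj c) * cinner x x"
    unfolding cinner_same[symmetric] by (simp add: cinner_scaleC_left cinner_scaleC_right)
  also have "\<dots> = complex_of_real ((cmod c * norm x)\<^sup>2)"
    by (simp add: cinner_same complex_norm_square[symmetric] power_mult_distrib)
  finally have "complex_of_real ((norm (c *\<^sub>C x))\<^sup>2) = complex_of_real ((cmod c * norm x)\<^sup>2)" .
  then have "(norm (c *\<^sub>C x))\<^sup>2 = (cmod c * norm x)\<^sup>2"
    using of_real_eq_iff by blast
  then show ?thesis by (simp add: power2_eq_iff_nonneg)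
qed

lemma norm_cinner_le: "cmod (cinner x y) \<le> (norm x)\<^sup>2 + (norm y)\<^sup>2"
  for x y :: "'a::complex_inner"
proof -
  have R: "\<bar>Re (cinner u y)\<bar> \<le> norm u * norm y" for u
    using Cauchy_Schwarz_ineq2[of u y] by (simp add: inner_eq_Re_cinner)
  have "Im (cinner x y) = Re (cinner ((- \<i>) *\<^sub>C x) y)"
    by (simp add: cinner_scaleC_left)
  then have "\<bar>Im (cinner x y)\<bar> \<le> norm x * norm y"
    using R[of "(- \<i>) *\<^sub>C x"] by (simp add: norm_scaleC)
  then have "cmod (cinner x y) \<le> 2 * (norm x * norm y)"
    using R[of x] cmod_le[of "cinner x y"] by linarith
  also have "\<dots> \<le> (norm x)\<^sup>2 + (norm y)\<^sup>2"
    using sum_squares_bound[of "norm x" "norm y"] by simp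
  finally show ?thesis .
qed

section \<open>Square-summable families\<close>

typedef (overloaded) ('i, 'a) ell2 =
  "{f :: 'i \<Rightarrow> 'a::complex_inner. (\<lambda>i. (norm (f i))\<^sup>2) summable_on UNIV}"
  morphisms ell2_coeff Abs_ell2
  by (rule exI[of _ "\<lambda>_. 0"]) simp

setup_lifting type_definition_ell2

lemma ell2_summable: "(\<lambda>i. (norm (ell2_coeff x i))\<^sup>2) summable_on UNIV"
  using ell2_coeff[of x] by simp

lemma square_summable_comparison:
  fixes g :: "'i \<Rightarrow> real"
    and f :: "'i \<Rightarrow> 'b::banach"
  assumes "g summable_on UNIV" "\<And>i. norm (f i) \<le> g i"
  shows "f summable_on UNIV"
  by (rule abs_summable_summable, rule Infinite_Sum.abs_summable_on_comparison_test'[OF assms(1)]) (rule assms(2))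

lemma norm_add_square_le: "(norm (x + y))\<^sup>2 \<le> 2 * ((norm x)\<^sup>2 + (norm y)\<^sup>2)"
  for x y :: "'a::real_normed_vector"
proof -
  have "(norm (x + y))\<^sup>2 \<le> (norm x + norm y)\<^sup>2"
    by (intro power_mono norm_triangle_ineq) simp
  also have "\<dots> \<le> 2 * ((norm x)\<^sup>2 + (norm y)\<^sup>2)"
    using sum_squares_bound[of "norm x" "norm y"] by (simp add: power2_sum)
  finally show ?thesis .
qed

lemma square_summable_add:
  fixes f g :: "'i \<Rightarrow> 'a::complex_inner"
  assumes "(\<lambda>i. (norm (f i))\<^sup>2) summable_on UNIV" "(\<lambda>i. (norm (g i))\<^sup>2) summable_on UNIV"
  shows "(\<lambda>i. (norm (f i + g i))\<^sup>2) summable_on UNIV"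
proof (rule square_summable_comparison)
  show "(\<lambda>i. 2 * ((norm (f i))\<^sup>2 + (norm (g i))\<^sup>2)) summable_on UNIV"
    by (intro summable_on_cmult_right summable_on_add assms)
qed (unfold real_norm_def, unfold abs_power2, rule norm_add_square_le)

instantiation ell2 :: (type, complex_inner) complex_inner
begin

lift_definition zero_ell2 :: "('a, 'b) ell2" is "\<lambda>_. 0" by simp

lift_definition plus_ell2 :: "('a, 'b) ell2 \<Rightarrow> ('a, 'b) ell2 \<Rightarrow> ('a, 'b) ell2"
  is "\<lambda>f g i. f i + g i" by (rule square_summable_add)

lift_definition uminus_ell2 :: "('a, 'b) ell2 \<Rightarrow> ('a, 'b) ell2"
  is "\<lambda>f i. - f i" by simp

lift_definition minus_ell2 :: "('a, 'b) ell2 \<Rightarrow> ('a, 'b) ell2 \<Rightarrow> ('a, 'b) ell2"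
  is "\<lambda>f g i. f i - g i"
  subgoal for f g using square_summable_add[of f "\<lambda>i. - g i"] by simp
  done

lift_definition scaleR_ell2 :: "real \<Rightarrow> ('a, 'b) ell2 \<Rightarrow> ('a, 'b) ell2"
  is "\<lambda>r f i. r *\<^sub>R f i" by (auto simp: power_mult_distrib intro!: summable_on_cmult_right)

lift_definition scaleC_ell2 :: "complex \<Rightarrow> ('a, 'b) ell2 \<Rightarrow> ('a, 'b) ell2"
  is "\<lambda>c f i. c *\<^sub>C f i" by (auto simp: norm_scaleC power_mult_distrib intro!: summable_on_cmult_right)

definition inner_ell2 :: "('a, 'b) ell2 \<Rightarrow> ('a, 'b) ell2 \<Rightarrow> real"
  where "inner_ell2 x y = (\<Sum>\<^sub>\<infinity>i. inner (ell2_coeff x i) (ell2_coeff y i))"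

definition cinner_ell2 :: "('a, 'b) ell2 \<Rightarrow> ('a, 'b) ell2 \<Rightarrow> complex"
  where "cinner_ell2 x y = (\<Sum>\<^sub>\<infinity>i. cinner (ell2_coeff x i) (ell2_coeff y i))"

definition norm_ell2 :: "('a, 'b) ell2 \<Rightarrow> real"
  where "norm_ell2 x = sqrt (inner x x)"

definition dist_ell2 :: "('a, 'b) ell2 \<Rightarrow> ('a, 'b) ell2 \<Rightarrow> real"
  where "dist_ell2 x y = norm (x - y)"

definition sgn_ell2 :: "('a, 'b) ell2 \<Rightarrow> ('a, 'b) ell2"
  where "sgn_ell2 x = inverse (norm x) *\<^sub>R x"

definition uniformity_ell2 :: "(('a, 'b) ell2 \<times> ('a, 'b) ell2) filter"
  where "uniformity_ell2 = (INF e\<in>{0 <..}. principal {(x, y). dist x y < e})"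

definition open_ell2 :: "('a, 'b) ell2 set \<Rightarrow> bool"
  where "open_ell2 U \<longleftrightarrow> (\<forall>x\<in>U. \<forall>\<^sub>F (x', y) in uniformity. x' = x \<longrightarrow> y \<in> U)"

lemma ell2_cinner_summable:
  "(\<lambda>i. cinner (ell2_coeff x i) (ell2_coeff y i)) summable_on UNIV"
  for x y :: "('a, 'b) ell2"
  by (rule square_summable_comparison[OF summable_on_add[OF ell2_summable[of x] ell2_summable[of y]]])
    (rule norm_cinner_le)

instance
proof
  fix x y z :: "('a, 'b) ell2" and r s :: real and b c :: complex
  show "x + y + z = x + (y + z)" by transfer (simp add: add.assoc)
  show "x + y = y + x" by transfer (simp add: add.commute)
  show "0 + x = x" by transfer simp
  show "- x + x = 0" by transfer simp
  show "x - y = x + - y" by transfer simp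
  show "r *\<^sub>R (x + y) = r *\<^sub>R x + r *\<^sub>R y" by transfer (simp add: scaleR_add_right)
  show "(r + s) *\<^sub>R x = r *\<^sub>R x + s *\<^sub>R x" by transfer (simp add: scaleR_add_left)
  show "r *\<^sub>R s *\<^sub>R x = (r * s) *\<^sub>R x" by transfer simp
  show "1 *\<^sub>R x = x" by transfer simp
  show "dist x y = norm (x - y)" by (rule dist_ell2_def)
  show "sgn x = inverse (norm x) *\<^sub>R x" by (rule sgn_ell2_def)
  show "(uniformity :: (('a, 'b) ell2 \<times> ('a, 'b) ell2) filter)
      = (INF e\<in>{0 <..}. principal {(x, y). dist x y < e})"
    by (rule uniformity_ell2_def)
  show "open U \<longleftrightarrow> (\<forall>x\<in>U. \<forall>\<^sub>F (x', y) in uniformity. x' = x \<longrightarrow> y \<in> U)"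
    for U :: "('a, 'b) ell2 set"
    by (rule open_ell2_def)
  show IR: "inner x y = Re (cinner x y)" for x y :: "('a, 'b) ell2"
    unfolding inner_ell2_def cinner_ell2_def
    by (simp add: infsum_Re[OF ell2_cinner_summable, symmetric] inner_eq_Re_cinner)
  show CC: "cinner x y = cnj (cinner y x)" for x y :: "('a, 'b) ell2"
    unfolding cinner_ell2_def infsum_cnj[symmetric] by (intro infsum_cong cinner_commute)
  show CA: "cinner (x + y) z = cinner x z + cinner y z"
    unfolding cinner_ell2_def
    by (subst infsum_add[symmetric])
      (auto intro!: ell2_cinner_summable infsum_cong simp: plus_ell2.rep_eq cinner_add_left)
  show CS: "cinner (c *\<^sub>C x) y = c * cinner x y" for c
    unfolding cinner_ell2_def
    by (subst infsum_cmult_right'[symmetric])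
      (auto intro!: infsum_cong simp: scaleC_ell2.rep_eq cinner_scaleC_left)
  show "c *\<^sub>C (x + y) = c *\<^sub>C x + c *\<^sub>C y" by transfer (simp add: scaleC_add_right)
  show "(b + c) *\<^sub>C x = b *\<^sub>C x + c *\<^sub>C x" by transfer (simp add: scaleC_add_left)
  show "b *\<^sub>C c *\<^sub>C x = (b * c) *\<^sub>C x" by transfer (simp add: scaleC_scaleC)
  show RC: "complex_of_real r *\<^sub>C x = r *\<^sub>R x" by transfer (simp add: scaleC_of_real)
  show "inner x y = inner y x" by (subst (1 2) IR, subst CC) simp
  show "inner (x + y) z = inner x z + inner y z" by (simp add: IR CA)
  show "inner (r *\<^sub>R x) y = r * inner x y" by (simp add: IR RC[symmetric] CS)
  have N: "inner x x = (\<Sum>\<^sub>\<infinity>i. (norm (ell2_coeff x i))\<^sup>2)"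
    unfolding norm_sq_eq_inner inner_ell2_def ..
  show "0 \<le> inner x x" unfolding N by (rule infsum_nonneg) simp
  show "inner x x = 0 \<longleftrightarrow> x = 0"
  proof
    assume "inner x x = 0"
    then have "(norm (ell2_coeff x i))\<^sup>2 = 0" for i
      unfolding N
      by (intro nonneg_infsum_le_0D[of "\<lambda>i. (norm (ell2_coeff x i))\<^sup>2" UNIV])
        (auto intro: ell2_summable)
    then have "ell2_coeff x = (\<lambda>_. 0)" by auto
    then show "x = 0" by (simp only: ell2_coeff_inject[symmetric] zero_ell2.rep_eq)
  qed (unfold N, simp add: zero_ell2.rep_eq)
  show "norm x = sqrt (inner x x)" by (rule norm_ell2_def)
qed

end

lemma norm_ell2_sq: "(norm x)\<^sup>2 = (\<Sum>\<^sub>\<infinity>i. (norm (ell2_coeff x i))\<^sup>2)"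
  unfolding norm_sq_eq_inner inner_ell2_def ..

lemma norm_ell2_finite_le: "finite F \<Longrightarrow> (\<Sum>i\<in>F. (norm (ell2_coeff x i))\<^sup>2) \<le> (norm x)\<^sup>2"
  unfolding norm_ell2_sq by (rule finite_sum_le_infsum[OF ell2_summable]) auto

lemma norm_ell2_coeff_le: "norm (ell2_coeff x i) \<le> norm x"
  using norm_ell2_finite_le[of "{i}" x] by (intro power2_le_imp_le[of "norm (ell2_coeff x i)"]) simp_all

lemma norm_ell2_le:
  assumes "0 \<le> e" "\<And>F. finite F \<Longrightarrow> (\<Sum>i\<in>F. (norm (ell2_coeff x i))\<^sup>2) \<le> e\<^sup>2"
  shows "norm x \<le> e"
proof -
  have "(norm x)\<^sup>2 \<le> e\<^sup>2"
    unfolding norm_ell2_sq by (rule infsum_le_finite_sums[OF ell2_summable]) (use assms in auto)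
  then show ?thesis using assms(1) by (rule power2_le_imp_le)
qed

instance ell2 :: (type, chilbert_space) chilbert_space
proof
  fix X :: "nat \<Rightarrow> ('a, 'b) ell2"
  assume X: "Cauchy X"
  have "Cauchy (\<lambda>n. ell2_coeff (X n) i)" for i
  proof (rule CauchyI)
    fix e :: real assume "0 < e"
    then obtain M where M: "\<And>m n. m \<ge> M \<Longrightarrow> n \<ge> M \<Longrightarrow> norm (X m - X n) < e"
      using CauchyD[OF X] by blast
    have le: "norm (ell2_coeff (X m) i - ell2_coeff (X n) i) \<le> norm (X m - X n)" for m n
      using norm_ell2_coeff_le[of "X m - X n" i] by (simp only: minus_ell2.rep_eq)
    show "\<exists>M. \<forall>m\<ge>M. \<forall>n\<ge>M. norm (ell2_coeff (X m) i - ell2_coeff (X n) i) < e"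
      by (intro exI[of _ M] allI impI order_le_less_trans[OF le] M)
  qed
  then have conv: "convergent (\<lambda>n. ell2_coeff (X n) i)" for i
    by (rule Cauchy_convergent)
  define f where "f i = lim (\<lambda>n. ell2_coeff (X n) i)" for i
  have f: "(\<lambda>n. ell2_coeff (X n) i) \<longlonglongrightarrow> f i" for i
    using conv[of i] unfolding f_def convergent_LIMSEQ_iff .
  have bound: "(\<Sum>i\<in>F. (norm (ell2_coeff (X n) i - f i))\<^sup>2) \<le> e\<^sup>2"
    if M: "\<forall>m\<ge>M. \<forall>n\<ge>M. norm (X m - X n) < e" "n \<ge> M" and F: "finite F" for e M n F
  proof (rule LIMSEQ_le_const2)
    show "(\<lambda>m. \<Sum>i\<in>F. (norm (ell2_coeff (X n) i - ell2_coeff (X m) i))\<^sup>2)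
        \<longlonglongrightarrow> (\<Sum>i\<in>F. (norm (ell2_coeff (X n) i - f i))\<^sup>2)"
      by (intro tendsto_intros f)
    have "(\<Sum>i\<in>F. (norm (ell2_coeff (X n) i - ell2_coeff (X m) i))\<^sup>2) \<le> e\<^sup>2" if "m \<ge> M" for m
    proof -
      have "(\<Sum>i\<in>F. (norm (ell2_coeff (X n) i - ell2_coeff (X m) i))\<^sup>2) \<le> (norm (X n - X m))\<^sup>2"
        using norm_ell2_finite_le[OF F, of "X n - X m"] by (simp add: minus_ell2.rep_eq)
      also have "\<dots> \<le> e\<^sup>2"
        using M that by (intro power_mono less_imp_le[of "norm _"]) simp_all
      finally show ?thesis .
    qed
    then show "\<exists>N. \<forall>m\<ge>N. (\<Sum>i\<in>F. (norm (ell2_coeff (X n) i - ell2_coeff (X m) i))\<^sup>2) \<le> e\<^sup>2"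
      by blast
  qed
  have f2: "(\<lambda>i. (norm (f i))\<^sup>2) summable_on UNIV"
  proof -
    obtain M where M: "\<forall>m\<ge>M. \<forall>n\<ge>M. norm (X m - X n) < 1" using CauchyD[OF X, of 1] by auto
    have "(\<lambda>i. (norm (ell2_coeff (X M) i - f i))\<^sup>2) summable_on UNIV"
    proof (rule nonneg_bdd_above_summable_on)
      show "bdd_above (sum (\<lambda>i. (norm (ell2_coeff (X M) i - f i))\<^sup>2) ` {F. F \<subseteq> UNIV \<and> finite F})"
        by (rule bdd_aboveI2[where M="1\<^sup>2"], rule bound[OF M order_refl]) blast
    qed simp
    then have "(\<lambda>i. (norm (f i - ell2_coeff (X M) i))\<^sup>2) summable_on UNIV"
      by (simp only: norm_minus_commute)
    from square_summable_add[OF this ell2_summable[of "X M"]]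
    show ?thesis by (simp only: diff_add_cancel)
  qed
  define y where "y = (Abs_ell2 f :: ('a, 'b) ell2)"
  have y: "ell2_coeff y = f" unfolding y_def by (rule Abs_ell2_inverse) (use f2 in simp)
  have "X \<longlonglongrightarrow> y"
  proof (rule LIMSEQ_I)
    fix r :: real assume "0 < r"
    then obtain M where M: "\<forall>m\<ge>M. \<forall>n\<ge>M. norm (X m - X n) < r/2"
      using CauchyD[OF X, of "r/2"] by auto
    have "norm (X n - y) < r" if "n \<ge> M" for n
    proof -
      have "norm (X n - y) \<le> r/2"
        unfolding norm_minus_commute[of "X n"]
      proof (rule norm_ell2_le)
        fix F :: "'a set" assume "finite F"
        from bound[OF M that this] show "(\<Sum>i\<in>F. (norm (ell2_coeff (y - X n) i))\<^sup>2) \<le> (r/2)\<^sup>2"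
          by (simp only: minus_ell2.rep_eq y norm_minus_commute)
      qed (use \<open>0 < r\<close> in simp)
      then show ?thesis using \<open>0 < r\<close> by simp
    qed
    then show "\<exists>no. \<forall>n\<ge>no. norm (X n - y) < r" by blast
  qed
  then show "convergent X" unfolding convergent_def by blast
qed

section \<open>Bounded complex-linear operators\<close>

typedef (overloaded) 'a bop =
  "{A :: 'a::complex_inner \<Rightarrow>\<^sub>L 'a. \<forall>c x. blinfun_apply A (c *\<^sub>C x) = c *\<^sub>C blinfun_apply A x}"
  by (rule exI[of _ id_blinfun]) simp

setup_lifting type_definition_bop

lift_definition bop_apply :: "'a::complex_inner bop \<Rightarrow> 'a \<Rightarrow> 'a" is blinfun_apply .

lemma scaleC_zero_right: "c *\<^sub>C 0 = (0 :: 'a::complex_inner)"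
  using scaleC_add_right[of c 0 "0::'a"] by simp

lemma scaleC_scaleR: "c *\<^sub>C r *\<^sub>R x = r *\<^sub>R c *\<^sub>C (x :: 'a::complex_inner)"
  by (simp add: scaleC_of_real[symmetric] scaleC_scaleC mult.commute)

lemma scaleC_minus_right: "c *\<^sub>C (- x) = - (c *\<^sub>C (x :: 'a::complex_inner))"
  using scaleC_scaleR[of c "-1" x] by simp

lemma scaleC_diff_right: "c *\<^sub>C (x - y) = c *\<^sub>C x - c *\<^sub>C (y :: 'a::complex_inner)"
  using scaleC_add_right[of c x "- y"] by (simp add: scaleC_minus_right)

lemma bounded_linear_scaleC: "bounded_linear (\<lambda>x :: 'a::complex_inner. c *\<^sub>C x)"
  by (rule bounded_linear_intro[where K="cmod c"])
    (simp_all add: scaleC_add_right scaleC_scaleR norm_scaleC mult.commute)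

instantiation bop :: (complex_inner) "{real_normed_algebra, monoid_mult}"
begin

lift_definition zero_bop :: "'a bop" is 0 by (simp add: scaleC_zero_right)
lift_definition one_bop :: "'a bop" is id_blinfun by simp
lift_definition plus_bop :: "'a bop \<Rightarrow> 'a bop \<Rightarrow> 'a bop" is "(+)"
  by (simp add: blinfun.add_left scaleC_add_right)
lift_definition minus_bop :: "'a bop \<Rightarrow> 'a bop \<Rightarrow> 'a bop" is "(-)"
  by (simp add: blinfun.diff_left scaleC_diff_right)
lift_definition uminus_bop :: "'a bop \<Rightarrow> 'a bop" is "uminus"
  by (simp add: blinfun.minus_left scaleC_minus_right)
lift_definition scaleR_bop :: "real \<Rightarrow> 'a bop \<Rightarrow> 'a bop" is "scaleR"
  by (simp add: blinfun.scaleR_left scaleC_scaleR)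
lift_definition times_bop :: "'a bop \<Rightarrow> 'a bop \<Rightarrow> 'a bop" is "(o\<^sub>L)" by simp
lift_definition norm_bop :: "'a bop \<Rightarrow> real" is norm .
lift_definition dist_bop :: "'a bop \<Rightarrow> 'a bop \<Rightarrow> real" is dist .
lift_definition sgn_bop :: "'a bop \<Rightarrow> 'a bop" is "sgn"
  by (simp add: sgn_div_norm blinfun.scaleR_left scaleC_scaleR)

definition uniformity_bop :: "('a bop \<times> 'a bop) filter"
  where "uniformity_bop = (INF e\<in>{0 <..}. principal {(x, y). dist x y < e})"

definition open_bop :: "'a bop set \<Rightarrow> bool"
  where "open_bop U \<longleftrightarrow> (\<forall>x\<in>U. \<forall>\<^sub>F (x', y) in uniformity. x' = x \<longrightarrow> y \<in> U)"

instance
proof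
  fix x y z :: "'a bop" and r s :: real
  show "x + y + z = x + (y + z)" by transfer (simp add: add.assoc)
  show "x + y = y + x" by transfer (simp add: add.commute)
  show "0 + x = x" by transfer simp
  show "- x + x = 0" by transfer simp
  show "x - y = x + - y" by transfer simp
  show "r *\<^sub>R (x + y) = r *\<^sub>R x + r *\<^sub>R y" by transfer (simp add: scaleR_add_right)
  show "(r + s) *\<^sub>R x = r *\<^sub>R x + s *\<^sub>R x" by transfer (simp add: scaleR_add_left)
  show "r *\<^sub>R s *\<^sub>R x = (r * s) *\<^sub>R x" by transfer simp
  show "1 *\<^sub>R x = x" by transfer simp
  show "x * y * z = x * (y * z)" by transfer (rule blinfun_eqI, simp)
  show "(x + y) * z = x * z + y * z"
    by transfer (rule bounded_bilinear.add_left[OF bounded_bilinear_blinfun_compose])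
  show "x * (y + z) = x * y + x * z"
    by transfer (rule bounded_bilinear.add_right[OF bounded_bilinear_blinfun_compose])
  show "r *\<^sub>R x * y = r *\<^sub>R (x * y)"
    by transfer (rule bounded_bilinear.scaleR_left[OF bounded_bilinear_blinfun_compose])
  show "x * r *\<^sub>R y = r *\<^sub>R (x * y)"
    by transfer (rule bounded_bilinear.scaleR_right[OF bounded_bilinear_blinfun_compose])
  show "1 * x = x" by transfer (rule blinfun_eqI, simp)
  show "x * 1 = x" by transfer (rule blinfun_eqI, simp)
  show "dist x y = norm (x - y)" by transfer (rule dist_norm)
  show "sgn x = inverse (norm x) *\<^sub>R x" by transfer (simp add: sgn_div_norm)
  show "(uniformity :: ('a bop \<times> 'a bop) filter)
      = (INF e\<in>{0 <..}. principal {(x, y). dist x y < e})"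
    by (rule uniformity_bop_def)
  show "open U \<longleftrightarrow> (\<forall>x\<in>U. \<forall>\<^sub>F (x', y) in uniformity. x' = x \<longrightarrow> y \<in> U)"
    for U :: "'a bop set"
    by (rule open_bop_def)
  show "norm x = 0 \<longleftrightarrow> x = 0" by transfer simp
  show "norm (x + y) \<le> norm x + norm y" by transfer (rule norm_triangle_ineq)
  show "norm (r *\<^sub>R x) = \<bar>r\<bar> * norm x" by transfer simp
  show "norm (x * y) \<le> norm x * norm y" by transfer (rule norm_blinfun_compose)
qed

end

lift_definition cscale :: "complex \<Rightarrow> 'a::complex_inner bop \<Rightarrow> 'a bop"
  is "\<lambda>c A. Blinfun (\<lambda>x. c *\<^sub>C blinfun_apply A x)"
  by (simp add: bounded_linear_Blinfun_apply scaleC_scaleC mult.commute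
      bounded_linear_compose[OF bounded_linear_scaleC blinfun.bounded_linear_right])

text \<open>Existence of the adjoint needs completeness (Riesz representation).\<close>

definition cadj :: "'a::complex_inner bop \<Rightarrow> 'a bop"  (\<open>_\<^sup>\<dagger>\<close> [1000] 999)
  where "A\<^sup>\<dagger> = (THE B. \<forall>x y. cinner (bop_apply A x) y = cinner x (bop_apply B y))"

definition Im_op :: "'a::complex_inner bop \<Rightarrow> 'a bop"
  where "Im_op A = cscale (1 / (2 * \<i>)) (A - A\<^sup>\<dagger>)"

section \<open>Fock space, free disk algebra, completely positive maps\<close>

text \<open>The letters are the elements of a finite nonempty type \<^typ>\<open>'d\<close>, so that \<open>d = CARD('d)\<close>.
  Words are lists, the semigroup operation is concatenation and the transpose of a word is its
  reversal.\<close>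

type_synonym 'd fock = "('d list, complex) ell2"

lift_definition fock_basis :: "'d list \<Rightarrow> 'd fock" is "\<lambda>\<alpha> \<beta>. if \<beta> = \<alpha> then 1 else 0"
  subgoal for \<alpha>
    by (rule summable_on_cong_neutral[THEN iffD1, OF _ _ _ summable_on_finite[of "{\<alpha>}"]]) auto
  done

lift_definition shift_ell2 :: "'d \<Rightarrow> 'd fock \<Rightarrow> 'd fock"
  is "\<lambda>k f \<gamma>. if \<gamma> \<noteq> [] \<and> hd \<gamma> = k then f (tl \<gamma>) else 0"
  subgoal for k f
  proof -
    assume "(\<lambda>\<alpha>. (cmod (f \<alpha>))\<^sup>2) summable_on UNIV"
    then have "(\<lambda>\<gamma>. (cmod (f (tl \<gamma>)))\<^sup>2) summable_on range (Cons k)"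
      by (subst summable_on_reindex) (auto simp: o_def)
    then show ?thesis
      by (rule summable_on_cong_neutral[THEN iffD1, rotated -1]) (auto simp: neq_Nil_conv)
  qed
  done

lemma norm_shift_ell2: "norm (shift_ell2 k x) = norm x"
proof -
  have "(norm (shift_ell2 k x))\<^sup>2 = (\<Sum>\<^sub>\<infinity>\<gamma>\<in>range (Cons k). (cmod (ell2_coeff x (tl \<gamma>)))\<^sup>2)"
    unfolding norm_ell2_sq shift_ell2.rep_eq
    by (rule infsum_cong_neutral) (auto simp: neq_Nil_conv)
  also have "\<dots> = (norm x)\<^sup>2"
    unfolding norm_ell2_sq by (subst infsum_reindex) (auto simp: o_def)
  finally show ?thesis by (simp add: power2_eq_iff_nonneg)
qed

lemma bounded_linear_shift_ell2: "bounded_linear (shift_ell2 k)"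
proof (rule bounded_linear_intro[where K=1])
  show "shift_ell2 k (x + y) = shift_ell2 k x + shift_ell2 k y" for x y
    by transfer auto
  show "shift_ell2 k (r *\<^sub>R x) = r *\<^sub>R shift_ell2 k x" for r x
    by transfer auto
qed (simp add: norm_shift_ell2)

lemma shift_ell2_scaleC: "shift_ell2 k (c *\<^sub>C x) = c *\<^sub>C shift_ell2 k x"
  by transfer (auto simp: scaleC_zero_right)

lift_definition creation :: "'d \<Rightarrow> 'd fock bop" is "\<lambda>k. Blinfun (shift_ell2 k)"
  by (simp add: bounded_linear_Blinfun_apply[OF bounded_linear_shift_ell2] shift_ell2_scaleC)

lemma creation_fock_basis: "bop_apply (creation k) (fock_basis \<alpha>) = fock_basis (k # \<alpha>)"
  unfolding bop_apply.rep_eq creation.rep_eq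
    bounded_linear_Blinfun_apply[OF bounded_linear_shift_ell2]
  by transfer (auto simp: fun_eq_iff neq_Nil_conv)

definition closed_unital_subalgebra :: "'a::complex_inner bop set \<Rightarrow> bool"
  where "closed_unital_subalgebra S \<longleftrightarrow> closed S \<and> 1 \<in> S \<and>
    (\<forall>a\<in>S. \<forall>b\<in>S. a + b \<in> S \<and> a * b \<in> S) \<and> (\<forall>c. \<forall>a\<in>S. cscale c a \<in> S)"

definition free_disk_algebra :: "'d fock bop set"
  where "free_disk_algebra = \<Inter>{S. closed_unital_subalgebra S \<and> range creation \<subseteq> S}"

definition free_disk_system :: "'d fock bop set"
  where "free_disk_system = closure {a + b\<^sup>\<dagger> | a b. a \<in> free_disk_algebra \<and> b \<in> free_disk_algebra}"

definition positive_operator_matrix :: "nat \<Rightarrow> (nat \<Rightarrow> nat \<Rightarrow> 'a::complex_inner bop) \<Rightarrow> bool"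
  where "positive_operator_matrix n T \<longleftrightarrow>
    (\<forall>x. (\<Sum>i<n. \<Sum>j<n. cinner (bop_apply (T i j) (x j)) (x i)) \<in> \<real>\<^sub>\<ge>\<^sub>0)"

text \<open>A map on the system \<open>S\<close> is represented by the unique function that agrees with it on \<open>S\<close>
  and is \<^const>\<open>undefined\<close> outside.\<close>

definition cp_maps :: "'a::complex_inner bop set \<Rightarrow> ('a bop \<Rightarrow> 'h::complex_inner bop) set"
  where "cp_maps S = {\<phi> \<in> extensional S.
    (\<forall>a\<in>S. \<forall>b\<in>S. \<phi> (a + b) = \<phi> a + \<phi> b) \<and>
    (\<forall>c. \<forall>a\<in>S. \<phi> (cscale c a) = cscale c (\<phi> a)) \<and>
    (\<forall>n T. (\<forall>i<n. \<forall>j<n. T i j \<in> S) \<longrightarrow> positive_operator_matrix n T \<longrightarrow>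
      positive_operator_matrix n (\<lambda>i j. \<phi> (T i j)))}"

section \<open>Formal power series in non-commuting variables\<close>

type_synonym ('d, 'a) series = "'d list \<Rightarrow> 'a bop"

definition series_const :: "'a::complex_inner bop \<Rightarrow> ('d, 'a) series"
  where "series_const A \<alpha> = (if \<alpha> = [] then A else 0)"

definition series_mult :: "('d, 'a::complex_inner) series \<Rightarrow> ('d, 'a) series \<Rightarrow> ('d, 'a) series"
    (infixl \<open>*\<^sub>S\<close> 70)
  where "(M *\<^sub>S F) \<gamma> = (\<Sum>(\<alpha>, \<beta>) | \<alpha> @ \<beta> = \<gamma>. M \<alpha> * F \<beta>)"

definition series_inverse_pair :: "('d, 'a::complex_inner) series \<Rightarrow> ('d, 'a) series \<Rightarrow> bool"
  where "series_inverse_pair M N \<longleftrightarrow> M *\<^sub>S N = series_const 1 \<and> N *\<^sub>S M = series_const 1"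

definition series_invertible :: "('d, 'a::complex_inner) series \<Rightarrow> bool"
  where "series_invertible M \<longleftrightarrow> (\<exists>N. series_inverse_pair M N)"

definition series_inverse :: "('d, 'a::complex_inner) series \<Rightarrow> ('d, 'a) series"
  where "series_inverse M = (THE N. series_inverse_pair M N)"

definition series_transpose :: "('d, 'a) series \<Rightarrow> ('d, 'a) series"
  where "series_transpose M \<alpha> = M (rev \<alpha>)"

definition left_mult :: "('d, 'a::complex_inner) series \<Rightarrow> ('d list \<Rightarrow> 'a) \<Rightarrow> 'd list \<Rightarrow> 'a"
  where "left_mult M F \<gamma> = (\<Sum>(\<alpha>, \<beta>) | \<alpha> @ \<beta> = \<gamma>. bop_apply (M \<alpha>) (F \<beta>))"

definition right_mult :: "('d, 'a::complex_inner) series \<Rightarrow> ('d list \<Rightarrow> 'a) \<Rightarrow> 'd list \<Rightarrow> 'a"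
  where "right_mult M F \<gamma> = (\<Sum>(\<alpha>, \<beta>) | \<beta> @ \<alpha> = \<gamma>. bop_apply (M \<alpha>) (F \<beta>))"

text \<open>The tensor product of the Fock space with \<open>H\<close> is the space of square-summable
  \<open>H\<close>-valued families \<^typ>\<open>('d list, 'h::chilbert_space) ell2\<close>.\<close>

definition ell2_contraction :: "(('i \<Rightarrow> 'a::complex_inner) \<Rightarrow> 'i \<Rightarrow> 'a) \<Rightarrow> bool"
  where "ell2_contraction T \<longleftrightarrow>
    (\<forall>F :: ('i, 'a) ell2. \<exists>G. ell2_coeff G = T (ell2_coeff F) \<and> norm G \<le> norm F)"

definition left_schur :: "('d, 'a::complex_inner) series set"
  where "left_schur = {B. ell2_contraction (left_mult B)}"

definition right_schur :: "('d, 'a::complex_inner) series set"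
  where "right_schur = {B. ell2_contraction (right_mult B)}"

section \<open>Evaluation on strict row contractions\<close>

text \<open>The row \<open>(Z\<^sub>1, \<dots>, Z\<^sub>d)\<close>, as an operator from the \<open>d\<close>-fold direct sum of the
  \<open>n\<close>-dimensional complex Hilbert space into that space, has norm less than 1.\<close>

definition nc_ball :: "nat \<Rightarrow> ('d::finite \<Rightarrow> complex mat) set"
  where "nc_ball n = {Z. (\<forall>k. Z k \<in> carrier_mat n n) \<and>
    (\<exists>r. 0 \<le> r \<and> r < 1 \<and> (\<forall>v :: 'd \<Rightarrow> nat \<Rightarrow> complex.
      (\<Sum>i<n. (cmod (\<Sum>k\<in>UNIV. \<Sum>j<n. Z k $$ (i, j) * v k j))\<^sup>2)
        \<le> r\<^sup>2 * (\<Sum>k\<in>UNIV. \<Sum>j<n. (cmod (v k j))\<^sup>2)))}"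

fun word_mat :: "nat \<Rightarrow> ('d \<Rightarrow> complex mat) \<Rightarrow> 'd list \<Rightarrow> complex mat"
  where
    "word_mat n Z [] = 1\<^sub>m n"
  | "word_mat n Z (k # \<alpha>) = Z k * word_mat n Z \<alpha>"

text \<open>Operators on the tensor product of \<open>n\<close>-dimensional space with \<open>H\<close> are identified with
  \<open>n \<times> n\<close> matrices over the operators on \<open>H\<close>; norm convergence is then entrywise norm convergence.
  The series is summed along the homogeneous components, since the family indexed by all words
  need not be summable.\<close>

definition homogeneous_part ::
    "nat \<Rightarrow> ('d::finite \<Rightarrow> complex mat) \<Rightarrow> ('d, 'a::complex_inner) series \<Rightarrow> nat \<times> nat \<Rightarrow> nat \<Rightarrow> 'a bop"
  where "homogeneous_part n Z M ij m =
    (\<Sum>\<alpha> | length \<alpha> = m. cscale (word_mat n Z \<alpha> $$ ij) (M \<alpha>))"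

definition series_eval ::
    "nat \<Rightarrow> ('d::finite \<Rightarrow> complex mat) \<Rightarrow> ('d, 'a::complex_inner) series \<Rightarrow> 'a bop mat"
  where "series_eval n Z M = Matrix.mat n n (\<lambda>ij. \<Sum>m. homogeneous_part n Z M ij m)"

definition free_holomorphic :: "('d::finite, 'a::complex_inner) series \<Rightarrow> bool"
  where "free_holomorphic M \<longleftrightarrow>
    (\<forall>n\<ge>1. \<forall>Z\<in>nc_ball n. \<forall>i<n. \<forall>j<n. summable (homogeneous_part n Z M (i, j)))"

text \<open>Not \<^const>\<open>invertible_mat\<close>, whose class \<^class>\<open>semiring_1\<close> excludes the zero Hilbert space.\<close>

definition invertible_op_mat :: "nat \<Rightarrow> 'a::complex_inner bop mat \<Rightarrow> bool"
  where "invertible_op_mat n A \<longleftrightarrow>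
    (\<exists>N\<in>carrier_mat n n. A * N = 1\<^sub>m n \<and> N * A = 1\<^sub>m n)"

definition nonunital :: "('d::finite, 'a::complex_inner) series \<Rightarrow> bool"
  where "nonunital B \<longleftrightarrow>
    (\<forall>n\<ge>1. \<forall>Z\<in>nc_ball n. invertible_op_mat n (1\<^sub>m n - series_eval n Z B))"

definition nonunital_schur_pairs :: "(('d::finite, 'h::complex_inner) series \<times> ('d, 'h) series) set"
  where "nonunital_schur_pairs = {(BL, BR). BL \<in> left_schur \<and> BR \<in> right_schur \<and>
    BR = series_transpose BL \<and> nonunital BL \<and> nonunital (series_transpose BR)}"

section \<open>Free Herglotz-Schur classes\<close>

definition positive_kernel :: "('i \<Rightarrow> 'i \<Rightarrow> 'a::complex_inner bop) \<Rightarrow> bool"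
  where "positive_kernel K \<longleftrightarrow> (\<forall>F h. finite F \<longrightarrow>
    (\<Sum>\<alpha>\<in>F. \<Sum>\<beta>\<in>F. cinner (bop_apply (K \<alpha> \<beta>) (h \<beta>)) (h \<alpha>)) \<in> \<real>\<^sub>\<ge>\<^sub>0)"

definition left_herglotz_kernel ::
    "('d, 'a::complex_inner) series \<Rightarrow> 'd list \<Rightarrow> 'd list \<Rightarrow> 'a bop"
  where "left_herglotz_kernel H \<alpha> \<beta> =
    (1/2) *\<^sub>R ((\<Sum>\<gamma> | \<gamma> @ \<beta> = \<alpha>. H \<gamma>) + (\<Sum>\<gamma> | \<gamma> @ \<alpha> = \<beta>. (H \<gamma>)\<^sup>\<dagger>))"

definition right_herglotz_kernel ::
    "('d, 'a::complex_inner) series \<Rightarrow> 'd list \<Rightarrow> 'd list \<Rightarrow> 'a bop"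
  where "right_herglotz_kernel H \<alpha> \<beta> =
    (1/2) *\<^sub>R ((\<Sum>\<gamma> | \<beta> @ \<gamma> = \<alpha>. H \<gamma>) + (\<Sum>\<gamma> | \<alpha> @ \<gamma> = \<beta>. (H \<gamma>)\<^sup>\<dagger>))"

definition left_herglotz :: "('d::finite, 'a::complex_inner) series set"
  where "left_herglotz = {H. free_holomorphic H \<and> positive_kernel (left_herglotz_kernel H)}"

definition right_herglotz :: "('d::finite, 'a::complex_inner) series set"
  where "right_herglotz = {H. free_holomorphic H \<and> positive_kernel (right_herglotz_kernel H)}"

definition herglotz_pairs :: "(('d::finite, 'h::complex_inner) series \<times> ('d, 'h) series) set"
  where "herglotz_pairs = {(HL, HR). HL \<in> left_herglotz \<and> HR \<in> right_herglotz \<and>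
    HR = series_transpose HL}"

definition imaginary_constant_rel ::
    "((('d::finite, 'h::complex_inner) series \<times> ('d, 'h) series) \<times>
      (('d, 'h) series \<times> ('d, 'h) series)) set"
  where "imaginary_constant_rel = {((HL, HR), (GL, GR)).
    (HL, HR) \<in> herglotz_pairs \<and> (GL, GR) \<in> herglotz_pairs \<and>
    (\<exists>C. C\<^sup>\<dagger> = C \<and> GL = (\<lambda>\<alpha>. HL \<alpha> + series_const (cscale \<i> C) \<alpha>))}"

section \<open>Cayley transform and Herglotz formula\<close>

definition schur_to_herglotz ::
    "('d, 'h::complex_inner) series \<times> ('d, 'h) series \<Rightarrow> ('d, 'h) series \<times> ('d, 'h) series"
  where "schur_to_herglotz = (\<lambda>(BL, BR).
    let HL = series_inverse (\<lambda>\<alpha>. series_const 1 \<alpha> - BL \<alpha>) *\<^sub>S (\<lambda>\<alpha>. series_const 1 \<alpha> + BL \<alpha>)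
    in (HL, series_transpose HL))"

definition herglotz_to_schur ::
    "('d, 'h::complex_inner) series \<times> ('d, 'h) series \<Rightarrow> ('d, 'h) series \<times> ('d, 'h) series"
  where "herglotz_to_schur = (\<lambda>(HL, HR).
    let BL = series_inverse (\<lambda>\<alpha>. HL \<alpha> + series_const 1 \<alpha>) *\<^sub>S (\<lambda>\<alpha>. HL \<alpha> - series_const 1 \<alpha>)
    in (BL, series_transpose BL))"

definition ZL_adj :: "('d, ('d list, complex) ell2) series"
  where "ZL_adj \<alpha> = (if length \<alpha> = 1 then (creation (hd \<alpha>))\<^sup>\<dagger> else 0)"

definition ZL_adj_resolvent :: "('d, ('d list, complex) ell2) series"
  where "ZL_adj_resolvent \<alpha> = prod_list (map (\<lambda>k. (creation k)\<^sup>\<dagger>) \<alpha>)"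

text \<open>The coefficients of \<open>\<phi>((I - ZL\<^sup>*)\<inverse> (I + ZL\<^sup>*)) + i C\<close>.\<close>

definition herglotz_series ::
    "('d fock bop \<Rightarrow> 'h::complex_inner bop) \<Rightarrow> 'h bop \<Rightarrow> ('d, 'h) series"
  where "herglotz_series \<phi> C \<alpha> =
    \<phi> ((ZL_adj_resolvent *\<^sub>S (\<lambda>\<beta>. series_const 1 \<beta> + ZL_adj \<beta>)) \<alpha>) + series_const (cscale \<i> C) \<alpha>"

end

theory Submission
  imports Defs
begin

text \<open>
  Left multiplication by a formal series is lower triangular with respect to the length of words.
  Hence \<open>B\<close> is a Schur function if and only if \<open>\<parallel>B g\<parallel> \<le> \<parallel>g\<parallel>\<close> holds for the truncations to words of
  length at most \<open>N\<close> of every formal vector \<open>g\<close> (\<open>left_schur_iff\<close>), and the coefficient kernel of \<open>H\<close>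
  is positive if and only if \<open>Re \<langle>H g, g\<rangle> \<ge> 0\<close> holds for all these truncations
  (\<open>positive_left_herglotz_kernel_iff\<close>). The identities
  \<open>Re \<langle>(1 + B) u, (1 - B) u\<rangle> = \<parallel>u\<parallel>\<^sup>2 - \<parallel>B u\<parallel>\<^sup>2\<close> and
  \<open>\<parallel>(H + 1) u\<parallel>\<^sup>2 - \<parallel>(H - 1) u\<parallel>\<^sup>2 = 4 Re \<langle>H u, u\<rangle>\<close> then show that the Cayley transform exchanges the two
  classes; its inverses exist as formal series as soon as the constant coefficients are invertible,
  which for \<open>1 - B\<close> is the non-unitality of \<open>B\<close> at \<open>Z = 0\<close> and for \<open>H + 1\<close> follows from
  \<open>Re H\<^sub>\<emptyset> \<ge> 0\<close>. Convergence on strict row contractions is automatic: positivity of the kernel and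
  contractivity both bound the columns of coefficients of a given length
  (\<open>column_bounded_positive_kernel\<close>, \<open>column_bounded_schur\<close>). Evaluation is multiplicative, so the
  inverse \<open>(H + 1) / 2\<close> of \<open>1 - B\<close> can be evaluated, and \<open>B\<close> is non-unital everywhere. Reversal of words
  carries all this over to right multiplication.

  For the Herglotz formula let \<open>V\<^sub>\<alpha>\<close> be the product of creation operators along the reversed word
  \<open>\<alpha>\<^sup>T\<close>. The kernels \<open>V\<^sub>\<alpha>\<^sup>\<dagger> V\<^sub>\<beta>\<close> and the coefficient kernel \<open>K\<close> of a Herglotz function are both Toeplitz: a
  common last letter of \<open>\<alpha>\<close> and \<open>\<beta>\<close> cancels, and different last letters give zero. So the formula
  says exactly that \<open>K\<^sub>\<alpha>\<^sub>,\<^sub>\<beta> = \<phi> (V\<^sub>\<alpha>\<^sup>\<dagger> V\<^sub>\<beta>)\<close> (\<open>herglotz_series_kernel\<close>), together with the imaginary part of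
  the constant coefficient. If \<open>\<phi>\<close> is completely positive, then \<open>K\<close> is positive, because
  \<open>V\<^sub>\<alpha>\<^sup>\<dagger> V\<^sub>\<beta>\<close> is a Gram matrix; and \<open>K\<close> determines \<open>\<phi>\<close>, because \<open>\<phi>\<close> is bounded and the span of the
  \<open>V\<^sub>\<alpha>\<^sup>\<dagger>\<close> and \<open>V\<^sub>\<beta>\<close>, the Toeplitz polynomials, is dense.

  Conversely a positive \<open>K\<close> defines \<open>\<phi>\<close> on Toeplitz polynomials, and the point is its complete
  positivity. It rests on a noncommutative Fejer-Riesz factorisation (\<open>Fejer_Riesz\<close>): if \<open>P\<close> is a
  positive matrix of Toeplitz polynomials and \<open>e > 0\<close>, then \<open>P + e = A\<^sup>\<dagger> A\<close> for an analytic matrix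
  polynomial \<open>A\<close>. Inserting this into \<open>\<phi>\<close> writes the quadratic form of \<open>\<phi> (P + e)\<close> as a sum of values
  of the quadratic form of \<open>K\<close> (\<open>symbol_map_positive\<close>), and \<open>e\<close> tends to zero. For the factorisation,
  \<open>T = P + e\<close> is invertible and Toeplitz with respect to the right creation operators \<open>R\<^sub>k\<close>, so in the
  inner product \<open>\<langle>T x, y\<rangle>\<close> these are isometries with orthogonal ranges; an orthonormal basis of their
  wandering space, which is spanned by \<open>T\<inverse>\<close> applied to the vacuum vectors, is moved by the words
  \<open>R\<^sup>\<alpha>\<close> to a total orthonormal system (\<open>wandering_basis\<close>), and the coefficients of the vacuum
  vectors in this system are those of \<open>A\<close>. Finally \<open>\<phi>\<close> extends to the closure
  (\<open>cp_on_extend_closure\<close>).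
\<close>

section \<open>Operators on complex Hilbert spaces\<close>

instance chilbert_space \<subseteq> banach ..

lemma bop_apply_simps [simp]:
  "bop_apply 0 x = 0" "bop_apply 1 x = x"
  "bop_apply (A + B) x = bop_apply A x + bop_apply B x"
  "bop_apply (A - B) x = bop_apply A x - bop_apply B x"
  "bop_apply (- A) x = - bop_apply A x"
  "bop_apply (r *\<^sub>R A) x = r *\<^sub>R bop_apply A x"
  "bop_apply (A * B) x = bop_apply A (bop_apply B x)"
  by (transfer, simp add: blinfun.bilinear_simps)+

lemma bop_apply_linear [simp]:
  "bop_apply A 0 = 0"
  "bop_apply A (x + y) = bop_apply A x + bop_apply A y"
  "bop_apply A (x - y) = bop_apply A x - bop_apply A y"
  "bop_apply A (- x) = - bop_apply A x"
  "bop_apply A (r *\<^sub>R x) = r *\<^sub>R bop_apply A x"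
  "bop_apply A (c *\<^sub>C x) = c *\<^sub>C bop_apply A x"
  by (transfer, simp add: blinfun.bilinear_simps)+

lemma bop_apply_sum: "bop_apply A (\<Sum>i\<in>I. f i) = (\<Sum>i\<in>I. bop_apply A (f i))"
  by (induction I rule: infinite_finite_induct) auto

lemma bop_apply_sum_op: "bop_apply (\<Sum>i\<in>I. f i) x = (\<Sum>i\<in>I. bop_apply (f i) x)"
  by (induction I rule: infinite_finite_induct) auto

lemma bop_apply_cscale [simp]: "bop_apply (cscale c A) x = c *\<^sub>C bop_apply A x"
  by transfer (simp add: bounded_linear_Blinfun_apply
      bounded_linear_compose[OF bounded_linear_scaleC blinfun.bounded_linear_right])

lemma bop_eqI: "(\<And>x. bop_apply A x = bop_apply B x) \<Longrightarrow> A = B"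
  by transfer (rule blinfun_eqI)

lemma norm_bop_apply_le: "norm (bop_apply A x) \<le> norm A * norm x"
  by transfer (rule norm_blinfun)

lemma norm_bop_le: "0 \<le> b \<Longrightarrow> (\<And>x. norm (bop_apply A x) \<le> b * norm x) \<Longrightarrow> norm A \<le> b"
  by transfer (rule norm_blinfun_bound)

lemma norm_bop_one_le: "norm (1 :: 'a::complex_inner bop) \<le> 1"
  by (rule norm_bop_le) auto

lemma scaleC_simps [simp]:
  "0 *\<^sub>C x = 0" "1 *\<^sub>C x = x" "c *\<^sub>C (0 :: 'a::complex_inner) = 0"
  using scaleC_of_real[of 0 x] scaleC_of_real[of 1 x] by (auto simp: scaleC_zero_right)

lemma scaleC_minus_left: "(- c) *\<^sub>C x = - (c *\<^sub>C (x :: 'a::complex_inner))"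
  using scaleC_add_left[of c "- c" x] by (simp add: eq_neg_iff_add_eq_0 add.commute)

lemma scaleC_sum_right: "c *\<^sub>C (\<Sum>i\<in>I. f i) = (\<Sum>i\<in>I. c *\<^sub>C (f i :: 'a::complex_inner))"
  by (induction I rule: infinite_finite_induct) (auto simp: scaleC_add_right)

lemma cinner_simps [simp]:
  fixes x y z :: "'a::complex_inner"
  shows "cinner 0 x = 0" "cinner x 0 = 0"
    "cinner (- x) y = - cinner x y" "cinner x (- y) = - cinner x y"
    "cinner (c *\<^sub>C x) y = c * cinner x y" "cinner x (c *\<^sub>C y) = cnj c * cinner x y"
proof -
  show 1: "cinner (- x) y = - cinner x y" for x y :: 'a
    using cinner_scaleC_left[of "-1" x y] by (simp add: scaleC_minus_left)
  show 2: "cinner 0 x = 0" for x :: 'a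
    using cinner_scaleC_left[of 0 0 x] by simp
  show "cinner x 0 = 0"
    using cinner_commute[of x 0] 2 by simp
  show "cinner x (- y) = - cinner x y"
    using cinner_commute[of x "- y"] cinner_commute[of y x] 1 by simp
qed (auto simp: cinner_scaleC_left cinner_scaleC_right)

lemma cinner_add_right: "cinner x (y + z) = cinner x y + cinner x (z :: 'a::complex_inner)"
  by (metis cinner_add_left cinner_commute complex_cnj_add)

lemma cinner_diff_left: "cinner (x - y) z = cinner x z - cinner y (z :: 'a::complex_inner)"
  using cinner_add_left[of x "- y" z] by simp

lemma cinner_diff_right: "cinner x (y - z) = cinner x y - cinner x (z :: 'a::complex_inner)"
  using cinner_add_right[of x y "- z"] by simp

lemma cinner_scaleR_left [simp]:
  "cinner (r *\<^sub>R x) y = of_real r * cinner x (y :: 'a::complex_inner)"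
  by (simp add: scaleC_of_real[symmetric])

lemma cinner_scaleR_right [simp]:
  "cinner x (r *\<^sub>R y) = of_real r * cinner x (y :: 'a::complex_inner)"
  by (simp add: scaleC_of_real[symmetric])

lemma cinner_sum_left: "cinner (\<Sum>i\<in>I. f i) y = (\<Sum>i\<in>I. cinner (f i) (y :: 'a::complex_inner))"
  by (induction I rule: infinite_finite_induct) (auto simp: cinner_add_left)

lemma cinner_sum_right: "cinner x (\<Sum>i\<in>I. f i) = (\<Sum>i\<in>I. cinner x (f i :: 'a::complex_inner))"
  by (induction I rule: infinite_finite_induct) (auto simp: cinner_add_right)

lemma Re_cinner_commute: "Re (cinner x y) = Re (cinner y (x :: 'a::complex_inner))"
  using cinner_commute[of x y] by simp

lemma cinner_ext_right:
  assumes "\<And>x. cinner x y = cinner x (z :: 'a::complex_inner)"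
  shows "y = z"
proof -
  have "cinner (y - z) (y - z) = 0"
    using assms[of "y - z"] by (simp add: cinner_diff_right)
  then show ?thesis by (simp add: cinner_same)
qed

lemma cinner_ext_left:
  assumes "\<And>x. cinner y x = cinner z (x :: 'a::complex_inner)"
  shows "y = z"
  by (rule cinner_ext_right) (metis assms cinner_commute)

lemma cinner_Cauchy_Schwarz: "cmod (cinner x y) \<le> norm x * norm (y :: 'a::complex_inner)"
proof (cases "cinner x y = 0")
  case False
  define u where "u = cnj (cinner x y) / of_real (cmod (cinner x y))"
  have "u * cinner x y = of_real ((cmod (cinner x y))\<^sup>2) / of_real (cmod (cinner x y))"
    unfolding u_def complex_norm_square by (simp add: mult.commute)
  also have "\<dots> = of_real (cmod (cinner x y))"
    by (simp add: power2_eq_square)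
  finally have "u * cinner x y = of_real (cmod (cinner x y))" .
  moreover have "cmod u = 1" using False by (simp add: u_def norm_divide)
  ultimately have "cmod (cinner x y) = inner (u *\<^sub>C x) y"
    by (simp add: inner_eq_Re_cinner)
  also have "\<dots> \<le> norm (u *\<^sub>C x) * norm y" by (rule norm_cauchy_schwarz)
  finally show ?thesis using \<open>cmod u = 1\<close> by (simp add: norm_scaleC)
qed simp

lemma of_real_nonneg: "0 \<le> r \<Longrightarrow> complex_of_real r \<in> \<real>\<^sub>\<ge>\<^sub>0"
  by simp

instance bop :: (chilbert_space) banach
proof
  fix X :: "nat \<Rightarrow> 'a bop" assume X: "Cauchy X"
  have "Cauchy (\<lambda>n. Rep_bop (X n))"
    using X unfolding Cauchy_def dist_bop.rep_eq .
  then obtain L where L: "(\<lambda>n. Rep_bop (X n)) \<longlonglongrightarrow> L"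
    using convergent_eq_Cauchy by blast
  have "blinfun_apply L (c *\<^sub>C x) = c *\<^sub>C blinfun_apply L x" for c x
  proof (rule LIMSEQ_unique)
    show "(\<lambda>n. blinfun_apply (Rep_bop (X n)) (c *\<^sub>C x)) \<longlonglongrightarrow> blinfun_apply L (c *\<^sub>C x)"
      by (intro tendsto_intros L)
    have "(\<lambda>n. c *\<^sub>C blinfun_apply (Rep_bop (X n)) x) \<longlonglongrightarrow> c *\<^sub>C blinfun_apply L x"
      by (intro bounded_linear.tendsto[OF bounded_linear_scaleC] tendsto_intros L)
    then show "(\<lambda>n. blinfun_apply (Rep_bop (X n)) (c *\<^sub>C x)) \<longlonglongrightarrow> c *\<^sub>C blinfun_apply L x"
      using Rep_bop[of "X _"] by simp
  qed
  then have L': "Rep_bop (Abs_bop L) = L" by (simp add: Abs_bop_inverse)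
  have "X \<longlonglongrightarrow> Abs_bop L"
    using L unfolding tendsto_iff dist_bop.rep_eq L' .
  then show "convergent X" unfolding convergent_def by blast
qed

lemma norm_cscale: "norm (cscale c A) = cmod c * norm A"
proof (rule antisym)
  have le: "norm (cscale c A) \<le> cmod c * norm A" for c and A :: "'a bop"
    by (rule norm_bop_le)
      (auto simp: norm_scaleC mult.assoc intro!: mult_left_mono norm_bop_apply_le)
  show "norm (cscale c A) \<le> cmod c * norm A" by (rule le)
  show "cmod c * norm A \<le> norm (cscale c A)"
  proof (cases "c = 0")
    case False
    have "cscale (inverse c) (cscale c A) = A"
      using False by (intro bop_eqI) (simp add: scaleC_scaleC)
    then have "cmod c * norm A \<le> cmod c * (cmod (inverse c) * norm (cscale c A))"
      using le[of "inverse c" "cscale c A"] by (intro mult_left_mono) auto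
    then show ?thesis
      using False by (simp add: norm_inverse mult.assoc[symmetric])
  qed simp
qed

lemma cscale_add_right: "cscale c (A + B) = cscale c A + cscale c B"
  by (rule bop_eqI) (simp add: scaleC_add_right)

lemma cscale_diff_right: "cscale c (A - B) = cscale c A - cscale c B"
  by (rule bop_eqI) (simp add: scaleC_diff_right)

lemma cscale_add_left: "cscale (b + c) A = cscale b A + cscale c A"
  by (rule bop_eqI) (simp add: scaleC_add_left)

lemma cscale_cscale [simp]: "cscale b (cscale c A) = cscale (b * c) A"
  by (rule bop_eqI) (simp add: scaleC_scaleC)

lemma cscale_simps [simp]: "cscale 0 A = 0" "cscale 1 A = A" "cscale c 0 = 0"
  by (auto intro!: bop_eqI)

lemma cscale_minus_one: "cscale (- 1) A = - A"
  by (rule bop_eqI) (simp add: scaleC_minus_left)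

lemma cscale_minus_left: "cscale (- c) A = - cscale c A"
  by (rule bop_eqI) (simp add: scaleC_minus_left)

lemma cscale_minus_right: "cscale c (- A) = - cscale c A"
  by (rule bop_eqI) (simp add: scaleC_minus_right)

lemma cscale_of_real: "cscale (of_real r) A = r *\<^sub>R A"
  by (rule bop_eqI) (simp add: scaleC_of_real)

lemma cscale_times: "cscale b A * cscale c B = cscale (b * c) (A * B)"
  by (rule bop_eqI) (simp add: scaleC_scaleC mult.commute)

lemma cscale_sum_right: "cscale c (\<Sum>i\<in>I. f i) = (\<Sum>i\<in>I. cscale c (f i))"
  by (induction I rule: infinite_finite_induct) (auto simp: cscale_add_right)

lemma cscale_sum_left: "cscale (\<Sum>i\<in>I. f i) A = (\<Sum>i\<in>I. cscale (f i) A)"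
  by (induction I rule: infinite_finite_induct) (auto simp: cscale_add_left)

lemma bop_eqI_cinner:
  "(\<And>x y. cinner x (bop_apply A y) = cinner x (bop_apply B y)) \<Longrightarrow> A = B"
  by (rule bop_eqI, rule cinner_ext_right)

text \<open>A vector representing \<open>f\<close> minimises \<open>\<parallel>x\<parallel>\<^sup>2 - 2 f x\<close>; by the parallelogram law every
  minimising sequence of this functional is Cauchy.\<close>

lemma real_Riesz_representation:
  fixes f :: "'a::chilbert_space \<Rightarrow> real"
  assumes f: "bounded_linear f"
  obtains z where "\<And>x. f x = inner x z"
proof -
  interpret f: bounded_linear f by (rule f)
  define J where "J x = (norm x)\<^sup>2 - 2 * f x" for x
  obtain K where K: "\<And>x. norm (f x) \<le> norm x * K" using f.bounded by blast
  have lower: "- K\<^sup>2 \<le> J x" for x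
  proof -
    have "0 \<le> (norm x - K)\<^sup>2" by simp
    then show ?thesis using K[of x] unfolding J_def by (simp add: power2_diff)
  qed
  define m where "m = Inf (range J)"
  have bdd: "bdd_below (range J)" using lower by (auto intro!: bdd_belowI2)
  have m_le: "m \<le> J x" for x unfolding m_def by (rule cInf_lower[OF _ bdd]) simp
  have "\<exists>x. J x < m + inverse (real (Suc n))" for n
  proof (rule ccontr)
    assume "\<not> ?thesis"
    then have "m + inverse (real (Suc n)) \<le> Inf (range J)"
      by (intro cInf_greatest) (auto simp: not_less)
    then show False unfolding m_def[symmetric] by simp
  qed
  then obtain X where X: "\<And>n. J (X n) < m + inverse (real (Suc n))" by metis
  have par: "(norm (x - y))\<^sup>2 = 2 * J x + 2 * J y - 4 * J ((1/2) *\<^sub>R (x + y))" for x y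
    unfolding J_def f.scaleR f.add norm_sq_eq_inner
    by (simp add: inner_simps inner_commute algebra_simps)
  have close: "(norm (X i - X j))\<^sup>2 < 2 * inverse (real (Suc i)) + 2 * inverse (real (Suc j))" for i j
    using par[of "X i" "X j"] X[of i] X[of j] m_le[of "(1/2) *\<^sub>R (X i + X j)"] by simp
  have "Cauchy X"
  proof (rule CauchyI)
    fix e :: real assume e: "0 < e"
    obtain M where M: "inverse (real (Suc M)) < e\<^sup>2 / 4"
      using reals_Archimedean[of "e\<^sup>2 / 4"] e by auto
    have "norm (X i - X j) < e" if "i \<ge> M" "j \<ge> M" for i j
    proof (rule power2_less_imp_less)
      have "inverse (real (Suc i)) \<le> inverse (real (Suc M))" "inverse (real (Suc j)) \<le> inverse (real (Suc M))"
        using that by (auto simp: field_simps)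
      then show "(norm (X i - X j))\<^sup>2 < e\<^sup>2" using close[of i j] M by linarith
    qed (use e in simp)
    then show "\<exists>M. \<forall>i\<ge>M. \<forall>j\<ge>M. norm (X i - X j) < e" by blast
  qed
  then obtain z where z: "X \<longlonglongrightarrow> z" using Cauchy_convergent_iff convergent_def by blast
  have "J z \<le> m"
  proof (rule LIMSEQ_le)
    show "(\<lambda>n. J (X n)) \<longlonglongrightarrow> J z" unfolding J_def by (intro tendsto_intros f.tendsto z)
    show "(\<lambda>n. m + inverse (real (Suc n))) \<longlonglongrightarrow> m"
      using tendsto_add[OF tendsto_const LIMSEQ_inverse_real_of_nat, of m] by simp
  qed (use X in \<open>auto intro: less_imp_le\<close>)
  have "f x = inner x z" for x
  proof -
    define a where "a = inner x z - f x"
    have quad: "0 \<le> 2 * t * a + t\<^sup>2 * (norm x)\<^sup>2" for t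
    proof -
      have "J z \<le> J (z + t *\<^sub>R x)" using \<open>J z \<le> m\<close> m_le[of "z + t *\<^sub>R x"] by simp
      then show ?thesis
        unfolding J_def f.scaleR f.add norm_sq_eq_inner a_def
        by (simp add: inner_simps inner_commute algebra_simps power2_eq_square)
    qed
    have "a = 0"
    proof (rule ccontr)
      assume a: "a \<noteq> 0"
      \<comment> \<open>The quadratic in \<open>t\<close> is negative at \<open>t = - a / c\<close> as soon as \<open>2 c > \<parallel>x\<parallel>\<^sup>2\<close>.\<close>
      define c where "c = (norm x)\<^sup>2 + 1"
      have sq: "0 \<le> (norm x)\<^sup>2" by simp
      have c: "c > 0" unfolding c_def using sq by linarith
      have "(norm x)\<^sup>2 < c" unfolding c_def by simp
      then have c2: "(norm x)\<^sup>2 < 2 * c" using c by linarith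
      have "2 * (- a / c) * a + (- a / c)\<^sup>2 * (norm x)\<^sup>2 = (a\<^sup>2 / c\<^sup>2) * ((norm x)\<^sup>2 - 2 * c)"
        using c by (simp add: field_simps power2_eq_square)
      also have "\<dots> < 0" using a c c2 by (intro mult_pos_neg) auto
      finally show False using quad[of "- a / c"] by simp
    qed
    then show ?thesis by (simp add: a_def)
  qed
  then show ?thesis by (rule that)
qed

lemma Abs_bop_apply:
  fixes f :: "'a::complex_inner \<Rightarrow> 'a"
  assumes "\<And>x y. f (x + y) = f x + f y" "\<And>c x. f (c *\<^sub>C x) = c *\<^sub>C f x"
    and "\<And>x. norm (f x) \<le> K * norm x"
  obtains B where "\<And>x. bop_apply B x = f x"
proof -
  have bl: "bounded_linear f"
    by (rule bounded_linear_intro[where K=K])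
      (use assms in \<open>auto simp: scaleC_of_real[symmetric] mult.commute\<close>)
  have "bop_apply (Abs_bop (Blinfun f)) x = f x" for x
    by (simp add: bop_apply.rep_eq Abs_bop_inverse bounded_linear_Blinfun_apply[OF bl] assms(2))
  then show ?thesis by (rule that)
qed

lemma ex_adjoint:
  fixes A :: "'a::chilbert_space bop"
  shows "\<exists>B. \<forall>x y. cinner (bop_apply A x) y = cinner x (bop_apply B y)"
proof -
  have "\<exists>z. \<forall>x. cinner (bop_apply A x) y = cinner x z" for y
  proof -
    have "bounded_linear (\<lambda>x. inner (bop_apply A x) y)"
    proof (rule bounded_linear_intro[where K="norm A * norm y"])
      fix x
      have "norm (inner (bop_apply A x) y) \<le> norm (bop_apply A x) * norm y"
        by (simp add: Cauchy_Schwarz_ineq2)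
      also have "\<dots> \<le> (norm A * norm x) * norm y" by (intro mult_right_mono norm_bop_apply_le) simp
      finally show "norm (inner (bop_apply A x) y) \<le> norm x * (norm A * norm y)" by (simp add: mult_ac)
    qed (auto simp: inner_simps)
    then obtain z where z: "\<And>x. inner (bop_apply A x) y = inner x z"
      using real_Riesz_representation by blast
    have "cinner (bop_apply A x) y = cinner x z" for x
    proof (rule complex_eqI)
      show "Re (cinner (bop_apply A x) y) = Re (cinner x z)" using z[of x] by (simp add: inner_eq_Re_cinner)
      show "Im (cinner (bop_apply A x) y) = Im (cinner x z)"
        using z[of "(- \<i>) *\<^sub>C x"] by (simp add: inner_eq_Re_cinner)
    qed
    then show ?thesis by blast
  qed
  then obtain g where g: "\<And>x y. cinner (bop_apply A x) y = cinner x (g y)" by metis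
  have add: "g (y + z) = g y + g z" for y z
    by (rule cinner_ext_right) (simp add: g[symmetric] cinner_add_right)
  have scale: "g (c *\<^sub>C y) = c *\<^sub>C g y" for c y
    by (rule cinner_ext_right) (simp add: g[symmetric])
  have bound: "norm (g y) \<le> norm A * norm y" for y
  proof (cases "g y = 0")
    case False
    have "(norm (g y))\<^sup>2 = cmod (cinner (bop_apply A (g y)) y)" by (simp add: g cinner_same norm_power)
    also have "\<dots> \<le> norm (bop_apply A (g y)) * norm y" by (rule cinner_Cauchy_Schwarz)
    also have "\<dots> \<le> (norm A * norm (g y)) * norm y" by (intro mult_right_mono norm_bop_apply_le) simp
    finally show ?thesis using False by (simp add: power2_eq_square mult_ac)
  qed simp
  obtain B where "\<And>y. bop_apply B y = g y" using Abs_bop_apply[OF add scale bound] by blast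
  then show ?thesis using g by (intro exI[of _ B]) auto
qed

lemma cinner_adjoint: "cinner (bop_apply A x) y = cinner x (bop_apply (A\<^sup>\<dagger>) y)"
  for A :: "'a::chilbert_space bop"
proof -
  have "\<exists>!B. \<forall>x y. cinner (bop_apply A x) y = cinner x (bop_apply B y)"
  proof (rule ex_ex1I[OF ex_adjoint])
    fix B C
    assume *: "\<forall>x y. cinner (bop_apply A x) y = cinner x (bop_apply B y)"
      "\<forall>x y. cinner (bop_apply A x) y = cinner x (bop_apply C y)"
    show "B = C"
    proof (rule bop_eqI_cinner)
      show "cinner x (bop_apply B y) = cinner x (bop_apply C y)" for x y
        by (rule trans[OF *(1)[rule_format, symmetric] *(2)[rule_format]])
    qed
  qed
  from theI'[OF this] show ?thesis unfolding cadj_def[symmetric] by blast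
qed

lemma cinner_adjoint': "cinner (bop_apply (A\<^sup>\<dagger>) x) y = cinner x (bop_apply A y)"
  for A :: "'a::chilbert_space bop"
proof -
  have "cinner (bop_apply (A\<^sup>\<dagger>) x) y = cnj (cinner y (bop_apply (A\<^sup>\<dagger>) x))" by (rule cinner_commute)
  also have "\<dots> = cnj (cinner (bop_apply A y) x)" by (simp only: cinner_adjoint)
  also have "\<dots> = cinner x (bop_apply A y)" by (rule cinner_commute[symmetric])
  finally show ?thesis .
qed

lemma cadj_eqI:
  fixes A :: "'a::chilbert_space bop"
  assumes "\<And>x y. cinner (bop_apply A x) y = cinner x (bop_apply B y)"
  shows "A\<^sup>\<dagger> = B"
  by (rule bop_eqI_cinner) (simp add: assms flip: cinner_adjoint)

lemma cadj_simps [simp]: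
  fixes A B :: "'a::chilbert_space bop"
  shows "(A\<^sup>\<dagger>)\<^sup>\<dagger> = A" "(A + B)\<^sup>\<dagger> = A\<^sup>\<dagger> + B\<^sup>\<dagger>" "(A - B)\<^sup>\<dagger> = A\<^sup>\<dagger> - B\<^sup>\<dagger>"
    "(cscale c A)\<^sup>\<dagger> = cscale (cnj c) (A\<^sup>\<dagger>)" "(A * B)\<^sup>\<dagger> = B\<^sup>\<dagger> * A\<^sup>\<dagger>"
    "(1 :: 'a bop)\<^sup>\<dagger> = 1" "(0 :: 'a bop)\<^sup>\<dagger> = 0"
  by (rule cadj_eqI, rule cinner_adjoint')
    (rule cadj_eqI; simp add: cinner_adjoint cinner_adjoint' cinner_add_left cinner_add_right
      cinner_diff_left cinner_diff_right)+

lemma cadj_sum: "(\<Sum>i\<in>I. f i)\<^sup>\<dagger> = (\<Sum>i\<in>I. (f i :: 'a::chilbert_space bop)\<^sup>\<dagger>)"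
  by (induction I rule: infinite_finite_induct) auto

lemma norm_cadj [simp]: "norm (A\<^sup>\<dagger>) = norm (A :: 'a::chilbert_space bop)"
proof -
  have le: "norm (A\<^sup>\<dagger>) \<le> norm A" for A :: "'a bop"
  proof (rule norm_bop_le)
    fix y
    define g where "g = bop_apply (A\<^sup>\<dagger>) y"
    show "norm (bop_apply (A\<^sup>\<dagger>) y) \<le> norm A * norm y"
    proof (cases "g = 0")
      case False
      have "(norm g)\<^sup>2 = cmod (cinner (bop_apply A g) y)"
        by (simp add: cinner_adjoint cinner_same norm_power g_def[symmetric])
      also have "\<dots> \<le> norm (bop_apply A g) * norm y" by (rule cinner_Cauchy_Schwarz)
      also have "\<dots> \<le> (norm A * norm g) * norm y" by (intro mult_right_mono norm_bop_apply_le) simp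
      finally show ?thesis using False by (simp add: power2_eq_square mult_ac g_def[symmetric])
    qed (simp add: g_def)
  qed simp
  show ?thesis using le[of A] le[of "A\<^sup>\<dagger>"] by simp
qed

lemma Neumann_invertible:
  fixes X :: "'a::chilbert_space bop"
  assumes X: "norm X < 1"
  obtains Y where "(1 - X) * Y = 1" "Y * (1 - X) = 1"
proof -
  have le: "norm (X ^ n) \<le> norm X ^ n" for n
  proof (induction n)
    case (Suc n)
    have "norm (X ^ Suc n) \<le> norm X * norm (X ^ n)" by (simp add: norm_mult_ineq)
    also have "\<dots> \<le> norm X * norm X ^ n" by (intro mult_left_mono Suc) simp
    finally show ?case by simp
  qed (simp add: norm_bop_one_le)
  have sm: "summable (\<lambda>n. X ^ n)"
    by (rule summable_comparison_test[OF _ summable_geometric[of "norm X"]]) (use X le in auto)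
  define Y where "Y = (\<Sum>n. X ^ n)"
  have S: "(\<lambda>n. X ^ n) sums Y" unfolding Y_def by (rule summable_sums[OF sm])
  have S1: "(\<lambda>n. X ^ Suc n) sums (Y - 1)"
    using S by (subst sums_Suc_iff) simp
  have "(\<lambda>n. X * X ^ n) sums (X * Y)"
    by (rule bounded_linear.sums[OF bounded_linear_mult_right S])
  then have 1: "X * Y = Y - 1" using S1 sums_unique2 by simp
  have "(\<lambda>n. X ^ n * X) sums (Y * X)"
    by (rule bounded_linear.sums[OF bounded_linear_mult_left S])
  then have 2: "Y * X = Y - 1" using S1 sums_unique2 by (simp add: power_commutes)
  show ?thesis by (rule that[of Y]; simp add: 1 2 algebra_simps)
qed

text \<open>For small \<open>t > 0\<close> the operator \<open>1 - t A\<close> is a strict contraction, so \<open>A\<close> is inverted by a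
  Neumann series.\<close>

lemma Lax_Milgram:
  fixes A :: "'a::chilbert_space bop"
  assumes e: "0 < e" and coercive: "\<And>x. e * (norm x)\<^sup>2 \<le> Re (cinner (bop_apply A x) x)"
  obtains Y where "A * Y = 1" "Y * A = 1"
proof -
  define M where "M = norm A + e"
  have M: "M > 0" "e \<le> M" "norm A \<le> M" 
    unfolding M_def using e norm_ge_zero[of A] by linarith+
  \<comment> \<open>This value of \<open>t\<close> minimises the bound \<open>1 - 2 t e + t\<^sup>2 M\<^sup>2\<close> for the square of the norm of \<open>1 - t A\<close>.\<close>
  define t where "t = e / M\<^sup>2"
  have t: "t > 0" unfolding t_def using e M by simp
  define q where "q = 1 - e\<^sup>2 / M\<^sup>2"
  have q: "0 \<le> q" "q < 1" unfolding q_def using e M by (auto simp: field_simps power_mono)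
  have bound: "norm (bop_apply (1 - t *\<^sub>R A) x) \<le> sqrt q * norm x" for x
  proof (rule power2_le_imp_le)
    have "(norm (x - t *\<^sub>R bop_apply A x))\<^sup>2
        = (norm x)\<^sup>2 - 2 * t * Re (cinner (bop_apply A x) x) + t\<^sup>2 * (norm (bop_apply A x))\<^sup>2"
      unfolding norm_sq_eq_inner
      by (simp add: inner_simps inner_commute inner_eq_Re_cinner[symmetric] power2_eq_square)
    also have "\<dots> \<le> (norm x)\<^sup>2 - 2 * t * (e * (norm x)\<^sup>2) + t\<^sup>2 * (M * norm x)\<^sup>2"
    proof -
      have "norm (bop_apply A x) \<le> M * norm x"
        using norm_bop_apply_le[of A x] mult_right_mono[OF M(3), of "norm x"] by simp
      then have "(norm (bop_apply A x))\<^sup>2 \<le> (M * norm x)\<^sup>2" by (intro power_mono) auto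
      then have "t\<^sup>2 * (norm (bop_apply A x))\<^sup>2 \<le> t\<^sup>2 * (M * norm x)\<^sup>2" by (intro mult_left_mono) auto
      moreover have "t * (e * (norm x)\<^sup>2) \<le> t * Re (cinner (bop_apply A x) x)"
        using t coercive by (intro mult_left_mono) auto
      ultimately show ?thesis by simp
    qed
    also have "\<dots> = q * (norm x)\<^sup>2"
      unfolding t_def q_def using M by (simp add: field_simps power2_eq_square)
    finally show "(norm (bop_apply (1 - t *\<^sub>R A) x))\<^sup>2 \<le> (sqrt q * norm x)\<^sup>2"
      using q by (simp add: power_mult_distrib)
  qed (use q in simp)
  have "norm (1 - t *\<^sub>R A) \<le> sqrt q" by (rule norm_bop_le[OF _ bound]) (use q in simp)
  also have "\<dots> < 1" using q by simp
  finally obtain Y where Y: "(1 - (1 - t *\<^sub>R A)) * Y = 1" "Y * (1 - (1 - t *\<^sub>R A)) = 1"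
    using Neumann_invertible by blast
  show ?thesis by (rule that[of "t *\<^sub>R Y"]; use Y in simp)
qed


section \<open>The algebra of formal series\<close>

lemma splits_eq: "{(\<alpha>, \<beta>). \<alpha> @ \<beta> = \<gamma>} = (\<lambda>i. (take i \<gamma>, drop i \<gamma>)) ` {..length \<gamma>}"
proof (intro equalityI subsetI)
  fix p assume "p \<in> {(\<alpha>, \<beta>). \<alpha> @ \<beta> = \<gamma>}"
  then show "p \<in> (\<lambda>i. (take i \<gamma>, drop i \<gamma>)) ` {..length \<gamma>}"
    by (intro image_eqI[of _ _ "length (fst p)"]) auto
qed auto

lemma finite_splits [simp]: "finite {(\<alpha>, \<beta>). \<alpha> @ \<beta> = \<gamma>}"
  unfolding splits_eq by simp

lemma sum_splits:
  "(\<Sum>(\<alpha>, \<beta>) | \<alpha> @ \<beta> = \<gamma>. f \<alpha> \<beta>) = (\<Sum>i\<le>length \<gamma>. f (take i \<gamma>) (drop i \<gamma>))"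
proof -
  have "inj_on (\<lambda>i. (take i \<gamma>, drop i \<gamma>)) {..length \<gamma>}"
    by (rule inj_onI) (metis (no_types, lifting) Pair_inject atMost_iff length_take min.absorb2)
  then show ?thesis unfolding splits_eq by (simp add: sum.reindex)
qed

lemma sum_splits_Nil [simp]: "(\<Sum>(\<alpha>, \<beta>) | \<alpha> @ \<beta> = []. f \<alpha> \<beta>) = f [] []"
  unfolding sum_splits by simp

lemma sum_splits_Cons:
  "(\<Sum>(\<alpha>, \<beta>) | \<alpha> @ \<beta> = k # \<gamma>. f \<alpha> \<beta>) = f [] (k # \<gamma>) + (\<Sum>(\<alpha>, \<beta>) | \<alpha> @ \<beta> = \<gamma>. f (k # \<alpha>) \<beta>)"
  unfolding sum_splits by (simp add: sum.atMost_Suc_shift del: sum.atMost_Suc)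

lemma sum_splits_add:
  "(\<Sum>(\<alpha>, \<beta>) | \<alpha> @ \<beta> = \<gamma>. f \<alpha> \<beta> + g \<alpha> \<beta>)
    = (\<Sum>(\<alpha>, \<beta>) | \<alpha> @ \<beta> = \<gamma>. f \<alpha> \<beta>) + (\<Sum>(\<alpha>, \<beta>) | \<alpha> @ \<beta> = \<gamma>. g \<alpha> \<beta>)"
  by (simp add: sum_splits sum.distrib)

lemma sum_splits_assoc:
  "(\<Sum>(\<sigma>, \<delta>) | \<sigma> @ \<delta> = \<gamma>. \<Sum>(\<alpha>, \<beta>) | \<alpha> @ \<beta> = \<sigma>. f \<alpha> \<beta> \<delta>)
    = (\<Sum>(\<alpha>, \<sigma>) | \<alpha> @ \<sigma> = \<gamma>. \<Sum>(\<beta>, \<delta>) | \<beta> @ \<delta> = \<sigma>. f \<alpha> \<beta> \<delta>)"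
proof (induction \<gamma> arbitrary: f)
  case (Cons k \<gamma>)
  show ?case
    unfolding sum_splits_Cons
    using Cons[of "\<lambda>\<alpha>. f (k # \<alpha>)"]
    by (simp add: sum_splits_add add.assoc)
qed simp

lemma series_mult_Nil [simp]: "(M *\<^sub>S F) [] = M [] * F []"
  unfolding series_mult_def by simp

lemma series_mult_assoc: "(M *\<^sub>S N) *\<^sub>S F = M *\<^sub>S (N *\<^sub>S F)"
proof
  fix \<gamma>
  show "((M *\<^sub>S N) *\<^sub>S F) \<gamma> = (M *\<^sub>S (N *\<^sub>S F)) \<gamma>"
    using sum_splits_assoc[of "\<lambda>\<alpha> \<beta> \<delta>. M \<alpha> * N \<beta> * F \<delta>" \<gamma>]
    by (simp add: series_mult_def sum_distrib_left sum_distrib_right mult.assoc case_prod_unfold)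
qed

lemma left_mult_series_mult: "left_mult (M *\<^sub>S N) F = left_mult M (left_mult N F)"
proof
  fix \<gamma>
  show "left_mult (M *\<^sub>S N) F \<gamma> = left_mult M (left_mult N F) \<gamma>"
    using sum_splits_assoc[of "\<lambda>\<alpha> \<beta> \<delta>. bop_apply (M \<alpha>) (bop_apply (N \<beta>) (F \<delta>))" \<gamma>]
    by (simp add: series_mult_def left_mult_def bop_apply_sum bop_apply_sum_op case_prod_unfold)
qed

lemma series_mult_one_left [simp]: "series_const 1 *\<^sub>S M = M"
proof
  fix \<gamma> show "(series_const 1 *\<^sub>S M) \<gamma> = M \<gamma>"
    by (cases \<gamma>) (simp_all add: series_mult_def series_const_def sum_splits_Cons, (simp add: sum_splits)?)
qed

lemma series_mult_one_right [simp]: "M *\<^sub>S series_const 1 = M"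
proof
  fix \<gamma> show "(M *\<^sub>S series_const 1) \<gamma> = M \<gamma>"
  proof (induction \<gamma> arbitrary: M)
    case (Cons k \<gamma>)
    from Cons[of "\<lambda>\<alpha>. M (k # \<alpha>)"] show ?case
      by (simp add: series_mult_def sum_splits_Cons) (simp add: series_const_def)
  qed (simp add: series_const_def)
qed

lemma left_mult_const [simp]: "left_mult (series_const A) F \<gamma> = bop_apply A (F \<gamma>)"
  by (cases \<gamma>) (simp_all add: left_mult_def series_const_def sum_splits_Cons, (simp add: sum_splits)?)

lemma series_mult_distrib:
  "(\<lambda>\<alpha>. M \<alpha> + N \<alpha>) *\<^sub>S F = (\<lambda>\<alpha>. (M *\<^sub>S F) \<alpha> + (N *\<^sub>S F) \<alpha>)"
  "(\<lambda>\<alpha>. M \<alpha> - N \<alpha>) *\<^sub>S F = (\<lambda>\<alpha>. (M *\<^sub>S F) \<alpha> - (N *\<^sub>S F) \<alpha>)"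
  "M *\<^sub>S (\<lambda>\<alpha>. F \<alpha> + G \<alpha>) = (\<lambda>\<alpha>. (M *\<^sub>S F) \<alpha> + (M *\<^sub>S G) \<alpha>)"
  "M *\<^sub>S (\<lambda>\<alpha>. F \<alpha> - G \<alpha>) = (\<lambda>\<alpha>. (M *\<^sub>S F) \<alpha> - (M *\<^sub>S G) \<alpha>)"
  "(\<lambda>\<alpha>. r *\<^sub>R M \<alpha>) *\<^sub>S F = (\<lambda>\<alpha>. r *\<^sub>R (M *\<^sub>S F) \<alpha>)"
  "M *\<^sub>S (\<lambda>\<alpha>. r *\<^sub>R F \<alpha>) = (\<lambda>\<alpha>. r *\<^sub>R (M *\<^sub>S F) \<alpha>)"
  by (rule ext, simp add: series_mult_def case_prod_unfold algebra_simps sum.distrib sum_subtractf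
      scaleR_sum_right)+

lemma left_mult_distrib:
  "left_mult (\<lambda>\<alpha>. M \<alpha> + N \<alpha>) F \<gamma> = left_mult M F \<gamma> + left_mult N F \<gamma>"
  "left_mult (\<lambda>\<alpha>. M \<alpha> - N \<alpha>) F \<gamma> = left_mult M F \<gamma> - left_mult N F \<gamma>"
  by (simp_all add: left_mult_def case_prod_unfold sum.distrib sum_subtractf)

lemma left_mult_cong_length:
  assumes "\<And>\<beta>. length \<beta> \<le> length \<gamma> \<Longrightarrow> F \<beta> = G \<beta>"
  shows "left_mult M F \<gamma> = left_mult M G \<gamma>"
  unfolding left_mult_def by (rule sum.cong) (auto intro!: arg_cong[where f="bop_apply _"] assms)

lemma series_inverse_pair_unique:
  assumes "series_inverse_pair M N" "series_inverse_pair M N'"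
  shows "N = N'"
proof -
  have NM: "N *\<^sub>S M = series_const 1" and MN': "M *\<^sub>S N' = series_const 1"
    using assms by (auto simp: series_inverse_pair_def)
  have "N *\<^sub>S (M *\<^sub>S N') = N'" unfolding series_mult_assoc[symmetric] NM by simp
  then show ?thesis unfolding MN' by simp
qed

lemma series_inverse_eqI: "series_inverse_pair M N \<Longrightarrow> series_inverse M = N"
  unfolding series_inverse_def by (rule the_equality) (auto intro: series_inverse_pair_unique)

text \<open>The coefficients of a right inverse are determined successively by the equation
  \<open>(M N)\<^sub>\<gamma> = 0\<close> for \<open>\<gamma> \<noteq> \<emptyset>\<close>, solved for \<open>N\<^sub>\<gamma>\<close>; \<open>Y\<close> is the inverse of the constant coefficient.\<close>

fun right_inverse :: "'a::complex_inner bop \<Rightarrow> ('d, 'a) series \<Rightarrow> ('d, 'a) series" where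
  "right_inverse Y M [] = Y"
| "right_inverse Y M (k # \<gamma>)
    = - (Y * (\<Sum>i\<in>{..length \<gamma>}. M (k # take i \<gamma>) * right_inverse Y M (drop i \<gamma>)))"

lemma series_mult_right_inverse:
  assumes "M [] * Y = 1"
  shows "M *\<^sub>S right_inverse Y M = series_const 1"
proof
  fix \<gamma> show "(M *\<^sub>S right_inverse Y M) \<gamma> = series_const 1 \<gamma>"
  proof (cases \<gamma>)
    case (Cons k \<delta>)
    have "M [] * - (Y * X) = - X" for X
      using assms by (simp flip: mult.assoc)
    then show ?thesis
      unfolding Cons series_mult_def sum_splits_Cons right_inverse.simps
      by (simp add: series_const_def sum_splits)
  qed (simp add: assms series_const_def)
qed

lemma series_invertible_if_const_invertible:
  assumes Y: "M [] * Y = 1" "Y * M [] = 1"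
  shows "series_inverse_pair M (series_inverse M)"
proof -
  define N where "N = right_inverse Y M"
  have MN: "M *\<^sub>S N = series_const 1"
    unfolding N_def by (rule series_mult_right_inverse) (rule Y)
  have NM: "N *\<^sub>S right_inverse (M []) N = series_const 1"
    by (rule series_mult_right_inverse) (simp add: N_def Y)
  have "M = M *\<^sub>S (N *\<^sub>S right_inverse (M []) N)" by (simp add: NM)
  also have "\<dots> = right_inverse (M []) N" by (simp add: MN flip: series_mult_assoc)
  finally have "series_inverse_pair M N" using MN NM by (simp add: series_inverse_pair_def)
  with series_inverse_eqI[OF this] show ?thesis by simp
qed

section \<open>The Cayley transform\<close>

text \<open>Since \<open>1 + B = 2 - (1 - B)\<close> and \<open>H - 1 = (H + 1) - 2\<close>, both transforms are affine functions of an
  inverse: \<open>H = 2 (1 - B)\<inverse> - 1\<close> and \<open>B = 1 - 2 (H + 1)\<inverse>\<close>.\<close>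

lemma Cayley_schur_to_herglotz:
  assumes inv: "series_inverse_pair (\<lambda>\<alpha>. series_const 1 \<alpha> - B \<alpha>) N"
    and H: "H = series_inverse (\<lambda>\<alpha>. series_const 1 \<alpha> - B \<alpha>) *\<^sub>S (\<lambda>\<alpha>. series_const 1 \<alpha> + B \<alpha>)"
  shows "H = (\<lambda>\<alpha>. 2 *\<^sub>R N \<alpha> - series_const 1 \<alpha>)"
    and "H *\<^sub>S (\<lambda>\<alpha>. series_const 1 \<alpha> - B \<alpha>) = (\<lambda>\<alpha>. series_const 1 \<alpha> + B \<alpha>)"
    and "series_inverse_pair (\<lambda>\<alpha>. H \<alpha> + series_const 1 \<alpha>) (\<lambda>\<alpha>. (1/2) *\<^sub>R (series_const 1 \<alpha> - B \<alpha>))"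
    and "series_inverse (\<lambda>\<alpha>. H \<alpha> + series_const 1 \<alpha>) *\<^sub>S (\<lambda>\<alpha>. H \<alpha> - series_const 1 \<alpha>) = B"
proof -
  let ?D = "\<lambda>\<alpha>. series_const 1 \<alpha> - B \<alpha>"
  have N: "?D *\<^sub>S N = series_const 1" "N *\<^sub>S ?D = series_const 1"
    using inv by (auto simp: series_inverse_pair_def)
  have D: "(\<lambda>\<alpha>. series_const 1 \<alpha> + B \<alpha>) = (\<lambda>\<alpha>. 2 *\<^sub>R series_const 1 \<alpha> - ?D \<alpha>)"
    by (rule ext) (simp add: scaleR_2)
  show 1: "H = (\<lambda>\<alpha>. 2 *\<^sub>R N \<alpha> - series_const 1 \<alpha>)"
    unfolding H series_inverse_eqI[OF inv] D
      series_mult_distrib(4)[of _ "\<lambda>\<alpha>. 2 *\<^sub>R series_const 1 \<alpha>"] series_mult_distrib(6) N by simp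
  show "H *\<^sub>S ?D = (\<lambda>\<alpha>. series_const 1 \<alpha> + B \<alpha>)"
    unfolding 1 series_mult_distrib(2)[of "\<lambda>\<alpha>. 2 *\<^sub>R N \<alpha>"] series_mult_distrib(5) N D by simp
  have H1: "(\<lambda>\<alpha>. H \<alpha> + series_const 1 \<alpha>) = (\<lambda>\<alpha>. 2 *\<^sub>R N \<alpha>)" unfolding 1 by simp
  show 2: "series_inverse_pair (\<lambda>\<alpha>. H \<alpha> + series_const 1 \<alpha>) (\<lambda>\<alpha>. (1/2) *\<^sub>R ?D \<alpha>)"
    unfolding H1 series_inverse_pair_def series_mult_distrib(5,6) N by simp
  have H2: "(\<lambda>\<alpha>. H \<alpha> - series_const 1 \<alpha>) = (\<lambda>\<alpha>. 2 *\<^sub>R N \<alpha> - 2 *\<^sub>R series_const 1 \<alpha>)"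
    unfolding 1 by (rule ext) (simp add: scaleR_2)
  show "series_inverse (\<lambda>\<alpha>. H \<alpha> + series_const 1 \<alpha>) *\<^sub>S (\<lambda>\<alpha>. H \<alpha> - series_const 1 \<alpha>) = B"
    unfolding series_inverse_eqI[OF 2] H2 series_mult_distrib(4)[of _ "\<lambda>\<alpha>. 2 *\<^sub>R N \<alpha>"]
      series_mult_distrib(5,6) N by simp
qed

lemma Cayley_herglotz_to_schur:
  assumes inv: "series_inverse_pair (\<lambda>\<alpha>. H \<alpha> + series_const 1 \<alpha>) N"
    and B: "B = series_inverse (\<lambda>\<alpha>. H \<alpha> + series_const 1 \<alpha>) *\<^sub>S (\<lambda>\<alpha>. H \<alpha> - series_const 1 \<alpha>)"
  shows "B = (\<lambda>\<alpha>. series_const 1 \<alpha> - 2 *\<^sub>R N \<alpha>)"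
    and "B *\<^sub>S (\<lambda>\<alpha>. H \<alpha> + series_const 1 \<alpha>) = (\<lambda>\<alpha>. H \<alpha> - series_const 1 \<alpha>)"
    and "series_inverse_pair (\<lambda>\<alpha>. series_const 1 \<alpha> - B \<alpha>) (\<lambda>\<alpha>. (1/2) *\<^sub>R (H \<alpha> + series_const 1 \<alpha>))"
    and "series_inverse (\<lambda>\<alpha>. series_const 1 \<alpha> - B \<alpha>) *\<^sub>S (\<lambda>\<alpha>. series_const 1 \<alpha> + B \<alpha>) = H"
proof -
  let ?D = "\<lambda>\<alpha>. H \<alpha> + series_const 1 \<alpha>"
  have N: "?D *\<^sub>S N = series_const 1" "N *\<^sub>S ?D = series_const 1"
    using inv by (auto simp: series_inverse_pair_def)
  have D: "(\<lambda>\<alpha>. H \<alpha> - series_const 1 \<alpha>) = (\<lambda>\<alpha>. ?D \<alpha> - 2 *\<^sub>R series_const 1 \<alpha>)"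
    by (rule ext) (simp add: scaleR_2)
  show 1: "B = (\<lambda>\<alpha>. series_const 1 \<alpha> - 2 *\<^sub>R N \<alpha>)"
    unfolding B series_inverse_eqI[OF inv] D series_mult_distrib(4)[of _ ?D] series_mult_distrib(6) N
    by simp
  show "B *\<^sub>S ?D = (\<lambda>\<alpha>. H \<alpha> - series_const 1 \<alpha>)"
    unfolding 1 series_mult_distrib(2) series_mult_distrib(5)[of _ N] N D by simp
  have H1: "(\<lambda>\<alpha>. series_const 1 \<alpha> - B \<alpha>) = (\<lambda>\<alpha>. 2 *\<^sub>R N \<alpha>)" unfolding 1 by simp
  show 2: "series_inverse_pair (\<lambda>\<alpha>. series_const 1 \<alpha> - B \<alpha>) (\<lambda>\<alpha>. (1/2) *\<^sub>R ?D \<alpha>)"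
    unfolding H1 series_inverse_pair_def series_mult_distrib(5)[of _ N] series_mult_distrib(6)[of _ _ ?D]
      series_mult_distrib(5)[of _ ?D] series_mult_distrib(6)[of _ _ N] N by simp
  have H2: "(\<lambda>\<alpha>. series_const 1 \<alpha> + B \<alpha>) = (\<lambda>\<alpha>. 2 *\<^sub>R series_const 1 \<alpha> - 2 *\<^sub>R N \<alpha>)"
    unfolding 1 by (rule ext) (simp add: scaleR_2)
  show "series_inverse (\<lambda>\<alpha>. series_const 1 \<alpha> - B \<alpha>) *\<^sub>S (\<lambda>\<alpha>. series_const 1 \<alpha> + B \<alpha>) = H"
    unfolding series_inverse_eqI[OF 2] H2 series_mult_distrib(4)[of _ "\<lambda>\<alpha>. 2 *\<^sub>R series_const 1 \<alpha>"]
      series_mult_distrib(5)[of _ ?D] series_mult_distrib(6)[of _ _ N]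
      series_mult_distrib(6)[of _ _ "series_const 1"] N by simp
qed


section \<open>Contractivity and positivity on truncations\<close>

definition words :: "nat \<Rightarrow> 'd::finite list set"
  where "words N = {\<alpha>. length \<alpha> \<le> N}"

lemma finite_words [simp]: "finite (words N :: 'd::finite list set)"
  unfolding words_def using finite_lists_length_le[of "UNIV :: 'd set" N] by simp

lemma finite_words_eq [simp]: "finite {\<alpha> :: 'd::finite list. length \<alpha> = m}"
  using finite_lists_length_eq[of "UNIV :: 'd set" m] by simp

lemma finite_subset_words:
  assumes "finite (A :: 'd::finite list set)"
  obtains N where "A \<subseteq> words N"
proof (rule that)
  show "A \<subseteq> words (Max (length ` A))" unfolding words_def using assms by auto
qed

lemma ex_ell2_finite_support:
  fixes g :: "'i \<Rightarrow> 'a::complex_inner"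
  assumes A: "finite A"
  obtains F where "ell2_coeff F = (\<lambda>i. if i \<in> A then g i else 0)"
    "(norm F)\<^sup>2 = (\<Sum>i\<in>A. (norm (g i))\<^sup>2)"
proof -
  have "(\<lambda>i. (norm (if i \<in> A then g i else 0))\<^sup>2) summable_on UNIV"
    by (rule summable_on_cong_neutral[THEN iffD1, OF _ _ _ summable_on_finite[OF A]]) auto
  then have F: "ell2_coeff (Abs_ell2 (\<lambda>i. if i \<in> A then g i else 0)) = (\<lambda>i. if i \<in> A then g i else 0)"
    by (simp add: Abs_ell2_inverse)
  have "(norm (Abs_ell2 (\<lambda>i. if i \<in> A then g i else 0)))\<^sup>2 = (\<Sum>\<^sub>\<infinity>i\<in>A. (norm (g i))\<^sup>2)"
    unfolding norm_ell2_sq F by (rule infsum_cong_neutral) auto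
  also have "\<dots> = (\<Sum>i\<in>A. (norm (g i))\<^sup>2)" using A by simp
  finally show ?thesis using F by (intro that)
qed

lemma ex_ell2:
  fixes g :: "'i \<Rightarrow> 'a::complex_inner"
  assumes b: "0 \<le> b" "\<And>A. finite A \<Longrightarrow> (\<Sum>i\<in>A. (norm (g i))\<^sup>2) \<le> b\<^sup>2"
  obtains F where "ell2_coeff F = g" "norm F \<le> b"
proof -
  have "(\<lambda>i. (norm (g i))\<^sup>2) summable_on UNIV"
    by (rule nonneg_bdd_above_summable_on) (auto intro!: bdd_aboveI2 b)
  then have F: "ell2_coeff (Abs_ell2 g) = g" by (simp add: Abs_ell2_inverse)
  show ?thesis by (rule that[OF F], rule norm_ell2_le) (use b F in auto)
qed

text \<open>Left multiplication is lower triangular with respect to the length of words, so its truncation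
  to the words of length at most \<open>N\<close> only depends on the truncation of the argument.\<close>

lemma left_schur_iff:
  fixes B :: "('d::finite, 'a::complex_inner) series"
  shows "B \<in> left_schur \<longleftrightarrow>
    (\<forall>N g. (\<Sum>\<alpha>\<in>words N. (norm (left_mult B g \<alpha>))\<^sup>2) \<le> (\<Sum>\<alpha>\<in>words N. (norm (g \<alpha>))\<^sup>2))"
    (is "_ \<longleftrightarrow> (\<forall>N g. ?B N g \<le> ?I N g)")
proof
  assume B: "B \<in> left_schur"
  show "\<forall>N g. ?B N g \<le> ?I N g"
  proof (intro allI)
    fix N and g :: "'d list \<Rightarrow> 'a"
    obtain F where F: "ell2_coeff F = (\<lambda>\<alpha>. if \<alpha> \<in> words N then g \<alpha> else 0)"
      "(norm F)\<^sup>2 = (\<Sum>\<alpha>\<in>words N. (norm (g \<alpha>))\<^sup>2)"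
      using ex_ell2_finite_support[OF finite_words] by blast
    obtain G where G: "ell2_coeff G = left_mult B (ell2_coeff F)" "norm G \<le> norm F"
      using B unfolding left_schur_def ell2_contraction_def by blast
    have "left_mult B g \<alpha> = ell2_coeff G \<alpha>" if "\<alpha> \<in> words N" for \<alpha>
      unfolding G F by (rule left_mult_cong_length) (use that in \<open>auto simp: words_def\<close>)
    then have "?B N g = (\<Sum>\<alpha>\<in>words N. (norm (ell2_coeff G \<alpha>))\<^sup>2)"
      by simp
    also have "\<dots> \<le> (norm G)\<^sup>2" by (rule norm_ell2_finite_le) simp
    also have "\<dots> \<le> (norm F)\<^sup>2" using G by (intro power_mono) auto
    finally show "?B N g \<le> ?I N g"
      by (simp add: F)
  qed
next
  assume B: "\<forall>N g. ?B N g \<le> ?I N g"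
  show "B \<in> left_schur" unfolding left_schur_def ell2_contraction_def mem_Collect_eq
  proof
    fix F :: "('d list, 'a) ell2"
    have "(\<Sum>\<alpha>\<in>A. (norm (left_mult B (ell2_coeff F) \<alpha>))\<^sup>2) \<le> (norm F)\<^sup>2" if A: "finite A" for A
    proof -
      obtain N where "A \<subseteq> words N" using finite_subset_words[OF A] .
      then have "(\<Sum>\<alpha>\<in>A. (norm (left_mult B (ell2_coeff F) \<alpha>))\<^sup>2)
          \<le> (\<Sum>\<alpha>\<in>words N. (norm (left_mult B (ell2_coeff F) \<alpha>))\<^sup>2)"
        by (intro sum_mono2) auto
      also have "\<dots> \<le> (\<Sum>\<alpha>\<in>words N. (norm (ell2_coeff F \<alpha>))\<^sup>2)" using B by blast
      also have "\<dots> \<le> (norm F)\<^sup>2" by (rule norm_ell2_finite_le) simp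
      finally show ?thesis .
    qed
    then obtain G where "ell2_coeff G = left_mult B (ell2_coeff F)" "norm G \<le> norm F"
      using ex_ell2[of "norm F" "left_mult B (ell2_coeff F)"] by auto
    then show "\<exists>G. ell2_coeff G = left_mult B (ell2_coeff F) \<and> norm G \<le> norm F" by blast
  qed
qed

lemma finite_left_quotient [simp]: "finite {\<gamma>. \<gamma> @ \<beta> = \<alpha>}"
proof (rule finite_subset)
  show "{\<gamma>. \<gamma> @ \<beta> = \<alpha>} \<subseteq> (\<lambda>i. take i \<alpha>) ` {..length \<alpha>}"
  proof
    fix \<gamma> assume "\<gamma> \<in> {\<gamma>. \<gamma> @ \<beta> = \<alpha>}"
    then show "\<gamma> \<in> (\<lambda>i. take i \<alpha>) ` {..length \<alpha>}" by (intro image_eqI[of _ _ "length \<gamma>"]) auto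
  qed
qed simp

lemma sum_left_quotients:
  assumes F: "finite F" and g: "\<And>\<gamma> \<beta>. \<beta> \<notin> F \<Longrightarrow> f \<gamma> \<beta> = 0"
  shows "(\<Sum>\<beta>\<in>F. \<Sum>\<gamma> | \<gamma> @ \<beta> = \<alpha>. f \<gamma> \<beta>) = (\<Sum>(\<gamma>, \<beta>) | \<gamma> @ \<beta> = \<alpha>. f \<gamma> \<beta>)"
proof -
  have "(\<Sum>\<beta>\<in>F. \<Sum>\<gamma> | \<gamma> @ \<beta> = \<alpha>. f \<gamma> \<beta>) = (\<Sum>(\<beta>, \<gamma>)\<in>Sigma F (\<lambda>\<beta>. {\<gamma>. \<gamma> @ \<beta> = \<alpha>}). f \<gamma> \<beta>)"
    by (rule sum.Sigma) (use F in auto)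
  also have "\<dots> = (\<Sum>(\<gamma>, \<beta>)\<in>{(\<gamma>, \<beta>). \<gamma> @ \<beta> = \<alpha> \<and> \<beta> \<in> F}. f \<gamma> \<beta>)"
    by (rule sum.reindex_bij_witness[where i=prod.swap and j=prod.swap]) auto
  also have "\<dots> = (\<Sum>(\<gamma>, \<beta>) | \<gamma> @ \<beta> = \<alpha>. f \<gamma> \<beta>)"
  proof (rule sum.mono_neutral_left)
    show "\<forall>p\<in>{(\<gamma>, \<beta>). \<gamma> @ \<beta> = \<alpha>} - {(\<gamma>, \<beta>). \<gamma> @ \<beta> = \<alpha> \<and> \<beta> \<in> F}. (case p of (\<gamma>, \<beta>) \<Rightarrow> f \<gamma> \<beta>) = 0"
      by clarsimp (rule ccontr, simp add: g)
  qed auto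
  finally show ?thesis .
qed

text \<open>The kernel is the real part of the matrix \<open>(T\<^sub>\<alpha>\<^sub>,\<^sub>\<beta>)\<close> of left multiplication by \<open>H\<close>, whose entry is
  \<open>H\<^sub>\<gamma>\<close> if \<open>\<alpha> = \<gamma>\<beta>\<close>.\<close>

lemma left_herglotz_kernel_form:
  fixes H :: "('d, 'a::chilbert_space) series"
  assumes F: "finite F"
  shows "(\<Sum>\<alpha>\<in>F. \<Sum>\<beta>\<in>F. cinner (bop_apply (left_herglotz_kernel H \<alpha> \<beta>) (h \<beta>)) (h \<alpha>))
    = of_real (Re (\<Sum>\<alpha>\<in>F. cinner (left_mult H (\<lambda>\<beta>. if \<beta> \<in> F then h \<beta> else 0) \<alpha>) (h \<alpha>)))"
proof -
  define g where "g \<beta> = (if \<beta> \<in> F then h \<beta> else 0)" for \<beta>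
  define s where "s \<alpha> \<beta> = (\<Sum>\<gamma> | \<gamma> @ \<beta> = \<alpha>. cinner (bop_apply (H \<gamma>) (g \<beta>)) (h \<alpha>))" for \<alpha> \<beta>
  have row: "(\<Sum>\<beta>\<in>F. s \<alpha> \<beta>) = cinner (left_mult H g \<alpha>) (h \<alpha>)" for \<alpha>
    unfolding s_def
    by (subst sum_left_quotients[OF F])
      (auto simp: left_mult_def g_def cinner_sum_left case_prod_unfold)
  have entry: "cinner (bop_apply (left_herglotz_kernel H \<alpha> \<beta>) (h \<beta>)) (h \<alpha>) = (s \<alpha> \<beta> + cnj (s \<beta> \<alpha>)) / 2"
    if "\<alpha> \<in> F" "\<beta> \<in> F" for \<alpha> \<beta>
  proof -
    have "cinner (bop_apply (\<Sum>\<gamma> | \<gamma> @ \<alpha> = \<beta>. (H \<gamma>)\<^sup>\<dagger>) (h \<beta>)) (h \<alpha>)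
        = (\<Sum>\<gamma> | \<gamma> @ \<alpha> = \<beta>. cnj (cinner (bop_apply (H \<gamma>) (h \<alpha>)) (h \<beta>)))"
      unfolding bop_apply_sum_op cinner_sum_left cinner_adjoint'
      by (rule sum.cong[OF refl], rule cinner_commute)
    then show ?thesis
      using that unfolding left_herglotz_kernel_def s_def g_def
      by (simp add: cinner_add_left) (simp add: bop_apply_sum_op cinner_sum_left cnj_sum)
  qed
  have "(\<Sum>\<alpha>\<in>F. \<Sum>\<beta>\<in>F. cinner (bop_apply (left_herglotz_kernel H \<alpha> \<beta>) (h \<beta>)) (h \<alpha>))
      = (\<Sum>\<alpha>\<in>F. \<Sum>\<beta>\<in>F. (s \<alpha> \<beta> + cnj (s \<beta> \<alpha>)) / 2)"
    by (simp add: entry)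
  also have "\<dots> = ((\<Sum>\<alpha>\<in>F. \<Sum>\<beta>\<in>F. s \<alpha> \<beta>) + (\<Sum>\<alpha>\<in>F. \<Sum>\<beta>\<in>F. cnj (s \<beta> \<alpha>))) / 2"
    by (simp add: sum.distrib sum_divide_distrib[symmetric])
  also have "(\<Sum>\<alpha>\<in>F. \<Sum>\<beta>\<in>F. cnj (s \<beta> \<alpha>)) = cnj (\<Sum>\<alpha>\<in>F. \<Sum>\<beta>\<in>F. s \<alpha> \<beta>)"
    by (subst sum.swap) simp
  also have "((\<Sum>\<alpha>\<in>F. \<Sum>\<beta>\<in>F. s \<alpha> \<beta>) + cnj (\<Sum>\<alpha>\<in>F. \<Sum>\<beta>\<in>F. s \<alpha> \<beta>)) / 2 = of_real (Re (\<Sum>\<alpha>\<in>F. \<Sum>\<beta>\<in>F. s \<alpha> \<beta>))"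
    unfolding complex_add_cnj by (simp del: Re_sum)
  finally show ?thesis unfolding row g_def .
qed

text \<open>A truncation of a formal vector is finitely supported, and conversely a finitely supported vector
  is its own truncation; so the kernel is positive if and only if all truncations of left multiplication
  by \<open>H\<close> are accretive.\<close>

lemma positive_left_herglotz_kernel_iff:
  fixes H :: "('d::finite, 'a::chilbert_space) series"
  shows "positive_kernel (left_herglotz_kernel H) \<longleftrightarrow>
    (\<forall>N g. 0 \<le> Re (\<Sum>\<alpha>\<in>words N. cinner (left_mult H g \<alpha>) (g \<alpha>)))"
proof
  assume H: "positive_kernel (left_herglotz_kernel H)"
  show "\<forall>N g. 0 \<le> Re (\<Sum>\<alpha>\<in>words N. cinner (left_mult H g \<alpha>) (g \<alpha>))"
  proof (intro allI)
    fix N and g :: "'d list \<Rightarrow> 'a"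
    have "left_mult H (\<lambda>\<beta>. if \<beta> \<in> words N then g \<beta> else 0) \<alpha> = left_mult H g \<alpha>" if "\<alpha> \<in> words N" for \<alpha>
      by (rule left_mult_cong_length) (use that in \<open>auto simp: words_def\<close>)
    then have "(\<Sum>\<alpha>\<in>words N. cinner (left_mult H (\<lambda>\<beta>. if \<beta> \<in> words N then g \<beta> else 0) \<alpha>) (g \<alpha>))
        = (\<Sum>\<alpha>\<in>words N. cinner (left_mult H g \<alpha>) (g \<alpha>))"
      by simp
    moreover have "complex_of_real (Re (\<Sum>\<alpha>\<in>words N.
        cinner (left_mult H (\<lambda>\<beta>. if \<beta> \<in> words N then g \<beta> else 0) \<alpha>) (g \<alpha>))) \<in> \<real>\<^sub>\<ge>\<^sub>0"
      unfolding left_herglotz_kernel_form[OF finite_words, symmetric]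
      using H finite_words unfolding positive_kernel_def by blast
    ultimately show "0 \<le> Re (\<Sum>\<alpha>\<in>words N. cinner (left_mult H g \<alpha>) (g \<alpha>))"
      by (metis nonneg_Reals_of_real_iff)
  qed
next
  assume H: "\<forall>N g. 0 \<le> Re (\<Sum>\<alpha>\<in>words N. cinner (left_mult H g \<alpha>) (g \<alpha>))"
  show "positive_kernel (left_herglotz_kernel H)" unfolding positive_kernel_def
  proof (intro allI impI)
    fix F :: "'d list set" and h :: "'d list \<Rightarrow> 'a" assume F: "finite F"
    define g where "g \<beta> = (if \<beta> \<in> F then h \<beta> else 0)" for \<beta>
    obtain N where N: "F \<subseteq> words N" using finite_subset_words[OF F] .
    have "(\<Sum>\<alpha>\<in>F. cinner (left_mult H g \<alpha>) (h \<alpha>)) = (\<Sum>\<alpha>\<in>words N. cinner (left_mult H g \<alpha>) (g \<alpha>))"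
      by (rule sum.mono_neutral_cong_left) (use N in \<open>auto simp: g_def\<close>)
    then show "(\<Sum>\<alpha>\<in>F. \<Sum>\<beta>\<in>F. cinner (bop_apply (left_herglotz_kernel H \<alpha> \<beta>) (h \<beta>)) (h \<alpha>)) \<in> \<real>\<^sub>\<ge>\<^sub>0"
      unfolding left_herglotz_kernel_form[OF F] g_def[symmetric] nonneg_Reals_of_real_iff
      using H by simp
  qed
qed

lemma left_mult_inverse:
  assumes "series_inverse_pair M N"
  shows "left_mult M (left_mult N g) = g"
proof -
  have "M *\<^sub>S N = series_const 1" using assms by (simp add: series_inverse_pair_def)
  then show ?thesis unfolding left_mult_series_mult[symmetric] by (intro ext) simp
qed

text \<open>With \<open>g = (1 - B) u\<close> one has \<open>H g = (1 + B) u\<close>, and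
  \<open>Re \<langle>(1 + B) u, (1 - B) u\<rangle> = \<parallel>u\<parallel>\<^sup>2 - \<parallel>B u\<parallel>\<^sup>2\<close>.\<close>

lemma positive_kernel_of_schur:
  fixes B H :: "('d::finite, 'a::chilbert_space) series"
  assumes B: "B \<in> left_schur"
    and inv: "series_inverse_pair (\<lambda>\<alpha>. series_const 1 \<alpha> - B \<alpha>) N"
    and H: "H *\<^sub>S (\<lambda>\<alpha>. series_const 1 \<alpha> - B \<alpha>) = (\<lambda>\<alpha>. series_const 1 \<alpha> + B \<alpha>)"
  shows "positive_kernel (left_herglotz_kernel H)"
  unfolding positive_left_herglotz_kernel_iff
proof (intro allI)
  fix n and g :: "'d list \<Rightarrow> 'a"
  define u where "u = left_mult N g"
  have g: "g = left_mult (\<lambda>\<alpha>. series_const 1 \<alpha> - B \<alpha>) u"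
    unfolding u_def left_mult_inverse[OF inv] ..
  have Hg: "left_mult H g = left_mult (\<lambda>\<alpha>. series_const 1 \<alpha> + B \<alpha>) u"
    unfolding g left_mult_series_mult[symmetric] H ..
  have "Re (cinner (left_mult H g \<alpha>) (g \<alpha>)) = (norm (u \<alpha>))\<^sup>2 - (norm (left_mult B u \<alpha>))\<^sup>2" for \<alpha>
    unfolding Hg unfolding g left_mult_distrib
    by (simp add: inner_eq_Re_cinner[symmetric] norm_sq_eq_inner inner_simps inner_commute)
  then have "Re (\<Sum>\<alpha>\<in>words n. cinner (left_mult H g \<alpha>) (g \<alpha>))
      = (\<Sum>\<alpha>\<in>words n. (norm (u \<alpha>))\<^sup>2) - (\<Sum>\<alpha>\<in>words n. (norm (left_mult B u \<alpha>))\<^sup>2)"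
    by (simp add: sum_subtractf)
  then show "0 \<le> Re (\<Sum>\<alpha>\<in>words n. cinner (left_mult H g \<alpha>) (g \<alpha>))"
    using B unfolding left_schur_iff by simp
qed

text \<open>With \<open>g = (H + 1) u\<close> one has \<open>B g = (H - 1) u\<close>, and
  \<open>\<parallel>(H + 1) u\<parallel>\<^sup>2 - \<parallel>(H - 1) u\<parallel>\<^sup>2 = 4 Re \<langle>H u, u\<rangle>\<close>.\<close>

lemma schur_of_positive_kernel:
  fixes B H :: "('d::finite, 'a::chilbert_space) series"
  assumes H: "positive_kernel (left_herglotz_kernel H)"
    and inv: "series_inverse_pair (\<lambda>\<alpha>. H \<alpha> + series_const 1 \<alpha>) N"
    and B: "B *\<^sub>S (\<lambda>\<alpha>. H \<alpha> + series_const 1 \<alpha>) = (\<lambda>\<alpha>. H \<alpha> - series_const 1 \<alpha>)"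
  shows "B \<in> left_schur"
  unfolding left_schur_iff
proof (intro allI)
  fix n and g :: "'d list \<Rightarrow> 'a"
  define u where "u = left_mult N g"
  have g: "g = left_mult (\<lambda>\<alpha>. H \<alpha> + series_const 1 \<alpha>) u"
    unfolding u_def left_mult_inverse[OF inv] ..
  have Bg: "left_mult B g = left_mult (\<lambda>\<alpha>. H \<alpha> - series_const 1 \<alpha>) u"
    unfolding g left_mult_series_mult[symmetric] B ..
  have "(norm (g \<alpha>))\<^sup>2 - (norm (left_mult B g \<alpha>))\<^sup>2 = 4 * Re (cinner (left_mult H u \<alpha>) (u \<alpha>))" for \<alpha>
    unfolding Bg unfolding g left_mult_distrib
    by (simp add: inner_eq_Re_cinner[symmetric] norm_sq_eq_inner inner_simps inner_commute)
  then have "(\<Sum>\<alpha>\<in>words n. (norm (g \<alpha>))\<^sup>2) - (\<Sum>\<alpha>\<in>words n. (norm (left_mult B g \<alpha>))\<^sup>2)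
      = 4 * Re (\<Sum>\<alpha>\<in>words n. cinner (left_mult H u \<alpha>) (u \<alpha>))"
    by (simp add: sum_subtractf[symmetric] sum_distrib_left)
  moreover have "0 \<le> Re (\<Sum>\<alpha>\<in>words n. cinner (left_mult H u \<alpha>) (u \<alpha>))"
    using H unfolding positive_left_herglotz_kernel_iff by blast
  ultimately show "(\<Sum>\<alpha>\<in>words n. (norm (left_mult B g \<alpha>))\<^sup>2) \<le> (\<Sum>\<alpha>\<in>words n. (norm (g \<alpha>))\<^sup>2)"
    by linarith
qed

section \<open>Column bounds\<close>

text \<open>The columns \<open>(M\<^sub>\<alpha>)\<close>, \<open>length \<alpha> = m\<close>, are bounded by \<open>C\<close> uniformly in \<open>m\<close>. This is what Schur
  functions and Herglotz functions have in common, and it suffices for convergence on strict row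
  contractions.\<close>

definition column_bounded :: "real \<Rightarrow> ('d, 'a::complex_inner) series \<Rightarrow> bool"
  where "column_bounded C M \<longleftrightarrow> 0 \<le> C \<and>
    (\<forall>m h. (\<Sum>\<alpha> | length \<alpha> = m. (norm (bop_apply (M \<alpha>) h))\<^sup>2) \<le> (C * norm h)\<^sup>2)"

lemma left_mult_delta: "left_mult M (\<lambda>\<beta>. if \<beta> = [] then h else 0) \<gamma> = bop_apply (M \<gamma>) h"
proof -
  have "left_mult M (\<lambda>\<beta>. if \<beta> = [] then h else 0) \<gamma>
      = (\<Sum>i\<le>length \<gamma>. if i = length \<gamma> then bop_apply (M \<gamma>) h else 0)"
    unfolding left_mult_def sum_splits by (rule sum.cong) auto
  then show ?thesis by simp
qed

lemma left_mult_homogeneous: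
  "left_mult M (\<lambda>\<beta>. if length \<beta> = length \<gamma> then x \<beta> else 0) \<gamma> = bop_apply (M []) (x \<gamma>)"
proof -
  have "left_mult M (\<lambda>\<beta>. if length \<beta> = length \<gamma> then x \<beta> else 0) \<gamma>
      = (\<Sum>i\<le>length \<gamma>. if i = 0 then bop_apply (M []) (x \<gamma>) else 0)"
    unfolding left_mult_def sum_splits by (rule sum.cong) (auto split: if_splits)
  then show ?thesis by simp
qed

lemma left_mult_add: "left_mult M (\<lambda>\<beta>. F \<beta> + G \<beta>) \<gamma> = left_mult M F \<gamma> + left_mult M G \<gamma>"
  unfolding left_mult_def sum_splits by (simp add: sum.distrib)

lemma column_bounded_schur:
  fixes B :: "('d::finite, 'a::complex_inner) series"
  assumes B: "B \<in> left_schur"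
  shows "column_bounded 1 B"
  unfolding column_bounded_def
proof (intro conjI allI)
  fix m and h :: 'a
  have "(\<Sum>\<alpha> | length \<alpha> = m. (norm (bop_apply (B \<alpha>) h))\<^sup>2) \<le> (\<Sum>\<alpha>\<in>words m. (norm (bop_apply (B \<alpha>) h))\<^sup>2)"
    by (rule sum_mono2) (auto simp: words_def[symmetric], auto simp: words_def)
  also have "\<dots> \<le> (\<Sum>\<alpha>\<in>(words m :: 'd list set). (norm (if \<alpha> = [] then h else 0))\<^sup>2)"
    using B[unfolded left_schur_iff, rule_format, of "\<lambda>\<beta>. if \<beta> = [] then h else 0" m]
    by (simp only: left_mult_delta)
  also have "\<dots> = (\<Sum>\<alpha>\<in>(words m :: 'd list set). if \<alpha> = [] then (norm h)\<^sup>2 else 0)"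
    by (rule sum.cong) auto
  also have "\<dots> = (norm h)\<^sup>2" by (simp add: words_def[symmetric]) (simp add: words_def)
  finally show "(\<Sum>\<alpha> | length \<alpha> = m. (norm (bop_apply (B \<alpha>) h))\<^sup>2) \<le> (1 * norm h)\<^sup>2" by simp
qed simp

text \<open>Positivity is tested on the vector with entry \<open>h\<close> at \<open>\<emptyset>\<close> and \<open>- s H\<^sub>\<alpha> h\<close> at the words of
  length \<open>m\<close>; the value \<open>s = 1 / (2 C)\<close> balances the two terms that are quadratic in \<open>H\<^sub>\<alpha> h\<close>.\<close>

lemma column_bounded_positive_kernel:
  fixes H :: "('d::finite, 'a::chilbert_space) series"
  assumes H: "positive_kernel (left_herglotz_kernel H)"
  shows "column_bounded (2 * (norm (H []) + 1)) H"
  unfolding column_bounded_def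
proof (intro conjI allI)
  fix m and h :: 'a
  define C where "C = norm (H []) + 1"
  have C: "C > 0" "norm (H []) \<le> C" unfolding C_def 
    using norm_ge_zero[of "H []"] by linarith+
  have form: "Re (cinner (bop_apply (H []) x) x) \<le> C * (norm x)\<^sup>2" for x
  proof -
    have "Re (cinner (bop_apply (H []) x) x) \<le> norm (bop_apply (H []) x) * norm x"
      by (rule order_trans[OF complex_Re_le_cmod cinner_Cauchy_Schwarz])
    also have "\<dots> \<le> (C * norm x) * norm x"
      using norm_bop_apply_le[of "H []" x] mult_right_mono[OF C(2), of "norm x"]
      by (intro mult_right_mono) auto
    finally show ?thesis by (simp add: power2_eq_square mult.assoc)
  qed
  define S where "S = (\<Sum>\<alpha> | length \<alpha> = m. (norm (bop_apply (H \<alpha>) h))\<^sup>2)"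
  have "S \<le> (2 * C * norm h)\<^sup>2"
  proof (cases "m = 0")
    case True
    have "norm (bop_apply (H []) h) \<le> 2 * C * norm h"
    proof -
      have "norm (bop_apply (H []) h) \<le> C * norm h"
        using norm_bop_apply_le[of "H []" h] mult_right_mono[OF C(2), of "norm h"] by simp
      also have "\<dots> \<le> (2 * C) * norm h" using C by (intro mult_right_mono) auto
      finally show ?thesis .
    qed
    then show ?thesis unfolding S_def True by (simp add: power_mono)
  next
    case False
    define s where "s = 1 / (2 * C)"
    define x where "x \<alpha> = (- s) *\<^sub>R bop_apply (H \<alpha>) h" for \<alpha>
    define g where "g \<alpha> = (if \<alpha> = [] then h else 0) + (if length \<alpha> = m then x \<alpha> else 0)" for \<alpha>
    have gm: "g \<alpha> = x \<alpha>" "left_mult H g \<alpha> = bop_apply (H \<alpha>) h + bop_apply (H []) (x \<alpha>)"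
      if "length \<alpha> = m" for \<alpha>
      using that False unfolding g_def left_mult_add left_mult_delta
      by (auto simp flip: that simp: left_mult_homogeneous)
    have g0: "g [] = h" "left_mult H g [] = bop_apply (H []) h"
      using False by (auto simp: g_def left_mult_def)
    have summand: "Re (cinner (left_mult H g \<alpha>) (g \<alpha>)) \<le> - (1 / (4 * C)) * (norm (bop_apply (H \<alpha>) h))\<^sup>2"
      if "length \<alpha> = m" for \<alpha>
    proof -
      have "Re (cinner (left_mult H g \<alpha>) (g \<alpha>))
          = - s * (norm (bop_apply (H \<alpha>) h))\<^sup>2 + Re (cinner (bop_apply (H []) (x \<alpha>)) (x \<alpha>))"
        unfolding gm[OF that] by (simp add: cinner_add_left cinner_diff_left x_def cinner_same algebra_simps)
      also have "\<dots> \<le> - s * (norm (bop_apply (H \<alpha>) h))\<^sup>2 + C * (norm (x \<alpha>))\<^sup>2"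
        using form[of "x \<alpha>"] by simp
      also have "\<dots> = (- s + C * s\<^sup>2) * (norm (bop_apply (H \<alpha>) h))\<^sup>2"
        unfolding x_def by (simp add: power_mult_distrib algebra_simps)
      also have "- s + C * s\<^sup>2 = - (1 / (4 * C))"
        unfolding s_def using C by (simp add: field_simps power2_eq_square)
      finally show ?thesis .
    qed
    have "0 \<le> Re (\<Sum>\<alpha>\<in>words m. cinner (left_mult H g \<alpha>) (g \<alpha>))"
      using H unfolding positive_left_herglotz_kernel_iff by blast
    also have "(\<Sum>\<alpha>\<in>words m. cinner (left_mult H g \<alpha>) (g \<alpha>))
        = (\<Sum>\<alpha>\<in>insert [] {\<alpha>. length \<alpha> = m}. cinner (left_mult H g \<alpha>) (g \<alpha>))"
      by (rule sum.mono_neutral_right) (auto simp: words_def[symmetric] g_def, auto simp: words_def)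
    also have "\<dots> = cinner (bop_apply (H []) h) h + (\<Sum>\<alpha> | length \<alpha> = m. cinner (left_mult H g \<alpha>) (g \<alpha>))"
      using False g0 by (subst sum.insert) auto
    also have "Re \<dots> \<le> C * (norm h)\<^sup>2 + (\<Sum>\<alpha> | length \<alpha> = m. - (1 / (4 * C)) * (norm (bop_apply (H \<alpha>) h))\<^sup>2)"
      unfolding plus_complex.sel Re_sum by (intro add_mono form sum_mono summand) simp
    also have "\<dots> = C * (norm h)\<^sup>2 - S / (4 * C)"
      unfolding S_def sum_distrib_left[symmetric] by simp
    finally show ?thesis using C by (simp add: field_simps power2_eq_square)
  qed
  then show "(\<Sum>\<alpha> | length \<alpha> = m. (norm (bop_apply (H \<alpha>) h))\<^sup>2) \<le> (2 * (norm (H []) + 1) * norm h)\<^sup>2"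
    unfolding S_def C_def .
qed simp


section \<open>Evaluation on strict row contractions\<close>

lemma index_mult_mat_sum:
  assumes "A \<in> carrier_mat n n" "B \<in> carrier_mat n n" "i < n" "j < n"
  shows "(A * B) $$ (i, j) = (\<Sum>l<n. A $$ (i, l) * B $$ (l, j))"
  using assms by (auto simp: scalar_prod_def lessThan_atLeast0 intro!: sum.cong)

lemma nc_ball_carrier: "Z \<in> nc_ball n \<Longrightarrow> Z k \<in> carrier_mat n n"
  unfolding nc_ball_def by blast

lemma word_mat_carrier [simp]: "Z \<in> nc_ball n \<Longrightarrow> word_mat n Z \<alpha> \<in> carrier_mat n n"
  by (induction \<alpha>) (auto intro: mult_carrier_mat nc_ball_carrier)

lemma word_mat_append:
  "Z \<in> nc_ball n \<Longrightarrow> word_mat n Z (\<alpha> @ \<beta>) = word_mat n Z \<alpha> * word_mat n Z \<beta>"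
proof (induction \<alpha>)
  case Nil
  then show ?case using left_mult_one_mat[OF word_mat_carrier[OF Nil]] by simp
next
  case (Cons k \<alpha>)
  then show ?case
    using assoc_mult_mat[OF nc_ball_carrier[OF Cons.prems] word_mat_carrier[OF Cons.prems]
        word_mat_carrier[OF Cons.prems]] by simp
qed

text \<open>A row and its adjoint column have the same norm.\<close>

lemma nc_ball_column_bound:
  assumes Z: "Z \<in> nc_ball n"
  obtains r where "0 \<le> r" "r < 1"
    "\<And>x. (\<Sum>k\<in>UNIV. \<Sum>j<n. (cmod (\<Sum>i<n. x i * Z k $$ (i, j)))\<^sup>2) \<le> r\<^sup>2 * (\<Sum>i<n. (cmod (x i))\<^sup>2)"
proof -
  obtain r where r: "0 \<le> r" "r < 1" and row: "\<And>v :: 'a \<Rightarrow> nat \<Rightarrow> complex.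
      (\<Sum>i<n. (cmod (\<Sum>k\<in>UNIV. \<Sum>j<n. Z k $$ (i, j) * v k j))\<^sup>2)
        \<le> r\<^sup>2 * (\<Sum>k\<in>UNIV. \<Sum>j<n. (cmod (v k j))\<^sup>2)"
    using Z unfolding nc_ball_def by blast
  show ?thesis
  proof (rule that[OF r])
    fix x :: "nat \<Rightarrow> complex"
    define y where "y k j = (\<Sum>i<n. x i * Z k $$ (i, j))" for k j
    define u where "u i = (\<Sum>k\<in>UNIV. \<Sum>j<n. Z k $$ (i, j) * cnj (y k j))" for i
    define Y where "Y = (\<Sum>k\<in>UNIV. \<Sum>j<n. (cmod (y k j))\<^sup>2)"
    define X where "X = (\<Sum>i<n. (cmod (x i))\<^sup>2)"
    have XY: "0 \<le> X" "0 \<le> Y" unfolding X_def Y_def by (auto intro!: sum_nonneg)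
    have u: "(\<Sum>i<n. (cmod (u i))\<^sup>2) \<le> r\<^sup>2 * Y"
      using row[of "\<lambda>k j. cnj (y k j)"] unfolding u_def Y_def by simp
    have "complex_of_real Y = (\<Sum>k\<in>UNIV. \<Sum>j<n. y k j * cnj (y k j))"
      unfolding Y_def by (simp add: complex_norm_square[symmetric])
    also have "\<dots> = (\<Sum>k\<in>UNIV. \<Sum>j<n. \<Sum>i<n. x i * (Z k $$ (i, j) * cnj (y k j)))"
      unfolding y_def[of _ _] by (simp add: sum_distrib_right mult.assoc)
    also have "\<dots> = (\<Sum>k\<in>UNIV. \<Sum>i<n. \<Sum>j<n. x i * (Z k $$ (i, j) * cnj (y k j)))"
      by (intro sum.cong[OF refl] sum.swap)
    also have "\<dots> = (\<Sum>i<n. x i * u i)"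
      unfolding u_def sum_distrib_left by (rule sum.swap)
    finally have "Y = cmod (\<Sum>i<n. x i * u i)"
      using XY by (metis abs_of_nonneg norm_of_real)
    also have "\<dots> \<le> (\<Sum>i<n. cmod (x i) * cmod (u i))"
      by (rule order_trans[OF norm_sum]) (simp add: norm_mult)
    also have "\<dots> \<le> L2_set (\<lambda>i. cmod (x i)) {..<n} * L2_set (\<lambda>i. cmod (u i)) {..<n}"
      using L2_set_mult_ineq[of "\<lambda>i. cmod (x i)" "\<lambda>i. cmod (u i)"] by simp
    also have "\<dots> \<le> sqrt X * sqrt (r\<^sup>2 * Y)"
      unfolding L2_set_def X_def by (intro mult_left_mono real_sqrt_le_mono u) (auto intro: sum_nonneg)
    finally have "Y\<^sup>2 \<le> (sqrt X * sqrt (r\<^sup>2 * Y))\<^sup>2" using XY by (intro power_mono)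
    also have "\<dots> = (r\<^sup>2 * X) * Y" using XY by (simp add: power_mult_distrib mult_ac)
    finally have "Y * Y \<le> (r\<^sup>2 * X) * Y" by (simp add: power2_eq_square)
    then have "Y \<le> r\<^sup>2 * X"
      using XY by (cases "Y = 0") (auto simp: mult_le_cancel_right)
    then show "(\<Sum>k\<in>UNIV. \<Sum>j<n. (cmod (\<Sum>i<n. x i * Z k $$ (i, j)))\<^sup>2) \<le> r\<^sup>2 * (\<Sum>i<n. (cmod (x i))\<^sup>2)"
      unfolding X_def Y_def y_def .
  qed
qed

lemma sum_words_Suc:
  fixes f :: "'d::finite list \<Rightarrow> 'b::comm_monoid_add"
  shows "(\<Sum>\<alpha> | length \<alpha> = Suc m. f \<alpha>) = (\<Sum>k\<in>UNIV. \<Sum>\<alpha> | length \<alpha> = m. f (k # \<alpha>))"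
proof -
  have "(\<Sum>k\<in>UNIV. \<Sum>\<alpha> | length \<alpha> = m. f (k # \<alpha>)) = (\<Sum>(k, \<alpha>)\<in>UNIV \<times> {\<alpha>. length \<alpha> = m}. f (k # \<alpha>))"
    by (rule sum.cartesian_product)
  also have "\<dots> = (\<Sum>\<alpha> | length \<alpha> = Suc m. f \<alpha>)"
    by (rule sum.reindex_bij_witness[where i="\<lambda>\<alpha>. (hd \<alpha>, tl \<alpha>)" and j="\<lambda>(k, \<alpha>). k # \<alpha>"])
      (auto simp: length_Suc_conv)
  finally show ?thesis ..
qed

text \<open>The column bound is applied once for each letter, starting with the first one.\<close>

lemma sum_word_mat_le:
  fixes Z :: "'d::finite \<Rightarrow> complex mat"
  assumes Z: "Z \<in> nc_ball n"
    and r: "\<And>x. (\<Sum>k\<in>UNIV. \<Sum>j<n. (cmod (\<Sum>i<n. x i * Z k $$ (i, j)))\<^sup>2) \<le> r\<^sup>2 * (\<Sum>i<n. (cmod (x i))\<^sup>2)"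
  shows "(\<Sum>\<alpha> | length \<alpha> = m. \<Sum>j<n. (cmod (\<Sum>i<n. x i * word_mat n Z \<alpha> $$ (i, j)))\<^sup>2)
    \<le> (r ^ m)\<^sup>2 * (\<Sum>i<n. (cmod (x i))\<^sup>2)"
proof (induction m arbitrary: x)
  case 0
  have "(\<Sum>i<n. x i * (1\<^sub>m n) $$ (i, j)) = x j" if "j < n" for j
  proof -
    have "(\<Sum>i<n. x i * (1\<^sub>m n) $$ (i, j)) = (\<Sum>i<n. if i = j then x i else 0)"
      using that by (intro sum.cong) auto
    then show ?thesis using that by simp
  qed
  then show ?case by simp
next
  case (Suc m)
  define y where "y k l = (\<Sum>i<n. x i * Z k $$ (i, l))" for k l
  have step: "(\<Sum>i<n. x i * word_mat n Z (k # \<alpha>) $$ (i, j)) = (\<Sum>l<n. y k l * word_mat n Z \<alpha> $$ (l, j))"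
    if "j < n" for k \<alpha> j
  proof -
    have "(\<Sum>i<n. x i * word_mat n Z (k # \<alpha>) $$ (i, j))
        = (\<Sum>i<n. \<Sum>l<n. x i * Z k $$ (i, l) * word_mat n Z \<alpha> $$ (l, j))"
      using that by (intro sum.cong refl)
        (simp add: index_mult_mat_sum[OF nc_ball_carrier[OF Z] word_mat_carrier[OF Z]] sum_distrib_left mult.assoc)
    also have "\<dots> = (\<Sum>l<n. \<Sum>i<n. x i * Z k $$ (i, l) * word_mat n Z \<alpha> $$ (l, j))" by (rule sum.swap)
    finally show ?thesis by (simp add: y_def sum_distrib_right)
  qed
  have "(\<Sum>\<alpha> | length \<alpha> = Suc m. \<Sum>j<n. (cmod (\<Sum>i<n. x i * word_mat n Z \<alpha> $$ (i, j)))\<^sup>2)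
      = (\<Sum>k\<in>UNIV. \<Sum>\<alpha> | length \<alpha> = m. \<Sum>j<n. (cmod (\<Sum>l<n. y k l * word_mat n Z \<alpha> $$ (l, j)))\<^sup>2)"
    unfolding sum_words_Suc by (intro sum.cong refl) (simp only: step lessThan_iff)
  also have "\<dots> \<le> (\<Sum>k\<in>UNIV. (r ^ m)\<^sup>2 * (\<Sum>j<n. (cmod (y k j))\<^sup>2))"
    by (intro sum_mono Suc)
  also have "\<dots> = (r ^ m)\<^sup>2 * (\<Sum>k\<in>UNIV. \<Sum>j<n. (cmod (y k j))\<^sup>2)" by (simp add: sum_distrib_left)
  also have "\<dots> \<le> (r ^ m)\<^sup>2 * (r\<^sup>2 * (\<Sum>i<n. (cmod (x i))\<^sup>2))"
    unfolding y_def by (intro mult_left_mono r) simp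
  finally show ?case by (simp add: power_mult_distrib mult_ac)
qed

definition abs_summable_at ::
    "nat \<Rightarrow> ('d::finite \<Rightarrow> complex mat) \<Rightarrow> ('d, 'a::complex_inner) series \<Rightarrow> bool"
  where "abs_summable_at n Z M \<longleftrightarrow>
    (\<forall>i<n. \<forall>j<n. summable (\<lambda>m. norm (homogeneous_part n Z M (i, j) m)))"

text \<open>The homogeneous part of degree \<open>m\<close> is the product of a row of matrix entries, of norm at most
  \<open>r\<^sup>m\<close>, and the column of coefficients, of norm at most \<open>C\<close>.\<close>

lemma abs_summable_at_column_bounded:
  fixes M :: "('d::finite, 'a::complex_inner) series"
  assumes M: "column_bounded C M" and Z: "Z \<in> nc_ball n"
  shows "abs_summable_at n Z M"
  unfolding abs_summable_at_def
proof (intro allI impI)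
  fix i j assume ij: "i < n" "j < n"
  obtain r where r: "0 \<le> r" "r < 1"
    and col: "\<And>x. (\<Sum>k\<in>UNIV. \<Sum>j<n. (cmod (\<Sum>i<n. x i * Z k $$ (i, j)))\<^sup>2) \<le> r\<^sup>2 * (\<Sum>i<n. (cmod (x i))\<^sup>2)"
    using nc_ball_column_bound[OF Z] by blast
  have C: "0 \<le> C" using M by (simp add: column_bounded_def)
  have row: "L2_set (\<lambda>\<alpha>. cmod (word_mat n Z \<alpha> $$ (i, j))) {\<alpha>. length \<alpha> = m} \<le> r ^ m" for m
  proof -
    define e where "e l = (if l = i then 1 else 0 :: complex)" for l
    have unit: "(\<Sum>l<n. e l * f l) = f i" for f :: "nat \<Rightarrow> complex"
    proof -
      have "(\<Sum>l<n. e l * f l) = (\<Sum>l<n. if l = i then f l else 0)" unfolding e_def by (rule sum.cong) auto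
      then show ?thesis using ij by simp
    qed
    have "(\<Sum>\<alpha> | length \<alpha> = m. (cmod (word_mat n Z \<alpha> $$ (i, j)))\<^sup>2)
        \<le> (\<Sum>\<alpha> | length \<alpha> = m. \<Sum>j<n. (cmod (word_mat n Z \<alpha> $$ (i, j)))\<^sup>2)"
      using ij by (intro sum_mono member_le_sum) auto
    also have "\<dots> = (\<Sum>\<alpha> | length \<alpha> = m. \<Sum>j<n. (cmod (\<Sum>l<n. e l * word_mat n Z \<alpha> $$ (l, j)))\<^sup>2)"
      by (simp add: unit)
    also have "\<dots> \<le> (r ^ m)\<^sup>2 * (\<Sum>l<n. (cmod (e l))\<^sup>2)" by (rule sum_word_mat_le[OF Z col])
    also have "(\<Sum>l<n. (cmod (e l))\<^sup>2) = 1"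
    proof -
      have "(\<Sum>l<n. (cmod (e l))\<^sup>2) = (\<Sum>l<n. if l = i then 1 else 0)"
        unfolding e_def by (rule sum.cong) auto
      then show ?thesis using ij by simp
    qed
    finally show ?thesis unfolding L2_set_def using r by (simp add: real_le_lsqrt sum_nonneg)
  qed
  have bound: "norm (homogeneous_part n Z M (i, j) m) \<le> C * r ^ m" for m
  proof (rule norm_bop_le)
    fix h
    have "norm (bop_apply (homogeneous_part n Z M (i, j) m) h)
        \<le> (\<Sum>\<alpha> | length \<alpha> = m. cmod (word_mat n Z \<alpha> $$ (i, j)) * norm (bop_apply (M \<alpha>) h))"
      unfolding homogeneous_part_def bop_apply_sum_op
      by (rule order_trans[OF norm_sum]) (simp add: norm_scaleC)
    also have "\<dots> \<le> L2_set (\<lambda>\<alpha>. cmod (word_mat n Z \<alpha> $$ (i, j))) {\<alpha>. length \<alpha> = m}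
        * L2_set (\<lambda>\<alpha>. norm (bop_apply (M \<alpha>) h)) {\<alpha>. length \<alpha> = m}"
      using L2_set_mult_ineq[of "\<lambda>\<alpha>. cmod (word_mat n Z \<alpha> $$ (i, j))" "\<lambda>\<alpha>. norm (bop_apply (M \<alpha>) h)"]
      by simp
    also have "\<dots> \<le> r ^ m * (C * norm h)"
    proof (intro mult_mono row)
      show "L2_set (\<lambda>\<alpha>. norm (bop_apply (M \<alpha>) h)) {\<alpha>. length \<alpha> = m} \<le> C * norm h"
        unfolding L2_set_def using M C by (intro real_le_lsqrt) (auto simp: column_bounded_def sum_nonneg)
    qed (use r in \<open>auto simp: L2_set_nonneg\<close>)
    finally show "norm (bop_apply (homogeneous_part n Z M (i, j) m) h) \<le> C * r ^ m * norm h"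
      by (simp add: mult_ac)
  qed (use r C in simp)
  show "summable (\<lambda>m. norm (homogeneous_part n Z M (i, j) m))"
    by (rule summable_comparison_test[OF _ summable_mult[OF summable_geometric[of r]]])
      (use bound r in auto)
qed

lemma free_holomorphic_column_bounded:
  fixes M :: "('d::finite, 'a::chilbert_space) series"
  assumes "column_bounded C M"
  shows "free_holomorphic M"
  unfolding free_holomorphic_def
  using abs_summable_at_column_bounded[OF assms]
  by (auto simp: abs_summable_at_def intro: summable_norm_cancel)

lemma homogeneous_part_linear:
  "homogeneous_part n Z (\<lambda>\<alpha>. M \<alpha> + N \<alpha>) ij m = homogeneous_part n Z M ij m + homogeneous_part n Z N ij m"
  "homogeneous_part n Z (\<lambda>\<alpha>. M \<alpha> - N \<alpha>) ij m = homogeneous_part n Z M ij m - homogeneous_part n Z N ij m"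
  "homogeneous_part n Z (\<lambda>\<alpha>. s *\<^sub>R M \<alpha>) ij m = s *\<^sub>R homogeneous_part n Z M ij m"
  by (simp_all add: homogeneous_part_def cscale_add_right cscale_diff_right sum.distrib sum_subtractf
      scaleR_sum_right mult.commute[of "complex_of_real s"] cscale_sum_right flip: cscale_of_real)

lemma homogeneous_part_const:
  "homogeneous_part n Z (series_const A) ij m = (if m = 0 then cscale (1\<^sub>m n $$ ij) A else 0)"
proof (cases "m = 0")
  case False
  then have "homogeneous_part n Z (series_const A) ij m = 0"
    unfolding homogeneous_part_def by (intro sum.neutral) (auto simp: series_const_def)
  then show ?thesis using False by simp
qed (simp add: homogeneous_part_def series_const_def)

lemma abs_summable_at_const: "abs_summable_at n Z (series_const A)"
proof -
  have "summable (\<lambda>m. norm (homogeneous_part n Z (series_const A) ij m))" for ij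
    by (rule summable_finite[of "{0}"]) (auto simp: homogeneous_part_const)
  then show ?thesis unfolding abs_summable_at_def by blast
qed

lemma abs_summable_at_add:
  assumes "abs_summable_at n Z M" "abs_summable_at n Z N"
  shows "abs_summable_at n Z (\<lambda>\<alpha>. M \<alpha> + N \<alpha>)"
  unfolding abs_summable_at_def homogeneous_part_linear
proof (intro allI impI)
  fix i j assume "i < n" "j < n"
  then have "summable (\<lambda>m. norm (homogeneous_part n Z M (i, j) m) + norm (homogeneous_part n Z N (i, j) m))"
    using assms by (intro summable_add) (auto simp: abs_summable_at_def)
  then show "summable (\<lambda>m. norm (homogeneous_part n Z M (i, j) m + homogeneous_part n Z N (i, j) m))"
    by (rule summable_comparison_test[rotated]) (auto intro: norm_triangle_ineq)
qed

lemma abs_summable_at_scaleR: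
  "abs_summable_at n Z M \<Longrightarrow> abs_summable_at n Z (\<lambda>\<alpha>. s *\<^sub>R M \<alpha>)"
  unfolding abs_summable_at_def homogeneous_part_linear by (auto intro: summable_mult)

lemma abs_summable_at_diff:
  "abs_summable_at n Z M \<Longrightarrow> abs_summable_at n Z N \<Longrightarrow> abs_summable_at n Z (\<lambda>\<alpha>. M \<alpha> - N \<alpha>)"
  using abs_summable_at_add[OF _ abs_summable_at_scaleR[of n Z N "-1"], of M] by simp

lemma sum_words_append:
  fixes f :: "'d::finite list \<Rightarrow> 'd list \<Rightarrow> 'b::comm_monoid_add"
  assumes "p \<le> m"
  shows "(\<Sum>\<gamma> | length \<gamma> = m. f (take p \<gamma>) (drop p \<gamma>))
    = (\<Sum>\<alpha> | length \<alpha> = p. \<Sum>\<beta> | length \<beta> = m - p. f \<alpha> \<beta>)"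
proof -
  have "(\<Sum>\<alpha> | length \<alpha> = p. \<Sum>\<beta> | length \<beta> = m - p. f \<alpha> \<beta>)
      = (\<Sum>(\<alpha>, \<beta>)\<in>{\<alpha>. length \<alpha> = p} \<times> {\<beta>. length \<beta> = m - p}. f \<alpha> \<beta>)"
    by (rule sum.cartesian_product)
  also have "\<dots> = (\<Sum>\<gamma> | length \<gamma> = m. f (take p \<gamma>) (drop p \<gamma>))"
    by (rule sum.reindex_bij_witness[where i="\<lambda>\<gamma>. (take p \<gamma>, drop p \<gamma>)" and j="\<lambda>(\<alpha>, \<beta>). \<alpha> @ \<beta>"])
      (use assms in auto)
  finally show ?thesis ..
qed

lemma homogeneous_part_mult:
  fixes M N :: "('d::finite, 'a::complex_inner) series"
  assumes Z: "Z \<in> nc_ball n" and ij: "i < n" "j < n"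
  shows "homogeneous_part n Z (M *\<^sub>S N) (i, j) m
    = (\<Sum>l<n. \<Sum>p\<le>m. homogeneous_part n Z M (i, l) p * homogeneous_part n Z N (l, j) (m - p))"
proof -
  let ?W = "word_mat n Z"
  have prod: "(\<Sum>\<alpha> | length \<alpha> = p. \<Sum>\<beta> | length \<beta> = m - p. cscale (?W (\<alpha> @ \<beta>) $$ (i, j)) (M \<alpha> * N \<beta>))
      = (\<Sum>l<n. homogeneous_part n Z M (i, l) p * homogeneous_part n Z N (l, j) (m - p))" for p
  proof -
    have "(\<Sum>\<alpha> | length \<alpha> = p. \<Sum>\<beta> | length \<beta> = m - p. cscale (?W (\<alpha> @ \<beta>) $$ (i, j)) (M \<alpha> * N \<beta>))
        = (\<Sum>\<alpha> | length \<alpha> = p. \<Sum>\<beta> | length \<beta> = m - p. \<Sum>l<n.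
            cscale (?W \<alpha> $$ (i, l)) (M \<alpha>) * cscale (?W \<beta> $$ (l, j)) (N \<beta>))"
      using ij by (simp add: word_mat_append[OF Z] index_mult_mat_sum[OF word_mat_carrier[OF Z] word_mat_carrier[OF Z]]
          cscale_sum_left cscale_times)
    also have "\<dots> = (\<Sum>\<alpha> | length \<alpha> = p. \<Sum>l<n. \<Sum>\<beta> | length \<beta> = m - p.
            cscale (?W \<alpha> $$ (i, l)) (M \<alpha>) * cscale (?W \<beta> $$ (l, j)) (N \<beta>))"
      by (intro sum.cong[OF refl] sum.swap)
    also have "\<dots> = (\<Sum>l<n. \<Sum>\<alpha> | length \<alpha> = p. \<Sum>\<beta> | length \<beta> = m - p.
            cscale (?W \<alpha> $$ (i, l)) (M \<alpha>) * cscale (?W \<beta> $$ (l, j)) (N \<beta>))"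
      by (rule sum.swap)
    finally show ?thesis unfolding homogeneous_part_def sum_product .
  qed
  have "homogeneous_part n Z (M *\<^sub>S N) (i, j) m
      = (\<Sum>\<gamma> | length \<gamma> = m. \<Sum>p\<le>m. cscale (?W (take p \<gamma> @ drop p \<gamma>) $$ (i, j)) (M (take p \<gamma>) * N (drop p \<gamma>)))"
    unfolding homogeneous_part_def series_mult_def sum_splits cscale_sum_right by simp
  also have "\<dots> = (\<Sum>p\<le>m. \<Sum>\<gamma> | length \<gamma> = m. cscale (?W (take p \<gamma> @ drop p \<gamma>) $$ (i, j)) (M (take p \<gamma>) * N (drop p \<gamma>)))"
    by (rule sum.swap)
  also have "\<dots> = (\<Sum>p\<le>m. \<Sum>\<alpha> | length \<alpha> = p. \<Sum>\<beta> | length \<beta> = m - p. cscale (?W (\<alpha> @ \<beta>) $$ (i, j)) (M \<alpha> * N \<beta>))"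
    by (intro sum.cong[OF refl] sum_words_append[where f="\<lambda>\<alpha> \<beta>. cscale (?W (\<alpha> @ \<beta>) $$ (i, j)) (M \<alpha> * N \<beta>)"]) simp
  also have "\<dots> = (\<Sum>l<n. \<Sum>p\<le>m. homogeneous_part n Z M (i, l) p * homogeneous_part n Z N (l, j) (m - p))"
    unfolding prod by (rule sum.swap)
  finally show ?thesis .
qed

lemma series_eval_carrier [simp]: "series_eval n Z M \<in> carrier_mat n n"
  by (simp add: series_eval_def)

text \<open>Evaluation is multiplicative because the homogeneous expansion of a product is the Cauchy product
  of the homogeneous expansions.\<close>

lemma series_eval_mult:
  fixes M N :: "('d::finite, 'a::chilbert_space) series"
  assumes Z: "Z \<in> nc_ball n" and M: "abs_summable_at n Z M" and N: "abs_summable_at n Z N"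
  shows "series_eval n Z (M *\<^sub>S N) = series_eval n Z M * series_eval n Z N"
proof (rule eq_matI)
  fix i j assume "i < dim_row (series_eval n Z M * series_eval n Z N)"
    "j < dim_col (series_eval n Z M * series_eval n Z N)"
  then have ij: "i < n" "j < n" by (auto simp: series_eval_def)
  have "(\<lambda>m. \<Sum>l<n. \<Sum>p\<le>m. homogeneous_part n Z M (i, l) p * homogeneous_part n Z N (l, j) (m - p)) sums
      (\<Sum>l<n. (\<Sum>m. homogeneous_part n Z M (i, l) m) * (\<Sum>m. homogeneous_part n Z N (l, j) m))"
    using M N ij by (intro sums_sum Cauchy_product_sums) (auto simp: abs_summable_at_def)
  then have "homogeneous_part n Z (M *\<^sub>S N) (i, j) sums
      (\<Sum>l<n. (\<Sum>m. homogeneous_part n Z M (i, l) m) * (\<Sum>m. homogeneous_part n Z N (l, j) m))"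
    unfolding homogeneous_part_mult[OF Z ij, symmetric] .
  from sums_unique[OF this]
  have "series_eval n Z (M *\<^sub>S N) $$ (i, j) = (\<Sum>l<n. series_eval n Z M $$ (i, l) * series_eval n Z N $$ (l, j))"
    using ij by (simp add: series_eval_def)
  then show "series_eval n Z (M *\<^sub>S N) $$ (i, j) = (series_eval n Z M * series_eval n Z N) $$ (i, j)"
    using ij by (simp only: index_mult_mat_sum[OF series_eval_carrier series_eval_carrier])
qed (simp_all add: series_eval_def)

lemma series_eval_one: "series_eval n Z (series_const (1 :: 'a::chilbert_space bop)) = 1\<^sub>m n"
proof (rule eq_matI)
  fix i j assume "i < dim_row (1\<^sub>m n :: 'a bop mat)" "j < dim_col (1\<^sub>m n :: 'a bop mat)"
  then have ij: "i < n" "j < n" by auto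
  have "(\<Sum>m. homogeneous_part n Z (series_const 1) (i, j) m) = (1\<^sub>m n :: 'a bop mat) $$ (i, j)"
    using ij unfolding homogeneous_part_const
      sums_unique[OF sums_single[of 0 "\<lambda>_. cscale (1\<^sub>m n $$ (i, j)) (1 :: 'a bop)"], symmetric]
    by simp
  then show "series_eval n Z (series_const 1) $$ (i, j) = (1\<^sub>m n :: 'a bop mat) $$ (i, j)"
    using ij by (simp add: series_eval_def)
qed (simp_all add: series_eval_def)

lemma series_eval_diff:
  fixes M N :: "('d::finite, 'a::chilbert_space) series"
  assumes "abs_summable_at n Z M" "abs_summable_at n Z N"
  shows "series_eval n Z (\<lambda>\<alpha>. M \<alpha> - N \<alpha>) = series_eval n Z M - series_eval n Z N"
proof (rule eq_matI)
  fix i j assume "i < dim_row (series_eval n Z M - series_eval n Z N)"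
    "j < dim_col (series_eval n Z M - series_eval n Z N)"
  then have ij: "i < n" "j < n" by (auto simp: series_eval_def)
  have "summable (homogeneous_part n Z M (i, j))" "summable (homogeneous_part n Z N (i, j))"
    using assms ij by (auto simp: abs_summable_at_def intro: summable_norm_cancel)
  then show "series_eval n Z (\<lambda>\<alpha>. M \<alpha> - N \<alpha>) $$ (i, j) = (series_eval n Z M - series_eval n Z N) $$ (i, j)"
    using ij by (simp add: series_eval_def homogeneous_part_linear suminf_diff)
qed (simp_all add: series_eval_def)

lemma nonunital_of_inverse_pair:
  fixes B N :: "('d::finite, 'a::chilbert_space) series"
  assumes inv: "series_inverse_pair (\<lambda>\<alpha>. series_const 1 \<alpha> - B \<alpha>) N"
    and B: "\<And>n Z. Z \<in> nc_ball n \<Longrightarrow> abs_summable_at n Z B"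
    and N: "\<And>n Z. Z \<in> nc_ball n \<Longrightarrow> abs_summable_at n Z N"
  shows "nonunital B"
  unfolding nonunital_def
proof (intro allI impI ballI)
  fix n :: nat and Z :: "'d \<Rightarrow> complex mat" assume Z: "Z \<in> nc_ball n"
  let ?D = "\<lambda>\<alpha>. series_const 1 \<alpha> - B \<alpha>"
  have D: "1\<^sub>m n - series_eval n Z B = series_eval n Z ?D"
    using series_eval_diff[OF abs_summable_at_const B[OF Z], of 1] by (simp add: series_eval_one)
  have D': "abs_summable_at n Z ?D"
    by (rule abs_summable_at_diff[OF abs_summable_at_const B[OF Z]])
  show "invertible_op_mat n (1\<^sub>m n - series_eval n Z B)"
    unfolding invertible_op_mat_def D
  proof (intro bexI[of _ "series_eval n Z N"] conjI)
    show "series_eval n Z ?D * series_eval n Z N = 1\<^sub>m n" "series_eval n Z N * series_eval n Z ?D = 1\<^sub>m n"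
      using inv unfolding series_eval_mult[OF Z D' N[OF Z], symmetric]
        series_eval_mult[OF Z N[OF Z] D', symmetric] series_inverse_pair_def
      by (simp_all add: series_eval_one)
  qed simp
qed

text \<open>At \<open>Z = 0\<close> on the one-dimensional space a series evaluates to its constant coefficient.\<close>

lemma nonunital_const_invertible:
  fixes B :: "('d::finite, 'a::chilbert_space) series"
  assumes B: "nonunital B"
  obtains Y where "(1 - B []) * Y = 1" "Y * (1 - B []) = 1"
proof -
  define Z where "Z k = (0\<^sub>m 1 1 :: complex mat)" for k :: 'd
  have Z: "Z \<in> nc_ball 1"
    unfolding nc_ball_def by (auto simp: Z_def intro!: exI[of _ 0])
  have zero: "word_mat 1 Z \<alpha> $$ (0, 0) = 0" if "\<alpha> \<noteq> []" for \<alpha>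
  proof (cases \<alpha>)
    case (Cons k \<beta>)
    have "word_mat 1 Z \<alpha> = 0\<^sub>m 1 1"
      using left_mult_zero_mat[OF word_mat_carrier[OF Z, of \<beta>], of 1] by (simp add: Cons Z_def)
    then show ?thesis by simp
  qed (use that in simp)
  have part: "homogeneous_part 1 Z B (0, 0) m = (if m = 0 then B [] else 0)" for m
  proof (cases "m = 0")
    case False
    have "homogeneous_part 1 Z B (0, 0) m = 0"
      unfolding homogeneous_part_def
    proof (rule sum.neutral, rule ballI)
      fix \<alpha> :: "'d list" assume "\<alpha> \<in> {\<alpha>. length \<alpha> = m}"
      then have "\<alpha> \<noteq> []" using False by auto
      from zero[OF this] show "cscale (word_mat 1 Z \<alpha> $$ (0, 0)) (B \<alpha>) = 0" by simp
    qed
    then show ?thesis using False by simp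
  qed (simp add: homogeneous_part_def)
  have eval: "series_eval 1 Z B $$ (0, 0) = B []"
  proof -
    have "suminf (homogeneous_part 1 Z B (0, 0)) = B []"
      unfolding part using sums_unique[OF sums_single[of 0 "\<lambda>_. B []"]] by simp
    then show ?thesis by (simp add: series_eval_def del: One_nat_def)
  qed
  let ?A = "1\<^sub>m 1 - series_eval 1 Z B"
  have A: "?A \<in> carrier_mat 1 1" "?A $$ (0, 0) = 1 - B []"
    using eval by (auto simp: series_eval_def)
  obtain N where N: "N \<in> carrier_mat 1 1" "?A * N = 1\<^sub>m 1" "N * ?A = 1\<^sub>m 1"
    using B Z unfolding nonunital_def invertible_op_mat_def by (metis order_refl)
  have "(?A * N) $$ (0, 0) = ?A $$ (0, 0) * N $$ (0, 0)" "(N * ?A) $$ (0, 0) = N $$ (0, 0) * ?A $$ (0, 0)"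
    using index_mult_mat_sum[OF A(1) N(1), of 0 0] index_mult_mat_sum[OF N(1) A(1), of 0 0]
    by (simp_all del: index_minus_mat)
  then show ?thesis
    unfolding N(2,3) A(2) by (intro that[of "N $$ (0, 0)"]) simp_all
qed


section \<open>Transposition\<close>

lemma series_transpose_transpose [simp]: "series_transpose (series_transpose M) = M"
  by (rule ext) (simp add: series_transpose_def)

text \<open>Reversal of words is an anti-automorphism of the free semigroup; it preserves lengths, so it
  turns every statement about left multiplication into one about right multiplication.\<close>

lemma right_mult_transpose:
  "right_mult (series_transpose M) F \<gamma> = left_mult M (\<lambda>\<beta>. F (rev \<beta>)) (rev \<gamma>)"
  unfolding right_mult_def left_mult_def series_transpose_def
  by (rule sum.reindex_bij_witness[where i="\<lambda>(\<alpha>, \<beta>). (rev \<alpha>, rev \<beta>)" and j="\<lambda>(\<alpha>, \<beta>). (rev \<alpha>, rev \<beta>)"])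
    (auto simp flip: rev_append)

lemma ex_ell2_rev:
  fixes F :: "('d list, 'a::complex_inner) ell2"
  obtains G where "ell2_coeff G = (\<lambda>\<alpha>. ell2_coeff F (rev \<alpha>))" "norm G \<le> norm F"
proof (rule ex_ell2)
  fix A :: "'d list set" assume "finite A"
  have "(\<Sum>\<alpha>\<in>A. (norm (ell2_coeff F (rev \<alpha>)))\<^sup>2) = (\<Sum>\<alpha>\<in>rev ` A. (norm (ell2_coeff F \<alpha>))\<^sup>2)"
    by (subst sum.reindex) (auto simp: inj_on_def)
  also have "\<dots> \<le> (norm F)\<^sup>2" using \<open>finite A\<close> by (intro norm_ell2_finite_le) simp
  finally show "(\<Sum>\<alpha>\<in>A. (norm (ell2_coeff F (rev \<alpha>)))\<^sup>2) \<le> (norm F)\<^sup>2" .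
qed (use that in auto)

lemma right_schur_transpose:
  fixes B :: "('d, 'a::complex_inner) series"
  assumes "B \<in> left_schur"
  shows "series_transpose B \<in> right_schur"
  unfolding right_schur_def ell2_contraction_def mem_Collect_eq
proof
  fix F :: "('d list, 'a) ell2"
  obtain F' where F': "ell2_coeff F' = (\<lambda>\<alpha>. ell2_coeff F (rev \<alpha>))" "norm F' \<le> norm F"
    by (rule ex_ell2_rev)
  obtain G' where G': "ell2_coeff G' = left_mult B (ell2_coeff F')" "norm G' \<le> norm F'"
    using assms unfolding left_schur_def ell2_contraction_def by blast
  obtain G where G: "ell2_coeff G = (\<lambda>\<alpha>. ell2_coeff G' (rev \<alpha>))" "norm G \<le> norm G'"
    by (rule ex_ell2_rev)
  have "ell2_coeff G = right_mult (series_transpose B) (ell2_coeff F)"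
    by (rule ext) (simp add: G G' F' right_mult_transpose)
  then show "\<exists>G. ell2_coeff G = right_mult (series_transpose B) (ell2_coeff F) \<and> norm G \<le> norm F"
    using G G' F' by (intro exI[of _ G]) auto
qed

lemma right_herglotz_kernel_transpose:
  fixes H :: "('d, 'a::complex_inner) series"
  shows "right_herglotz_kernel (series_transpose H) \<alpha> \<beta> = left_herglotz_kernel H (rev \<alpha>) (rev \<beta>)"
proof -
  have "(\<Sum>\<gamma> | \<beta> @ \<gamma> = \<alpha>. f (rev \<gamma>)) = (\<Sum>\<gamma> | \<gamma> @ rev \<beta> = rev \<alpha>. f \<gamma>)"
    for f :: "('d, 'a) series" and \<alpha> \<beta>
    by (rule sum.reindex_bij_witness[where i=rev and j=rev]) (auto, metis rev_append rev_rev_ident)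
  from this[where f=H] this[where f="\<lambda>\<gamma>. (H \<gamma>)\<^sup>\<dagger>"] show ?thesis
    unfolding right_herglotz_kernel_def left_herglotz_kernel_def series_transpose_def by simp
qed

lemma positive_right_herglotz_kernel_transpose:
  fixes H :: "('d, 'a::complex_inner) series"
  assumes H: "positive_kernel (left_herglotz_kernel H)"
  shows "positive_kernel (right_herglotz_kernel (series_transpose H))"
  unfolding positive_kernel_def right_herglotz_kernel_transpose
proof (intro allI impI)
  fix F :: "'d list set" and h :: "'d list \<Rightarrow> 'a" assume "finite F"
  then have "(\<Sum>\<alpha>\<in>rev ` F. \<Sum>\<beta>\<in>rev ` F.
      cinner (bop_apply (left_herglotz_kernel H \<alpha> \<beta>) (h (rev \<beta>))) (h (rev \<alpha>))) \<in> \<real>\<^sub>\<ge>\<^sub>0"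
    using H[unfolded positive_kernel_def, rule_format, of "rev ` F" "\<lambda>\<alpha>. h (rev \<alpha>)"] by simp
  then show "(\<Sum>\<alpha>\<in>F. \<Sum>\<beta>\<in>F.
      cinner (bop_apply (left_herglotz_kernel H (rev \<alpha>) (rev \<beta>)) (h \<beta>)) (h \<alpha>)) \<in> \<real>\<^sub>\<ge>\<^sub>0"
    by (simp add: sum.reindex inj_on_def)
qed

lemma column_bounded_transpose:
  assumes "column_bounded C M"
  shows "column_bounded C (series_transpose M)"
proof -
  have "(\<Sum>\<alpha> | length \<alpha> = m. (norm (bop_apply (M (rev \<alpha>)) h))\<^sup>2)
      = (\<Sum>\<alpha> | length \<alpha> = m. (norm (bop_apply (M \<alpha>) h))\<^sup>2)" for m h
    by (rule sum.reindex_bij_witness[where i=rev and j=rev]) auto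
  then show ?thesis using assms by (simp add: column_bounded_def series_transpose_def)
qed

section \<open>Schur and Herglotz pairs\<close>

lemma nonunital_schur_pairs_iff:
  "(BL, BR) \<in> nonunital_schur_pairs \<longleftrightarrow> BR = series_transpose BL \<and> BL \<in> left_schur \<and> nonunital BL"
  by (auto simp: nonunital_schur_pairs_def right_schur_transpose)

text \<open>Positivity of the kernel forces the coefficients of \<open>H\<close> to be column bounded, so the series and
  its transpose converge on all strict row contractions.\<close>

lemma herglotz_pairs_iff:
  fixes HL HR :: "('d::finite, 'a::chilbert_space) series"
  shows "(HL, HR) \<in> herglotz_pairs \<longleftrightarrow>
    HR = series_transpose HL \<and> positive_kernel (left_herglotz_kernel HL)"
  using column_bounded_positive_kernel free_holomorphic_column_bounded column_bounded_transpose
    positive_right_herglotz_kernel_transpose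
  by (fastforce simp: herglotz_pairs_def left_herglotz_def right_herglotz_def)

lemma schur_inverse_pair:
  fixes B :: "('d::finite, 'a::chilbert_space) series"
  assumes "nonunital B"
  shows "series_inverse_pair (\<lambda>\<alpha>. series_const 1 \<alpha> - B \<alpha>) (series_inverse (\<lambda>\<alpha>. series_const 1 \<alpha> - B \<alpha>))"
proof -
  obtain Y where "(1 - B []) * Y = 1" "Y * (1 - B []) = 1" using nonunital_const_invertible[OF assms] .
  then show ?thesis by (intro series_invertible_if_const_invertible[of _ Y]) (simp_all add: series_const_def)
qed

text \<open>The first truncation shows that the real part of the constant coefficient of \<open>H\<close> is nonnegative, so
  the constant coefficient of \<open>H + 1\<close> is coercive.\<close>

lemma herglotz_inverse_pair:
  fixes H :: "('d::finite, 'a::chilbert_space) series"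
  assumes "positive_kernel (left_herglotz_kernel H)"
  shows "series_inverse_pair (\<lambda>\<alpha>. H \<alpha> + series_const 1 \<alpha>) (series_inverse (\<lambda>\<alpha>. H \<alpha> + series_const 1 \<alpha>))"
proof -
  have "0 \<le> Re (cinner (bop_apply (H []) x) x)" for x
    using assms[unfolded positive_left_herglotz_kernel_iff, rule_format, of "\<lambda>_. x" 0]
    by (simp add: words_def left_mult_def)
  then have "1 * (norm x)\<^sup>2 \<le> Re (cinner (bop_apply (H [] + 1) x) x)" for x
    by (simp add: cinner_add_left cinner_same)
  then obtain Y where "(H [] + 1) * Y = 1" "Y * (H [] + 1) = 1"
    using Lax_Milgram[of 1 "H [] + 1"] by auto
  then show ?thesis by (intro series_invertible_if_const_invertible[of _ Y]) (simp_all add: series_const_def)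
qed

lemma schur_to_herglotz_pair:
  fixes BL BR :: "('d::finite, 'a::chilbert_space) series"
  assumes "(BL, BR) \<in> nonunital_schur_pairs"
  shows "schur_to_herglotz (BL, BR) \<in> herglotz_pairs"
    and "herglotz_to_schur (schur_to_herglotz (BL, BR)) = (BL, BR)"
proof -
  have B: "BR = series_transpose BL" "BL \<in> left_schur" "nonunital BL"
    using assms by (auto simp: nonunital_schur_pairs_iff)
  note inv = schur_inverse_pair[OF B(3)]
  note Cayley = Cayley_schur_to_herglotz[OF inv refl]
  show "schur_to_herglotz (BL, BR) \<in> herglotz_pairs"
    using positive_kernel_of_schur[OF B(2) inv Cayley(2)]
    by (simp add: schur_to_herglotz_def Let_def herglotz_pairs_iff)
  show "herglotz_to_schur (schur_to_herglotz (BL, BR)) = (BL, BR)"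
    using Cayley(4) B(1) by (simp add: schur_to_herglotz_def herglotz_to_schur_def Let_def)
qed

lemma herglotz_to_schur_pair:
  fixes HL HR :: "('d::finite, 'a::chilbert_space) series"
  assumes "(HL, HR) \<in> herglotz_pairs"
  shows "herglotz_to_schur (HL, HR) \<in> nonunital_schur_pairs"
    and "schur_to_herglotz (herglotz_to_schur (HL, HR)) = (HL, HR)"
proof -
  have H: "HR = series_transpose HL" "positive_kernel (left_herglotz_kernel HL)"
    using assms by (auto simp: herglotz_pairs_iff)
  note inv = herglotz_inverse_pair[OF H(2)]
  note Cayley = Cayley_herglotz_to_schur[OF inv refl]
  note B = schur_of_positive_kernel[OF H(2) inv Cayley(2)]
  have "nonunital (series_inverse (\<lambda>\<alpha>. HL \<alpha> + series_const 1 \<alpha>) *\<^sub>S (\<lambda>\<alpha>. HL \<alpha> - series_const 1 \<alpha>))"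
    by (rule nonunital_of_inverse_pair[OF Cayley(3)])
      (intro abs_summable_at_scaleR abs_summable_at_add abs_summable_at_const
        abs_summable_at_column_bounded[OF column_bounded_schur[OF B]]
        abs_summable_at_column_bounded[OF column_bounded_positive_kernel[OF H(2)]]; assumption)+
  then show "herglotz_to_schur (HL, HR) \<in> nonunital_schur_pairs"
    using B by (simp add: herglotz_to_schur_def Let_def nonunital_schur_pairs_iff)
  show "schur_to_herglotz (herglotz_to_schur (HL, HR)) = (HL, HR)"
    using Cayley(4) H(1) by (simp add: schur_to_herglotz_def herglotz_to_schur_def Let_def)
qed

lemma bij_betw_schur_to_herglotz:
  "bij_betw schur_to_herglotz
    (nonunital_schur_pairs :: (('d::finite, 'a::chilbert_space) series \<times> ('d, 'a) series) set) herglotz_pairs"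
  by (rule bij_betw_byWitness[where f'=herglotz_to_schur])
    (auto simp: schur_to_herglotz_pair herglotz_to_schur_pair)

lemma bij_betw_herglotz_to_schur:
  "bij_betw herglotz_to_schur
    (herglotz_pairs :: (('d::finite, 'a::chilbert_space) series \<times> ('d, 'a) series) set) nonunital_schur_pairs"
  by (rule bij_betw_byWitness[where f'=schur_to_herglotz])
    (auto simp: schur_to_herglotz_pair herglotz_to_schur_pair)


section \<open>Operator systems and completely positive maps\<close>

definition operator_system :: "'a::complex_inner bop set \<Rightarrow> bool"
  where "operator_system X \<longleftrightarrow> 1 \<in> X \<and> (\<forall>a\<in>X. \<forall>b\<in>X. a + b \<in> X) \<and>
    (\<forall>c. \<forall>a\<in>X. cscale c a \<in> X) \<and> (\<forall>a\<in>X. a\<^sup>\<dagger> \<in> X)"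

definition cp_on :: "'a::complex_inner bop set \<Rightarrow> ('a bop \<Rightarrow> 'h::complex_inner bop) \<Rightarrow> bool"
  where "cp_on X \<phi> \<longleftrightarrow>
    (\<forall>a\<in>X. \<forall>b\<in>X. \<phi> (a + b) = \<phi> a + \<phi> b) \<and>
    (\<forall>c. \<forall>a\<in>X. \<phi> (cscale c a) = cscale c (\<phi> a)) \<and>
    (\<forall>n T. (\<forall>i<n. \<forall>j<n. T i j \<in> X) \<longrightarrow> positive_operator_matrix n T \<longrightarrow>
      positive_operator_matrix n (\<lambda>i j. \<phi> (T i j)))"

lemma cp_maps_iff: "\<phi> \<in> cp_maps X \<longleftrightarrow> \<phi> \<in> extensional X \<and> cp_on X \<phi>"
  by (simp add: cp_maps_def cp_on_def)

lemma cp_on_positive: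
  "cp_on X \<phi> \<Longrightarrow> (\<And>i j. i < n \<Longrightarrow> j < n \<Longrightarrow> T i j \<in> X) \<Longrightarrow> positive_operator_matrix n T \<Longrightarrow>
    positive_operator_matrix n (\<lambda>i j. \<phi> (T i j))"
  unfolding cp_on_def by blast

lemma operator_systemD:
  assumes "operator_system X"
  shows "1 \<in> X" "a \<in> X \<Longrightarrow> b \<in> X \<Longrightarrow> a + b \<in> X" "a \<in> X \<Longrightarrow> cscale c a \<in> X" "a \<in> X \<Longrightarrow> a\<^sup>\<dagger> \<in> X"
  using assms by (auto simp: operator_system_def)

lemma operator_system_0: "operator_system X \<Longrightarrow> 0 \<in> X"
  unfolding operator_system_def by (metis cscale_simps(1))

lemma operator_system_sum:
  "operator_system X \<Longrightarrow> (\<And>i. i \<in> I \<Longrightarrow> f i \<in> X) \<Longrightarrow> (\<Sum>i\<in>I. f i) \<in> X"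
  by (induction I rule: infinite_finite_induct) (auto simp: operator_system_0, simp add: operator_system_def)

lemma operator_system_diff:
  assumes "operator_system X" "a \<in> X" "b \<in> X"
  shows "a - b \<in> X"
proof -
  have "a + cscale (- 1) b \<in> X" using assms unfolding operator_system_def by blast
  then show ?thesis by (simp add: cscale_minus_one)
qed

lemma cp_on_0: "cp_on X \<phi> \<Longrightarrow> operator_system X \<Longrightarrow> \<phi> 0 = 0"
  unfolding cp_on_def operator_system_def by (metis cscale_simps(1))

lemma cp_on_cscale: "cp_on X \<phi> \<Longrightarrow> a \<in> X \<Longrightarrow> \<phi> (cscale c a) = cscale c (\<phi> a)"
  unfolding cp_on_def by blast

lemma cp_on_diff:
  assumes "cp_on X \<phi>" "operator_system X" "a \<in> X" "b \<in> X"
  shows "\<phi> (a - b) = \<phi> a - \<phi> b"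
proof -
  have b: "cscale (- 1) b \<in> X" using assms unfolding operator_system_def by blast
  have "\<phi> (a + cscale (- 1) b) = \<phi> a + cscale (- 1) (\<phi> b)"
    using assms b unfolding cp_on_def by simp
  then show ?thesis by (simp add: cscale_minus_one)
qed

lemma cp_on_sum:
  assumes "cp_on X \<phi>" "operator_system X" "\<And>i. i \<in> I \<Longrightarrow> f i \<in> X"
  shows "\<phi> (\<Sum>i\<in>I. f i) = (\<Sum>i\<in>I. \<phi> (f i))"
  using assms(3)
proof (induction I rule: infinite_finite_induct)
  case (insert i I)
  then show ?case
    using assms(1,2) operator_system_sum[OF assms(2), of I f] by (simp add: cp_on_def)
qed (use assms in \<open>auto simp: cp_on_0\<close>)

lemma sum_lessThan_2: "(\<Sum>i<2. f i) = f 0 + f (1::nat)"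
  by (simp add: numeral_2_eq_2)

definition matrix_2x2 :: "'a \<Rightarrow> 'a \<Rightarrow> 'a \<Rightarrow> 'a \<Rightarrow> nat \<Rightarrow> nat \<Rightarrow> 'a"
  where "matrix_2x2 a b c d i j = (if i = 0 then if j = 0 then a else b else if j = 0 then c else d)"

lemma positive_matrix_2x2:
  fixes a :: "'a::chilbert_space bop"
  assumes c: "norm a \<le> c"
  shows "positive_operator_matrix 2 (matrix_2x2 (c *\<^sub>R 1) a (a\<^sup>\<dagger>) (c *\<^sub>R 1))"
  (is "positive_operator_matrix 2 ?T")
  unfolding positive_operator_matrix_def
proof (intro allI)
  fix x :: "nat \<Rightarrow> 'a"
  let ?s = "cinner (bop_apply a (x 1)) (x 0)"
  have adj: "cinner (bop_apply (a\<^sup>\<dagger>) (x 0)) (x 1) = cnj ?s"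
    unfolding cinner_adjoint' by (rule cinner_commute)
  have "cmod ?s \<le> norm (bop_apply a (x 1)) * norm (x 0)" by (rule cinner_Cauchy_Schwarz)
  also have "\<dots> \<le> (c * norm (x 1)) * norm (x 0)"
    using norm_bop_apply_le[of a "x 1"] mult_right_mono[OF c, of "norm (x 1)"]
    by (intro mult_right_mono) auto
  finally have "- (c * norm (x 1) * norm (x 0)) \<le> Re ?s"
    using abs_Re_le_cmod[of ?s] by linarith
  moreover have "0 \<le> c * (norm (x 0) - norm (x 1))\<^sup>2"
    using c norm_ge_zero[of a] by (intro mult_nonneg_nonneg) (auto simp del: norm_ge_zero)
  ultimately have nn: "0 \<le> c * (norm (x 0))\<^sup>2 + 2 * Re ?s + c * (norm (x 1))\<^sup>2"
    by (simp add: power2_diff algebra_simps)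
  have "of_real c * of_real ((norm (x 0))\<^sup>2) + ?s + (cnj ?s + of_real c * of_real ((norm (x 1))\<^sup>2))
      = complex_of_real (c * (norm (x 0))\<^sup>2 + 2 * Re ?s + c * (norm (x 1))\<^sup>2)"
    using complex_add_cnj[of ?s] by (simp add: algebra_simps)
  then show "(\<Sum>i<2. \<Sum>j<2. cinner (bop_apply (?T i j) (x j)) (x i)) \<in> \<real>\<^sub>\<ge>\<^sub>0"
    unfolding sum_lessThan_2 matrix_2x2_def
    using nn by (simp add: adj[simplified] cinner_same del: of_real_add of_real_mult of_real_power)
qed

text \<open>Applying \<open>\<phi>\<close> to the positive matrix with rows \<open>(\<parallel>a\<parallel>, a)\<close> and \<open>(a\<^sup>\<dagger>, \<parallel>a\<parallel>)\<close> shows both that \<open>\<phi>\<close>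
  preserves adjoints and that it is bounded.\<close>

lemma cp_on_2x2:
  fixes \<phi> :: "'a::chilbert_space bop \<Rightarrow> 'h::chilbert_space bop"
  assumes \<phi>: "cp_on X \<phi>" and X: "operator_system X" and a: "a \<in> X"
  shows "of_real (norm a) * cinner (bop_apply (\<phi> 1) x) x + cinner (bop_apply (\<phi> a) y) x
    + (cinner (bop_apply (\<phi> (a\<^sup>\<dagger>)) x) y + of_real (norm a) * cinner (bop_apply (\<phi> 1) y) y) \<in> \<real>\<^sub>\<ge>\<^sub>0"
proof -
  let ?T = "matrix_2x2 (norm a *\<^sub>R 1) a (a\<^sup>\<dagger>) (norm a *\<^sub>R 1)"
  have 1: "r *\<^sub>R 1 \<in> X" for r using X unfolding operator_system_def by (metis cscale_of_real)
  have T: "\<forall>i<2. \<forall>j<2. ?T i j \<in> X"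
    using a X 1 by (auto simp: matrix_2x2_def operator_system_def)
  have "positive_operator_matrix 2 (\<lambda>i j. \<phi> (?T i j))"
    using \<phi> T positive_matrix_2x2[of a "norm a"] unfolding cp_on_def by blast
  moreover have "\<phi> (r *\<^sub>R 1) = r *\<^sub>R \<phi> 1" for r
    using \<phi> X unfolding cp_on_def operator_system_def by (metis cscale_of_real)
  ultimately show ?thesis
    unfolding positive_operator_matrix_def sum_lessThan_2
    by (auto simp: matrix_2x2_def dest!: spec[of _ "\<lambda>i. if i = 0 then x else y"])
qed

lemma cp_on_one_nonneg:
  fixes \<phi> :: "'a::chilbert_space bop \<Rightarrow> 'h::chilbert_space bop"
  assumes \<phi>: "cp_on X \<phi>" and X: "operator_system X"
  shows "cinner (bop_apply (\<phi> 1) x) x \<in> \<real>\<^sub>\<ge>\<^sub>0"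
proof -
  have "positive_operator_matrix 1 (\<lambda>i j. \<phi> 1)"
    using X by (intro cp_on_positive[OF \<phi>, of 1 "\<lambda>i j. 1"])
      (auto simp: operator_system_def positive_operator_matrix_def cinner_same)
  then show ?thesis unfolding positive_operator_matrix_def by (auto dest: spec[of _ "\<lambda>_. x"])
qed

lemma cp_on_adjoint:
  fixes \<phi> :: "'a::chilbert_space bop \<Rightarrow> 'h::chilbert_space bop"
  assumes \<phi>: "cp_on X \<phi>" and X: "operator_system X" and a: "a \<in> X"
  shows "\<phi> (a\<^sup>\<dagger>) = (\<phi> a)\<^sup>\<dagger>"
proof (rule bop_eqI, rule cinner_ext_left)
  fix x y
  let ?s = "\<lambda>x y. cinner (bop_apply (\<phi> a) y) x" and ?t = "\<lambda>x y. cinner (bop_apply (\<phi> (a\<^sup>\<dagger>)) x) y"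
  have real: "Im (?s x y + ?t x y) = 0" for x y
    using cp_on_2x2[OF assms, of x y] cp_on_one_nonneg[OF \<phi> X, of x] cp_on_one_nonneg[OF \<phi> X, of y]
    by (simp add: complex_nonneg_Reals_iff)
  have "?t x y = cnj (?s x y)"
    using real[where x=x and y=y] real[where x="\<i> *\<^sub>C x" and y=y] by (intro complex_eqI) auto
  also have "\<dots> = cinner (bop_apply ((\<phi> a)\<^sup>\<dagger>) x) y"
    unfolding cinner_adjoint' by (rule cinner_commute[symmetric])
  finally show "cinner (bop_apply (\<phi> (a\<^sup>\<dagger>)) x) y = cinner (bop_apply ((\<phi> a)\<^sup>\<dagger>) x) y" .
qed

lemma cp_on_bound:
  fixes \<phi> :: "'a::chilbert_space bop \<Rightarrow> 'h::chilbert_space bop"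
  assumes \<phi>: "cp_on X \<phi>" and X: "operator_system X" and a: "a \<in> X"
  shows "norm (\<phi> a) \<le> norm (\<phi> 1) * norm a"
proof (rule norm_bop_le)
  fix y
  define z where "z = bop_apply (\<phi> a) y"
  show "norm (bop_apply (\<phi> a) y) \<le> norm (\<phi> 1) * norm a * norm y"
  proof (cases "z = 0 \<or> y = 0")
    case False
    define x where "x = - ((norm y / norm z) *\<^sub>R z)"
    have x: "norm x = norm y" using False by (simp add: x_def)
    have one: "Re (cinner (bop_apply (\<phi> 1) u) u) \<le> norm (\<phi> 1) * (norm u)\<^sup>2" for u
    proof -
      have "Re (cinner (bop_apply (\<phi> 1) u) u) \<le> norm (bop_apply (\<phi> 1) u) * norm u"
        by (rule order_trans[OF complex_Re_le_cmod cinner_Cauchy_Schwarz])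
      also have "\<dots> \<le> (norm (\<phi> 1) * norm u) * norm u" by (intro mult_right_mono norm_bop_apply_le) simp
      finally show ?thesis by (simp add: power2_eq_square mult.assoc)
    qed
    have s: "cinner (bop_apply (\<phi> a) y) x = - of_real (norm y * norm z)"
      using False by (simp add: x_def z_def[symmetric] cinner_same power2_eq_square)
    have t: "Re (cinner (bop_apply (\<phi> (a\<^sup>\<dagger>)) x) y) = - (norm y * norm z)"
      unfolding cp_on_adjoint[OF assms] cinner_adjoint' by (subst Re_cinner_commute) (simp add: s)
    have "0 \<le> norm a * Re (cinner (bop_apply (\<phi> 1) x) x) - norm y * norm z - norm y * norm z
        + norm a * Re (cinner (bop_apply (\<phi> 1) y) y)"
      using cp_on_2x2[OF assms, of x y] t by (simp add: s complex_nonneg_Reals_iff)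
    also have "\<dots> \<le> norm a * (norm (\<phi> 1) * (norm y)\<^sup>2) - norm y * norm z - norm y * norm z
        + norm a * (norm (\<phi> 1) * (norm y)\<^sup>2)"
      using mult_left_mono[OF one[of x], of "norm a"] mult_left_mono[OF one[of y], of "norm a"]
      by (simp add: x)
    finally have "norm y * norm z \<le> norm y * (norm (\<phi> 1) * norm a * norm y)"
      by (simp add: power2_eq_square algebra_simps)
    then show ?thesis using False by (simp add: z_def[symmetric])
  qed (auto simp: z_def)
qed simp

lemma bounded_linear_cscale: "bounded_linear (cscale c)"
  by (rule bounded_linear_intro[where K="cmod c"])
    (auto simp: cscale_add_right norm_cscale mult.commute simp flip: cscale_of_real)

lemma bounded_linear_cadj: "bounded_linear (cadj :: 'a::chilbert_space bop \<Rightarrow> 'a bop)"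
  by (rule bounded_linear_intro[where K=1]) (auto simp flip: cscale_of_real)

lemma operator_system_closure:
  fixes X :: "'a::chilbert_space bop set"
  assumes X: "operator_system X"
  shows "operator_system (closure X)"
  unfolding operator_system_def
proof (intro conjI allI ballI)
  show "1 \<in> closure X" using X closure_subset unfolding operator_system_def by blast
next
  fix a b assume "a \<in> closure X" "b \<in> closure X"
  then obtain f g where "\<And>n. f n \<in> X" "f \<longlonglongrightarrow> a" "\<And>n. g n \<in> X" "g \<longlonglongrightarrow> b"
    unfolding closure_sequential by blast
  then show "a + b \<in> closure X"
    using X unfolding closure_sequential operator_system_def
    by (intro exI[of _ "\<lambda>n. f n + g n"]) (auto intro: tendsto_add)
next
  fix c a assume "a \<in> closure X"
  then obtain f where "\<And>n. f n \<in> X" "f \<longlonglongrightarrow> a" unfolding closure_sequential by blast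
  then show "cscale c a \<in> closure X"
    using X unfolding closure_sequential operator_system_def
    by (intro exI[of _ "\<lambda>n. cscale c (f n)"]) (auto intro: bounded_linear.tendsto[OF bounded_linear_cscale])
next
  fix a assume "a \<in> closure X"
  then obtain f where "\<And>n. f n \<in> X" "f \<longlonglongrightarrow> a" unfolding closure_sequential by blast
  then show "a\<^sup>\<dagger> \<in> closure X"
    using X unfolding closure_sequential operator_system_def
    by (intro exI[of _ "\<lambda>n. (f n)\<^sup>\<dagger>"]) (auto intro: bounded_linear.tendsto[OF bounded_linear_cadj])
qed

section \<open>Toeplitz kernels on the free semigroup\<close>

text \<open>The coefficient kernel of a Herglotz function and the kernel \<open>V\<^sub>\<alpha>\<^sup>\<dagger> V\<^sub>\<beta>\<close> formed from products of
  creation operators have the same structure: a kernel of this kind is determined by its first row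
  and its first column.\<close>

definition toeplitz_kernel :: "('d list \<Rightarrow> 'd list \<Rightarrow> 'b::zero) \<Rightarrow> bool"
  where "toeplitz_kernel T \<longleftrightarrow> (\<forall>\<alpha> \<beta> k l. T (\<alpha> @ [k]) (\<beta> @ [l]) = (if k = l then T \<alpha> \<beta> else 0))"

lemma toeplitz_kernel_induct:
  assumes "toeplitz_kernel T"
    and "\<And>\<alpha>. P \<alpha> []" "\<And>\<beta>. P [] \<beta>"
    and "\<And>\<alpha> \<beta> k. P \<alpha> \<beta> \<Longrightarrow> P (\<alpha> @ [k]) (\<beta> @ [k])"
    and "\<And>\<alpha> \<beta> k l. k \<noteq> l \<Longrightarrow> P (\<alpha> @ [k]) (\<beta> @ [l])"
  shows "P \<alpha> \<beta>"
proof (induction \<alpha> arbitrary: \<beta> rule: rev_induct)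
  case (snoc k \<alpha>)
  show ?case using assms snoc by (cases \<beta> rule: rev_cases) (auto, metis)
qed (rule assms)

lemma toeplitz_kernel_eqI:
  assumes T: "toeplitz_kernel T" and T': "toeplitz_kernel T'"
    and col: "\<And>\<alpha>. T \<alpha> [] = T' \<alpha> []" and row: "\<And>\<beta>. T [] \<beta> = T' [] \<beta>"
  shows "T \<alpha> \<beta> = T' \<alpha> \<beta>"
  by (rule toeplitz_kernel_induct[OF T, of "\<lambda>\<alpha> \<beta>. T \<alpha> \<beta> = T' \<alpha> \<beta>"])
    (use T T' in \<open>auto simp: toeplitz_kernel_def col row\<close>)

lemma toeplitz_left_herglotz_kernel: "toeplitz_kernel (left_herglotz_kernel H)"
  unfolding toeplitz_kernel_def left_herglotz_kernel_def
proof (intro allI)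
  fix \<alpha> \<beta> :: "'a list" and k l
  have eq: "{\<gamma>. \<gamma> @ \<beta> @ [l] = \<alpha> @ [k]} = (if k = l then {\<gamma>. \<gamma> @ \<beta> = \<alpha>} else {})" for \<alpha> \<beta> :: "'a list" and k l
    by (auto simp flip: append_assoc)
  show "(1 / 2) *\<^sub>R ((\<Sum>\<gamma> | \<gamma> @ \<beta> @ [l] = \<alpha> @ [k]. H \<gamma>) + (\<Sum>\<gamma> | \<gamma> @ \<alpha> @ [k] = \<beta> @ [l]. (H \<gamma>)\<^sup>\<dagger>))
      = (if k = l then (1 / 2) *\<^sub>R ((\<Sum>\<gamma> | \<gamma> @ \<beta> = \<alpha>. H \<gamma>) + (\<Sum>\<gamma> | \<gamma> @ \<alpha> = \<beta>. (H \<gamma>)\<^sup>\<dagger>)) else 0)"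
    unfolding eq by auto
qed

lemma left_herglotz_kernel_Nil:
  "left_herglotz_kernel H \<alpha> [] = (1/2) *\<^sub>R (if \<alpha> = [] then H [] + (H [])\<^sup>\<dagger> else H \<alpha>)"
  "left_herglotz_kernel H [] \<beta> = (1/2) *\<^sub>R (if \<beta> = [] then H [] + (H [])\<^sup>\<dagger> else (H \<beta>)\<^sup>\<dagger>)"
  by (simp_all add: left_herglotz_kernel_def)

section \<open>Words in the creation operators\<close>

text \<open>The order of the letters is reversed, so that \<open>V\<^sub>\<alpha>\<close> maps \<open>e\<^sub>\<beta>\<close> to \<open>e\<^sub>\<gamma>\<close> with
  \<open>\<gamma> = \<alpha>\<^sup>T \<beta>\<close>, and \<open>V\<^sub>\<alpha>\<^sup>\<dagger>\<close> is the coefficient of \<open>Z\<^sup>\<alpha>\<close> in \<open>(I - Z L\<^sup>*)\<inverse>\<close>.\<close>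

definition creation_word :: "'d list \<Rightarrow> 'd fock bop"
  where "creation_word \<alpha> = prod_list (map creation (rev \<alpha>))"

lemma creation_word_simps [simp]:
  "creation_word [] = 1" "creation_word (\<alpha> @ \<beta>) = creation_word \<beta> * creation_word \<alpha>"
  "creation_word [k] = creation k"
  by (auto simp: creation_word_def)

lemma creation_word_Cons: "creation_word (k # \<alpha>) = creation_word \<alpha> * creation k"
  by (simp add: creation_word_def)

lemma creation_word_fock_basis:
  "bop_apply (creation_word \<alpha>) (fock_basis \<beta>) = fock_basis (rev \<alpha> @ \<beta>)"
  by (induction \<alpha> arbitrary: \<beta>) (auto simp: creation_word_Cons creation_fock_basis)

lemma ZL_adj_resolvent_eq: "ZL_adj_resolvent \<alpha> = (creation_word \<alpha>)\<^sup>\<dagger>"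
  by (induction \<alpha>) (auto simp: ZL_adj_resolvent_def creation_word_Cons)

lemma bop_apply_creation: "bop_apply (creation k) x = shift_ell2 k x"
  by (simp add: bop_apply.rep_eq creation.rep_eq bounded_linear_Blinfun_apply[OF bounded_linear_shift_ell2])

lemma cinner_creation:
  "cinner (bop_apply (creation k) x) (bop_apply (creation l) y) = (if k = l then cinner x y else 0)"
proof (cases "k = l")
  case True
  have "cinner (shift_ell2 k x) (shift_ell2 k y)
      = (\<Sum>\<^sub>\<infinity>\<gamma>\<in>range (Cons k). cinner (ell2_coeff x (tl \<gamma>)) (ell2_coeff y (tl \<gamma>)))"
    unfolding cinner_ell2_def shift_ell2.rep_eq
    by (rule infsum_cong_neutral) (auto simp: neq_Nil_conv)
  also have "\<dots> = cinner x y"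
    unfolding cinner_ell2_def by (subst infsum_reindex) (auto simp: o_def)
  finally show ?thesis using True by (simp add: bop_apply_creation)
next
  case False
  have "cinner (shift_ell2 k x) (shift_ell2 l y) = 0"
    unfolding cinner_ell2_def shift_ell2.rep_eq
    by (rule infsum_0) (use False in \<open>auto simp: cinner_complex_def\<close>)
  then show ?thesis using False by (simp add: bop_apply_creation)
qed

lemma creation_adjoint_creation: "(creation k)\<^sup>\<dagger> * creation l = (if k = l then 1 else 0)"
  by (rule bop_eqI, rule cinner_ext_left) (auto simp: cinner_adjoint' cinner_creation)

definition creation_kernel :: "'d list \<Rightarrow> 'd list \<Rightarrow> 'd fock bop"
  where "creation_kernel \<alpha> \<beta> = (creation_word \<alpha>)\<^sup>\<dagger> * creation_word \<beta>"

lemma creation_kernel_Nil [simp]: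
  "creation_kernel \<alpha> [] = (creation_word \<alpha>)\<^sup>\<dagger>" "creation_kernel [] \<beta> = creation_word \<beta>"
  by (simp_all add: creation_kernel_def)

text \<open>The creation operators are isometries with orthogonal ranges, so a common last letter cancels and
  different last letters give zero.\<close>

lemma creation_kernel_snoc:
  "creation_kernel (\<alpha> @ [k]) (\<beta> @ [l]) = (if k = l then creation_kernel \<alpha> \<beta> else 0)"
proof -
  have "creation_kernel (\<alpha> @ [k]) (\<beta> @ [l]) = (creation_word \<alpha>)\<^sup>\<dagger> * ((creation k)\<^sup>\<dagger> * creation l) * creation_word \<beta>"
    by (simp add: creation_kernel_def mult.assoc)
  then show ?thesis unfolding creation_adjoint_creation by (simp add: creation_kernel_def)
qed

lemma toeplitz_creation_kernel: "toeplitz_kernel creation_kernel"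
  unfolding toeplitz_kernel_def by (simp add: creation_kernel_snoc)

lemma creation_kernel_adjoint [simp]: "(creation_kernel \<alpha> \<beta>)\<^sup>\<dagger> = creation_kernel \<beta> \<alpha>"
  by (simp add: creation_kernel_def)

lemma positive_creation_kernel:
  "positive_operator_matrix n (\<lambda>i j. creation_kernel (f i) (f j))"
  unfolding positive_operator_matrix_def
proof
  fix x :: "nat \<Rightarrow> 'a fock"
  have "(\<Sum>i<n. \<Sum>j<n. cinner (bop_apply (creation_kernel (f i) (f j)) (x j)) (x i))
      = cinner (\<Sum>j<n. bop_apply (creation_word (f j)) (x j)) (\<Sum>i<n. bop_apply (creation_word (f i)) (x i))"
    by (simp add: cinner_sum_left cinner_sum_right creation_kernel_def cinner_adjoint')
  then show "(\<Sum>i<n. \<Sum>j<n. cinner (bop_apply (creation_kernel (f i) (f j)) (x j)) (x i)) \<in> \<real>\<^sub>\<ge>\<^sub>0"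
    by (simp only: cinner_same of_real_nonneg zero_le_power2)
qed

section \<open>The free disk system\<close>

lemma closed_unital_subalgebraD:
  assumes "closed_unital_subalgebra S"
  shows "closed S" "1 \<in> S" "a \<in> S \<Longrightarrow> b \<in> S \<Longrightarrow> a + b \<in> S" "a \<in> S \<Longrightarrow> b \<in> S \<Longrightarrow> a * b \<in> S"
    "a \<in> S \<Longrightarrow> cscale c a \<in> S" "0 \<in> S"
proof -
  show "closed S" and 1: "1 \<in> S" and "a \<in> S \<Longrightarrow> b \<in> S \<Longrightarrow> a + b \<in> S" "a \<in> S \<Longrightarrow> b \<in> S \<Longrightarrow> a * b \<in> S"
    and c: "a \<in> S \<Longrightarrow> cscale c a \<in> S" for a b c
    using assms by (auto simp: closed_unital_subalgebra_def)
  show "0 \<in> S" using c[OF 1, of 0] by simp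
qed

lemma closed_unital_subalgebra_free_disk_algebra: "closed_unital_subalgebra free_disk_algebra"
proof -
  have "closed free_disk_algebra"
    unfolding free_disk_algebra_def by (rule closed_Inter) (auto simp: closed_unital_subalgebra_def)
  then show ?thesis
    unfolding closed_unital_subalgebra_def
    by (auto simp: free_disk_algebra_def intro: closed_unital_subalgebraD)
qed

lemmas free_disk_algebra_closed = closed_unital_subalgebraD[OF closed_unital_subalgebra_free_disk_algebra]

lemma creation_word_free_disk_algebra: "creation_word \<alpha> \<in> free_disk_algebra"
proof (induction \<alpha>)
  case (Cons k \<alpha>)
  have "creation k \<in> free_disk_algebra" unfolding free_disk_algebra_def by auto
  then show ?case using Cons by (simp add: creation_word_Cons free_disk_algebra_closed)
qed (simp add: free_disk_algebra_closed)

lemma operator_system_free_disk_system: "operator_system (free_disk_system :: 'd fock bop set)"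
  unfolding free_disk_system_def
proof (rule operator_system_closure)
  let ?A = "free_disk_algebra :: 'd fock bop set"
  note A = free_disk_algebra_closed
  show "operator_system {a + b\<^sup>\<dagger> |a b. a \<in> ?A \<and> b \<in> ?A}"
    unfolding operator_system_def
  proof (intro conjI ballI allI)
    show "1 \<in> {a + b\<^sup>\<dagger> |a b. a \<in> ?A \<and> b \<in> ?A}" 
      by (rule CollectI, rule exI[of _ 1], rule exI[of _ 0]) (simp add: A)
  next
    fix x y assume "x \<in> {a + b\<^sup>\<dagger> |a b. a \<in> ?A \<and> b \<in> ?A}" "y \<in> {a + b\<^sup>\<dagger> |a b. a \<in> ?A \<and> b \<in> ?A}"
    then obtain a b a' b' where "x = a + b\<^sup>\<dagger>" "y = a' + b'\<^sup>\<dagger>" "a \<in> ?A" "b \<in> ?A" "a' \<in> ?A" "b' \<in> ?A" by blast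
    then show "x + y \<in> {a + b\<^sup>\<dagger> |a b. a \<in> ?A \<and> b \<in> ?A}"
      by (intro CollectI exI[of _ "a + a'"] exI[of _ "b + b'"]) (simp add: A)
  next
    fix c x assume "x \<in> {a + b\<^sup>\<dagger> |a b. a \<in> ?A \<and> b \<in> ?A}"
    then obtain a b where "x = a + b\<^sup>\<dagger>" "a \<in> ?A" "b \<in> ?A" by blast
    then show "cscale c x \<in> {a + b\<^sup>\<dagger> |a b. a \<in> ?A \<and> b \<in> ?A}"
      by (intro CollectI exI[of _ "cscale c a"] exI[of _ "cscale (cnj c) b"]) (simp add: A cscale_add_right)
  next
    fix x assume "x \<in> {a + b\<^sup>\<dagger> |a b. a \<in> ?A \<and> b \<in> ?A}"
    then obtain a b where "x = a + b\<^sup>\<dagger>" "a \<in> ?A" "b \<in> ?A" by blast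
    then show "x\<^sup>\<dagger> \<in> {a + b\<^sup>\<dagger> |a b. a \<in> ?A \<and> b \<in> ?A}"
      by (intro CollectI exI[of _ b] exI[of _ a]) (simp add: add.commute)
  qed
qed

lemma creation_kernel_free_disk_system: "creation_kernel \<alpha> \<beta> \<in> free_disk_system"
proof (rule toeplitz_kernel_induct[OF toeplitz_creation_kernel, of "\<lambda>\<alpha> \<beta>. creation_kernel \<alpha> \<beta> \<in> free_disk_system"])
  have word: "creation_word \<alpha> \<in> free_disk_system" for \<alpha> :: "'a list"
  proof -
    have "creation_word \<alpha> \<in> {a + b\<^sup>\<dagger> |a b. a \<in> free_disk_algebra \<and> b \<in> free_disk_algebra}"
      by (rule CollectI, rule exI[of _ "creation_word \<alpha>"], rule exI[of _ 0])
        (simp add: free_disk_algebra_closed creation_word_free_disk_algebra)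
    then show ?thesis unfolding free_disk_system_def by (rule closure_subset[THEN subsetD])
  qed
  show "creation_kernel [] \<beta> \<in> free_disk_system" for \<beta> :: "'a list" by (simp add: word)
  show "creation_kernel \<alpha> [] \<in> free_disk_system" for \<alpha> :: "'a list"
    using operator_systemD(4)[OF operator_system_free_disk_system word] by simp
next
  fix \<alpha> \<beta> :: "'a list" and k l :: 'a assume "k \<noteq> l"
  then show "creation_kernel (\<alpha> @ [k]) (\<beta> @ [l]) \<in> free_disk_system"
    by (simp add: creation_kernel_snoc operator_system_0[OF operator_system_free_disk_system])
next
  fix \<alpha> \<beta> :: "'a list" and k :: 'a assume "creation_kernel \<alpha> \<beta> \<in> free_disk_system"
  then show "creation_kernel (\<alpha> @ [k]) (\<beta> @ [k]) \<in> free_disk_system"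
    by (simp add: creation_kernel_snoc)
qed

section \<open>From completely positive maps to Herglotz functions\<close>

text \<open>These are the coefficients of \<open>2 (I - Z L\<^sup>*)\<inverse> - I\<close>.\<close>

lemma herglotz_coefficient:
  "(ZL_adj_resolvent *\<^sub>S (\<lambda>\<beta>. series_const 1 \<beta> + ZL_adj \<beta>)) \<alpha>
    = (if \<alpha> = [] then 1 else 2 *\<^sub>R (creation_word \<alpha>)\<^sup>\<dagger>)"
proof -
  have "(ZL_adj_resolvent *\<^sub>S ZL_adj) \<alpha> = (if \<alpha> = [] then 0 else (creation_word \<alpha>)\<^sup>\<dagger>)"
  proof (cases \<alpha> rule: rev_cases)
    case (snoc \<beta> k)
    have "(ZL_adj_resolvent *\<^sub>S ZL_adj) \<alpha>
        = (\<Sum>i\<le>Suc (length \<beta>). if i = length \<beta> then (creation_word \<alpha>)\<^sup>\<dagger> else 0)"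
      unfolding series_mult_def sum_splits snoc
      by (rule sum.cong) (auto simp: ZL_adj_def ZL_adj_resolvent_eq)
    then show ?thesis by (simp add: snoc)
  qed (simp add: ZL_adj_def)
  then show ?thesis
    unfolding series_mult_distrib by (simp add: ZL_adj_resolvent_eq scaleR_2)
qed

lemma herglotz_series_eq:
  assumes \<phi>: "cp_on free_disk_system \<phi>"
  shows "herglotz_series \<phi> C \<alpha>
    = (if \<alpha> = [] then \<phi> 1 + cscale \<i> C else 2 *\<^sub>R \<phi> ((creation_word \<alpha>)\<^sup>\<dagger>))"
proof -
  have "(creation_word \<alpha>)\<^sup>\<dagger> \<in> free_disk_system"
    using creation_kernel_free_disk_system[of \<alpha> "[]"] by simp
  then have "\<phi> (2 *\<^sub>R (creation_word \<alpha>)\<^sup>\<dagger>) = 2 *\<^sub>R \<phi> ((creation_word \<alpha>)\<^sup>\<dagger>)"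
    using \<phi> unfolding cp_on_def by (metis cscale_of_real)
  then show ?thesis
    unfolding herglotz_series_def herglotz_coefficient by (simp add: series_const_def)
qed

lemma cp_on_one_self_adjoint:
  fixes \<phi> :: "'d fock bop \<Rightarrow> 'h::chilbert_space bop"
  assumes \<phi>: "cp_on free_disk_system \<phi>"
  shows "(\<phi> 1)\<^sup>\<dagger> = \<phi> 1"
  using cp_on_adjoint[OF \<phi> operator_system_free_disk_system operator_systemD(1)[OF operator_system_free_disk_system]]
  by simp

text \<open>Both sides are Toeplitz kernels, so only the first row and the first column need to be
  compared; the first row uses that \<open>\<phi>\<close> preserves adjoints.\<close>

lemma herglotz_series_kernel:
  fixes \<phi> :: "'d fock bop \<Rightarrow> 'h::chilbert_space bop"
  assumes \<phi>: "cp_on free_disk_system \<phi>" and C: "C\<^sup>\<dagger> = C"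
  shows "left_herglotz_kernel (herglotz_series \<phi> C) \<alpha> \<beta> = \<phi> (creation_kernel \<alpha> \<beta>)"
proof (rule toeplitz_kernel_eqI[OF toeplitz_left_herglotz_kernel])
  note S = operator_system_free_disk_system
  show "toeplitz_kernel (\<lambda>\<alpha> \<beta>. \<phi> (creation_kernel \<alpha> \<beta>))"
    using cp_on_0[OF \<phi> S] by (auto simp: toeplitz_kernel_def creation_kernel_snoc)
  have const: "(1/2) *\<^sub>R (herglotz_series \<phi> C [] + (herglotz_series \<phi> C [])\<^sup>\<dagger>) = \<phi> 1"
    unfolding herglotz_series_eq[OF \<phi>]
    by (simp add: C cp_on_one_self_adjoint[OF \<phi>] cscale_minus_left)
  show "left_herglotz_kernel (herglotz_series \<phi> C) \<alpha> [] = \<phi> (creation_kernel \<alpha> [])" for \<alpha>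
    using const by (auto simp: left_herglotz_kernel_Nil herglotz_series_eq[OF \<phi>])
  have adj: "(\<phi> ((creation_word \<beta>)\<^sup>\<dagger>))\<^sup>\<dagger> = \<phi> (creation_word \<beta>)" for \<beta>
    using cp_on_adjoint[OF \<phi> S creation_kernel_free_disk_system[of \<beta> "[]"]] by simp
  have half: "(1/2) *\<^sub>R (2 *\<^sub>R X)\<^sup>\<dagger> = X\<^sup>\<dagger>" for X :: "'h bop"
    by (simp flip: cscale_of_real)
  show "left_herglotz_kernel (herglotz_series \<phi> C) [] \<beta> = \<phi> (creation_kernel [] \<beta>)" for \<beta>
    using const half adj by (auto simp: left_herglotz_kernel_Nil herglotz_series_eq[OF \<phi>])
qed

lemma positive_kernel_herglotz_series:
  fixes \<phi> :: "'d::finite fock bop \<Rightarrow> 'h::chilbert_space bop"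
  assumes \<phi>: "cp_on free_disk_system \<phi>" and C: "C\<^sup>\<dagger> = C"
  shows "positive_kernel (left_herglotz_kernel (herglotz_series \<phi> C))"
  unfolding positive_kernel_def herglotz_series_kernel[OF assms]
proof (intro allI impI)
  fix F :: "'d list set" and h :: "'d list \<Rightarrow> 'h" assume "finite F"
  then obtain f where f: "bij_betw f {0..<card F} F" using ex_bij_betw_nat_finite by blast
  have "positive_operator_matrix (card F) (\<lambda>i j. \<phi> (creation_kernel (f i) (f j)))"
    by (intro cp_on_positive[OF \<phi>] positive_creation_kernel creation_kernel_free_disk_system)
  then have "(\<Sum>i\<in>{0..<card F}. \<Sum>j\<in>{0..<card F}. cinner (bop_apply (\<phi> (creation_kernel (f i) (f j))) (h (f j))) (h (f i))) \<in> \<real>\<^sub>\<ge>\<^sub>0"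
    unfolding positive_operator_matrix_def lessThan_atLeast0 by (auto dest: spec[of _ "\<lambda>i. h (f i)"])
  then show "(\<Sum>\<alpha>\<in>F. \<Sum>\<beta>\<in>F. cinner (bop_apply (\<phi> (creation_kernel \<alpha> \<beta>)) (h \<beta>)) (h \<alpha>)) \<in> \<real>\<^sub>\<ge>\<^sub>0"
    by (simp only: sum.reindex_bij_betw[OF f, of "\<lambda>\<beta>. cinner (bop_apply (\<phi> (creation_kernel _ \<beta>)) (h \<beta>)) (h _)"]
        sum.reindex_bij_betw[OF f, of "\<lambda>\<alpha>. \<Sum>\<beta>\<in>F. cinner (bop_apply (\<phi> (creation_kernel \<alpha> \<beta>)) (h \<beta>)) (h \<alpha>)"])
qed


section \<open>Toeplitz polynomials\<close>

text \<open>A Toeplitz polynomial is a combination of the operators \<open>V\<^sub>\<beta>\<close> and \<open>V\<^sub>\<alpha>\<^sup>\<dagger>\<close>, that is, of the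
  values of the creation kernel on the first row and on the first column.\<close>

definition star_pairs :: "nat \<Rightarrow> ('d::finite list \<times> 'd list) set"
  where "star_pairs N = {(\<alpha>, \<beta>). (\<alpha> = [] \<or> \<beta> = []) \<and> length \<alpha> \<le> N \<and> length \<beta> \<le> N}"

lemma finite_star_pairs [simp]: "finite (star_pairs N)"
  by (rule finite_subset[of _ "words N \<times> words N"]) (auto simp: star_pairs_def words_def[symmetric], auto simp: words_def)

lemma star_pairs_mono: "N \<le> M \<Longrightarrow> star_pairs N \<subseteq> star_pairs M"
  unfolding star_pairs_def by auto

text \<open>If \<open>\<rho>\<close> and \<open>\<sigma>\<close> are comparable in the suffix order, cancelling the common suffix leaves exactly one
  pair \<open>(\<alpha>, \<beta>)\<close> of the star with \<open>\<alpha> \<rho> = \<beta> \<sigma>\<close>; otherwise there is none.\<close>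

lemma toeplitz_kernel_star_expansion:
  fixes T :: "'d::finite list \<Rightarrow> 'd list \<Rightarrow> 'b::comm_monoid_add"
  assumes T: "toeplitz_kernel T" and len: "length \<sigma> \<le> N" "length \<rho> \<le> N"
  shows "T \<sigma> \<rho> = (\<Sum>(\<alpha>, \<beta>)\<in>star_pairs N. if \<alpha> @ \<rho> = \<beta> @ \<sigma> then T \<alpha> \<beta> else 0)"
proof -
  define S where "S \<sigma> \<rho> = (\<Sum>(\<alpha>, \<beta>)\<in>star_pairs N. if \<alpha> @ \<rho> = \<beta> @ \<sigma> then T \<alpha> \<beta> else 0)" for \<sigma> \<rho>
  have pick: "S \<sigma> \<rho> = T \<alpha> \<beta>"
    if "(\<alpha>, \<beta>) \<in> star_pairs N" "\<And>\<alpha>' \<beta>'. (\<alpha>', \<beta>') \<in> star_pairs N \<Longrightarrow> \<alpha>' @ \<rho> = \<beta>' @ \<sigma> \<longleftrightarrow> (\<alpha>', \<beta>') = (\<alpha>, \<beta>)"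
    for \<sigma> \<rho> \<alpha> \<beta>
  proof -
    have "S \<sigma> \<rho> = (\<Sum>p\<in>star_pairs N. if p = (\<alpha>, \<beta>) then T \<alpha> \<beta> else 0)"
      unfolding S_def by (rule sum.cong) (auto simp: that(2) split: if_splits)
    then show ?thesis using that(1) by simp
  qed
  have "length \<sigma> \<le> N \<longrightarrow> length \<rho> \<le> N \<longrightarrow> T \<sigma> \<rho> = S \<sigma> \<rho>"
  proof (rule toeplitz_kernel_induct[OF T, of "\<lambda>\<sigma> \<rho>. length \<sigma> \<le> N \<longrightarrow> length \<rho> \<le> N \<longrightarrow> T \<sigma> \<rho> = S \<sigma> \<rho>"]; intro impI)
    show "T \<sigma> [] = S \<sigma> []" if "length \<sigma> \<le> N" for \<sigma>
      using that by (intro pick[symmetric]) (auto simp: star_pairs_def)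
    show "T [] \<rho> = S [] \<rho>" if "length \<rho> \<le> N" for \<rho>
      using that by (intro pick[symmetric]) (auto simp: star_pairs_def)
  next
    fix \<sigma> \<rho> :: "'d list" and k
    assume "length \<sigma> \<le> N \<longrightarrow> length \<rho> \<le> N \<longrightarrow> T \<sigma> \<rho> = S \<sigma> \<rho>" "length (\<sigma> @ [k]) \<le> N" "length (\<rho> @ [k]) \<le> N"
    then show "T (\<sigma> @ [k]) (\<rho> @ [k]) = S (\<sigma> @ [k]) (\<rho> @ [k])"
      using T by (simp add: S_def toeplitz_kernel_def flip: append_assoc)
  next
    fix \<sigma> \<rho> :: "'d list" and k l :: 'd assume "k \<noteq> l"
    then show "T (\<sigma> @ [k]) (\<rho> @ [l]) = S (\<sigma> @ [k]) (\<rho> @ [l])"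
      using T by (simp add: S_def toeplitz_kernel_def flip: append_assoc)
  qed
  then show ?thesis using len by (simp add: S_def)
qed

lemma cinner_fock_basis: "cinner x (fock_basis \<alpha>) = ell2_coeff x \<alpha>"
proof -
  have "cinner x (fock_basis \<alpha>) = (\<Sum>\<^sub>\<infinity>\<gamma>\<in>{\<alpha>}. ell2_coeff x \<gamma>)"
    unfolding cinner_ell2_def
    by (rule infsum_cong_neutral) (auto simp: fock_basis.rep_eq cinner_complex_def)
  then show ?thesis by simp
qed

lemma cinner_fock_basis': "cinner (fock_basis \<alpha>) x = cnj (ell2_coeff x \<alpha>)"
  using cinner_commute[of "fock_basis \<alpha>" x] by (simp add: cinner_fock_basis)

definition symbol_coeff :: "'d fock bop \<Rightarrow> 'd list \<Rightarrow> 'd list \<Rightarrow> complex"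
  where "symbol_coeff a \<alpha> \<beta> = cinner (bop_apply a (fock_basis (rev \<alpha>))) (fock_basis (rev \<beta>))"

lemma symbol_coeff_linear:
  "symbol_coeff (a + b) \<alpha> \<beta> = symbol_coeff a \<alpha> \<beta> + symbol_coeff b \<alpha> \<beta>"
  "symbol_coeff (cscale c a) \<alpha> \<beta> = c * symbol_coeff a \<alpha> \<beta>"
  "symbol_coeff (\<Sum>i\<in>I. f i) \<alpha> \<beta> = (\<Sum>i\<in>I. symbol_coeff (f i) \<alpha> \<beta>)"
  by (simp_all add: symbol_coeff_def cinner_add_left bop_apply_sum_op cinner_sum_left)

lemma symbol_coeff_creation_kernel:
  "symbol_coeff (creation_kernel \<alpha> \<beta>) \<alpha>' \<beta>' = (if \<alpha>' @ \<beta> = \<beta>' @ \<alpha> then 1 else 0)"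
proof -
  have "rev \<beta> @ rev \<alpha>' = rev \<alpha> @ rev \<beta>' \<longleftrightarrow> \<alpha>' @ \<beta> = \<beta>' @ \<alpha>"
    by (metis rev_append rev_rev_ident)
  then show ?thesis
    unfolding symbol_coeff_def creation_kernel_def bop_apply_simps cinner_adjoint'
      creation_word_fock_basis
    by (auto simp: cinner_fock_basis fock_basis.rep_eq)
qed

text \<open>On the star-shaped index set the coefficient functionals are dual to the creation kernel.\<close>

lemma symbol_coeff_star:
  assumes "(\<alpha>, \<beta>) \<in> star_pairs N" "(\<alpha>', \<beta>') \<in> star_pairs M"
  shows "symbol_coeff (creation_kernel \<alpha> \<beta>) \<alpha>' \<beta>' = (if (\<alpha>', \<beta>') = (\<alpha>, \<beta>) then 1 else 0)"
  unfolding symbol_coeff_creation_kernel using assms by (auto simp: star_pairs_def)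

definition toeplitz_poly :: "nat \<Rightarrow> 'd::finite fock bop \<Rightarrow> bool"
  where "toeplitz_poly N a \<longleftrightarrow>
    a = (\<Sum>(\<alpha>, \<beta>)\<in>star_pairs N. cscale (symbol_coeff a \<alpha> \<beta>) (creation_kernel \<alpha> \<beta>))"

lemma symbol_coeff_star_sum:
  assumes a: "a = (\<Sum>(\<alpha>, \<beta>)\<in>star_pairs N. cscale (t \<alpha> \<beta>) (creation_kernel \<alpha> \<beta>))"
    and p: "(\<alpha>, \<beta>) \<in> star_pairs M"
  shows "symbol_coeff a \<alpha> \<beta> = (if (\<alpha>, \<beta>) \<in> star_pairs N then t \<alpha> \<beta> else 0)"
proof -
  have "symbol_coeff a \<alpha> \<beta> = (\<Sum>q\<in>star_pairs N. if q = (\<alpha>, \<beta>) then t \<alpha> \<beta> else 0)"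
    unfolding a symbol_coeff_linear
    by (rule sum.cong) (auto simp: symbol_coeff_linear symbol_coeff_star[OF _ p] split: if_splits)
  then show ?thesis by simp
qed

lemma toeplitz_polyI:
  assumes "a = (\<Sum>(\<alpha>, \<beta>)\<in>star_pairs N. cscale (t \<alpha> \<beta>) (creation_kernel \<alpha> \<beta>))"
  shows "toeplitz_poly N a"
  unfolding toeplitz_poly_def
  by (subst assms, rule sum.cong) (auto simp: symbol_coeff_star_sum[OF assms])

lemma symbol_coeff_outside:
  assumes "toeplitz_poly N a" "(\<alpha>, \<beta>) \<in> star_pairs M - star_pairs N"
  shows "symbol_coeff a \<alpha> \<beta> = 0"
  using symbol_coeff_star_sum[OF assms(1)[unfolded toeplitz_poly_def], of \<alpha> \<beta> M] assms(2) by auto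

lemma toeplitz_poly_mono:
  assumes a: "toeplitz_poly N a" and "N \<le> M"
  shows "toeplitz_poly M a"
proof -
  have "(\<Sum>(\<alpha>, \<beta>)\<in>star_pairs N. cscale (symbol_coeff a \<alpha> \<beta>) (creation_kernel \<alpha> \<beta>))
      = (\<Sum>(\<alpha>, \<beta>)\<in>star_pairs M. cscale (symbol_coeff a \<alpha> \<beta>) (creation_kernel \<alpha> \<beta>))"
    using star_pairs_mono[OF \<open>N \<le> M\<close>] by (intro sum.mono_neutral_left) (auto simp: symbol_coeff_outside[OF a])
  then show ?thesis using a unfolding toeplitz_poly_def by simp
qed

definition toeplitz_polys :: "'d::finite fock bop set"
  where "toeplitz_polys = {a. \<exists>N. toeplitz_poly N a}"

lemma toeplitz_poly_add: "toeplitz_poly N a \<Longrightarrow> toeplitz_poly N b \<Longrightarrow> toeplitz_poly N (a + b)"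
  by (rule toeplitz_polyI[where t="\<lambda>\<alpha> \<beta>. symbol_coeff a \<alpha> \<beta> + symbol_coeff b \<alpha> \<beta>"])
    (simp add: toeplitz_poly_def cscale_add_left sum.distrib case_prod_unfold)

lemma toeplitz_poly_cscale: "toeplitz_poly N a \<Longrightarrow> toeplitz_poly N (cscale c a)"
proof (rule toeplitz_polyI[where t="\<lambda>\<alpha> \<beta>. c * symbol_coeff a \<alpha> \<beta>"])
  assume "toeplitz_poly N a"
  then have "cscale c a = cscale c (\<Sum>(\<alpha>, \<beta>)\<in>star_pairs N. cscale (symbol_coeff a \<alpha> \<beta>) (creation_kernel \<alpha> \<beta>))"
    unfolding toeplitz_poly_def by simp
  then show "cscale c a = (\<Sum>(\<alpha>, \<beta>)\<in>star_pairs N. cscale (c * symbol_coeff a \<alpha> \<beta>) (creation_kernel \<alpha> \<beta>))"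
    by (simp add: cscale_sum_right case_prod_unfold)
qed

lemma toeplitz_poly_adjoint: "toeplitz_poly N a \<Longrightarrow> toeplitz_poly N (a\<^sup>\<dagger>)"
proof (rule toeplitz_polyI[where t="\<lambda>\<alpha> \<beta>. cnj (symbol_coeff a \<beta> \<alpha>)"])
  assume "toeplitz_poly N a"
  then have "a\<^sup>\<dagger> = (\<Sum>(\<alpha>, \<beta>)\<in>star_pairs N. cscale (symbol_coeff a \<alpha> \<beta>) (creation_kernel \<alpha> \<beta>))\<^sup>\<dagger>"
    unfolding toeplitz_poly_def by simp
  also have "\<dots> = (\<Sum>(\<alpha>, \<beta>)\<in>star_pairs N. cscale (cnj (symbol_coeff a \<alpha> \<beta>)) (creation_kernel \<beta> \<alpha>))"
    by (simp add: cadj_sum case_prod_unfold)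
  also have "\<dots> = (\<Sum>(\<alpha>, \<beta>)\<in>star_pairs N. cscale (cnj (symbol_coeff a \<beta> \<alpha>)) (creation_kernel \<alpha> \<beta>))"
    by (rule sum.reindex_bij_witness[where i=prod.swap and j=prod.swap]) (auto simp: star_pairs_def)
  finally show "a\<^sup>\<dagger> = (\<Sum>(\<alpha>, \<beta>)\<in>star_pairs N. cscale (cnj (symbol_coeff a \<beta> \<alpha>)) (creation_kernel \<alpha> \<beta>))" .
qed

lemma toeplitz_poly_creation_kernel:
  assumes "(\<alpha>, \<beta>) \<in> star_pairs N"
  shows "toeplitz_poly N (creation_kernel \<alpha> \<beta>)"
proof (rule toeplitz_polyI[where t="\<lambda>\<alpha>' \<beta>'. if (\<alpha>', \<beta>') = (\<alpha>, \<beta>) then 1 else 0"])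
  have "(\<Sum>(\<alpha>', \<beta>')\<in>star_pairs N. cscale (if (\<alpha>', \<beta>') = (\<alpha>, \<beta>) then 1 else 0) (creation_kernel \<alpha>' \<beta>'))
      = (\<Sum>p\<in>star_pairs N. if p = (\<alpha>, \<beta>) then creation_kernel \<alpha> \<beta> else 0)"
    by (rule sum.cong) (auto split: if_splits)
  then show "creation_kernel \<alpha> \<beta>
      = (\<Sum>(\<alpha>', \<beta>')\<in>star_pairs N. cscale (if (\<alpha>', \<beta>') = (\<alpha>, \<beta>) then 1 else 0) (creation_kernel \<alpha>' \<beta>'))"
    using assms by simp
qed

lemma toeplitz_poly_one: "toeplitz_poly N 1"
  using toeplitz_poly_creation_kernel[of "[]" "[]" N] by (simp add: star_pairs_def)

lemma operator_system_toeplitz_polys: "operator_system (toeplitz_polys :: 'd::finite fock bop set)"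
  unfolding operator_system_def toeplitz_polys_def
proof (intro conjI ballI allI)
  fix a b :: "'d fock bop"
  assume "a \<in> {a. \<exists>N. toeplitz_poly N a}" "b \<in> {a. \<exists>N. toeplitz_poly N a}"
  then obtain N M where "toeplitz_poly N a" "toeplitz_poly M b" by blast
  then have "toeplitz_poly (max N M) a" "toeplitz_poly (max N M) b"
    by (auto intro: toeplitz_poly_mono)
  then show "a + b \<in> {a. \<exists>N. toeplitz_poly N a}" by (auto intro: toeplitz_poly_add)
qed (auto intro: toeplitz_poly_one toeplitz_poly_cscale toeplitz_poly_adjoint)

lemma toeplitz_polys_subset: "toeplitz_polys \<subseteq> free_disk_system"
proof
  fix a :: "'a fock bop" assume "a \<in> toeplitz_polys"
  then obtain N where "toeplitz_poly N a" unfolding toeplitz_polys_def by blast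
  note a = this[unfolded toeplitz_poly_def]
  show "a \<in> free_disk_system"
    by (subst a, rule operator_system_sum[OF operator_system_free_disk_system])
      (auto intro: operator_systemD(3)[OF operator_system_free_disk_system] creation_kernel_free_disk_system)
qed

inductive_set analytic_polys :: "'d fock bop set" where
  word: "creation_word \<alpha> \<in> analytic_polys"
| add: "a \<in> analytic_polys \<Longrightarrow> b \<in> analytic_polys \<Longrightarrow> a + b \<in> analytic_polys"
| scale: "a \<in> analytic_polys \<Longrightarrow> cscale c a \<in> analytic_polys"

lemma analytic_polys_mult:
  assumes "a \<in> analytic_polys" "b \<in> analytic_polys"
  shows "a * b \<in> analytic_polys"
  using assms(1)
proof induction
  case (word \<alpha>)
  show ?case using assms(2)
  proof induction
    case (word \<beta>)
    show ?case using analytic_polys.word[of "\<beta> @ \<alpha>"] by simp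
  next
    case (scale b c)
    have "creation_word \<alpha> * cscale c b = cscale c (creation_word \<alpha> * b)" by (rule bop_eqI) simp
    then show ?case using scale by (simp add: analytic_polys.scale)
  qed (simp add: distrib_left analytic_polys.add)
next
  case (scale a c)
  have "cscale c a * b = cscale c (a * b)" by (rule bop_eqI) simp
  then show ?case using scale by (simp add: analytic_polys.scale)
qed (simp add: distrib_right analytic_polys.add)

lemma analytic_polys_subset: "a \<in> analytic_polys \<Longrightarrow> a \<in> toeplitz_polys"
proof (induction rule: analytic_polys.induct)
  case (word \<alpha>)
  have "toeplitz_poly (length \<alpha>) (creation_kernel [] \<alpha>)"
    by (rule toeplitz_poly_creation_kernel) (simp add: star_pairs_def)
  then show ?case by (auto simp: toeplitz_polys_def)
qed (auto intro: operator_systemD[OF operator_system_toeplitz_polys])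

lemma closed_unital_subalgebra_closure_analytic_polys:
  "closed_unital_subalgebra (closure analytic_polys)"
  unfolding closed_unital_subalgebra_def
proof (intro conjI ballI allI)
  show "1 \<in> closure analytic_polys"
    using analytic_polys.word[of "[]"] closure_subset by auto
next
  fix a b :: "'a fock bop" assume "a \<in> closure analytic_polys" "b \<in> closure analytic_polys"
  then obtain f g where fg: "\<And>n. f n \<in> analytic_polys" "f \<longlonglongrightarrow> a" "\<And>n. g n \<in> analytic_polys" "g \<longlonglongrightarrow> b"
    unfolding closure_sequential by blast
  show "a + b \<in> closure analytic_polys"
    unfolding closure_sequential
    by (rule exI[of _ "\<lambda>n. f n + g n"]) (auto intro: tendsto_add fg analytic_polys.add)
  show "a * b \<in> closure analytic_polys"
    unfolding closure_sequential
    by (rule exI[of _ "\<lambda>n. f n * g n"]) (auto intro: tendsto_mult fg analytic_polys_mult)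
next
  fix c and a :: "'a fock bop" assume "a \<in> closure analytic_polys"
  then obtain f where f: "\<And>n. f n \<in> analytic_polys" "f \<longlonglongrightarrow> a" unfolding closure_sequential by blast
  show "cscale c a \<in> closure analytic_polys"
    unfolding closure_sequential
    by (rule exI[of _ "\<lambda>n. cscale c (f n)"])
      (auto intro: bounded_linear.tendsto[OF bounded_linear_cscale] f analytic_polys.scale)
qed simp

text \<open>The closure of the analytic polynomials is an algebra, so it contains the free disk algebra.\<close>

lemma free_disk_system_eq: "free_disk_system = closure toeplitz_polys"
proof
  show "closure toeplitz_polys \<subseteq> (free_disk_system :: 'a fock bop set)"
  proof (rule closure_minimal[OF toeplitz_polys_subset])
    show "closed (free_disk_system :: 'a fock bop set)" unfolding free_disk_system_def by simp
  qed
  have "(free_disk_algebra :: 'a fock bop set) \<subseteq> closure analytic_polys"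
    unfolding free_disk_algebra_def
  proof (rule Inter_lower, safe)
    show "creation k \<in> closure analytic_polys" for k :: 'a
      using analytic_polys.word[of "[k]"] closure_subset by auto
  qed (rule closed_unital_subalgebra_closure_analytic_polys)
  also have "\<dots> \<subseteq> closure toeplitz_polys" by (rule closure_mono) (auto intro: analytic_polys_subset)
  finally have A: "(free_disk_algebra :: 'a fock bop set) \<subseteq> closure toeplitz_polys" .
  note S = operator_systemD[OF operator_system_closure[OF operator_system_toeplitz_polys]]
  show "free_disk_system \<subseteq> closure (toeplitz_polys :: 'a fock bop set)"
    unfolding free_disk_system_def
    by (rule closure_minimal) (use A in \<open>auto intro: S\<close>)
qed

text \<open>A completely positive map is bounded, hence determined by its values on Toeplitz polynomials,
  and these are determined by the values on the creation kernel.\<close>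

lemma cp_on_free_disk_system_eqI:
  fixes \<phi> \<psi> :: "'d::finite fock bop \<Rightarrow> 'h::chilbert_space bop"
  assumes \<phi>: "cp_on free_disk_system \<phi>" and \<psi>: "cp_on free_disk_system \<psi>"
    and eq: "\<And>\<alpha> \<beta>. \<phi> (creation_kernel \<alpha> \<beta>) = \<psi> (creation_kernel \<alpha> \<beta>)"
    and a: "a \<in> free_disk_system"
  shows "\<phi> a = \<psi> a"
proof -
  note S = operator_system_free_disk_system
  have poly: "\<phi> p = \<psi> p" if p: "p \<in> toeplitz_polys" for p
  proof -
    obtain N where "toeplitz_poly N p" using p unfolding toeplitz_polys_def by blast
    note p = this[unfolded toeplitz_poly_def]
    have expand: "\<theta> p = (\<Sum>(\<alpha>, \<beta>)\<in>star_pairs N. cscale (symbol_coeff p \<alpha> \<beta>) (\<theta> (creation_kernel \<alpha> \<beta>)))"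
      if \<theta>: "cp_on free_disk_system \<theta>" for \<theta> :: "'d fock bop \<Rightarrow> 'h bop"
    proof -
      have "\<theta> p = (\<Sum>q\<in>star_pairs N. \<theta> (case q of (\<alpha>, \<beta>) \<Rightarrow> cscale (symbol_coeff p \<alpha> \<beta>) (creation_kernel \<alpha> \<beta>)))"
        by (subst p, rule cp_on_sum[OF \<theta> S])
          (auto intro: operator_systemD(3)[OF S] creation_kernel_free_disk_system)
      also have "\<dots> = (\<Sum>(\<alpha>, \<beta>)\<in>star_pairs N. cscale (symbol_coeff p \<alpha> \<beta>) (\<theta> (creation_kernel \<alpha> \<beta>)))"
        by (rule sum.cong) (auto intro: cp_on_cscale[OF \<theta> creation_kernel_free_disk_system])
      finally show ?thesis .
    qed
    show ?thesis unfolding expand[OF \<phi>] expand[OF \<psi>] eq ..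
  qed
  obtain f where f: "\<And>n. f n \<in> toeplitz_polys" "f \<longlonglongrightarrow> a"
    using a unfolding free_disk_system_eq closure_sequential by blast
  have lim: "(\<lambda>n. \<theta> (f n)) \<longlonglongrightarrow> \<theta> a" if \<theta>: "cp_on free_disk_system \<theta>" for \<theta> :: "'d fock bop \<Rightarrow> 'h bop"
  proof (rule Lim_null_comparison[THEN LIM_zero_cancel])
    show "\<forall>\<^sub>F n in sequentially. norm (\<theta> (f n) - \<theta> a) \<le> norm (\<theta> 1) * norm (f n - a)"
    proof (rule always_eventually, rule allI)
      fix n
      have fn: "f n \<in> free_disk_system" using f(1) toeplitz_polys_subset by blast
      show "norm (\<theta> (f n) - \<theta> a) \<le> norm (\<theta> 1) * norm (f n - a)"
        using cp_on_bound[OF \<theta> S operator_system_diff[OF S fn a]]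
        by (simp add: cp_on_diff[OF \<theta> S fn a])
    qed
    show "(\<lambda>n. norm (\<theta> 1) * norm (f n - a)) \<longlonglongrightarrow> 0"
      by (rule tendsto_mult_right_zero[OF tendsto_norm_zero[OF LIM_zero[OF f(2)]]])
  qed
  have "(\<lambda>n. \<phi> (f n)) = (\<lambda>n. \<psi> (f n))" using poly f(1) by auto
  then show ?thesis using lim[OF \<phi>] lim[OF \<psi>] LIMSEQ_unique by metis
qed


section \<open>Orthonormalisation with respect to a positive operator\<close>

inductive_set complex_span :: "'a::complex_inner set \<Rightarrow> 'a set" for S where
  zero: "0 \<in> complex_span S"
| base: "x \<in> S \<Longrightarrow> x \<in> complex_span S"
| add: "x \<in> complex_span S \<Longrightarrow> y \<in> complex_span S \<Longrightarrow> x + y \<in> complex_span S"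
| scale: "x \<in> complex_span S \<Longrightarrow> c *\<^sub>C x \<in> complex_span S"

lemma complex_span_sum: "(\<And>i. i \<in> I \<Longrightarrow> f i \<in> complex_span S) \<Longrightarrow> (\<Sum>i\<in>I. f i) \<in> complex_span S"
  by (induction I rule: infinite_finite_induct) (auto intro: complex_span.intros)

lemma complex_span_diff: "x \<in> complex_span S \<Longrightarrow> y \<in> complex_span S \<Longrightarrow> x - y \<in> complex_span S"
  using complex_span.add[OF _ complex_span.scale[of y S "-1"], of x] by (simp add: scaleC_minus_left)

lemma complex_span_mono: "S \<subseteq> T \<Longrightarrow> x \<in> complex_span S \<Longrightarrow> x \<in> complex_span T"
  by (rotate_tac, induction rule: complex_span.induct) (auto intro: complex_span.intros)

lemma self_adjoint_of_real_form:
  fixes T :: "'a::complex_inner bop"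
  assumes "\<And>x. Im (cinner (bop_apply T x) x) = 0"
  shows "cinner (bop_apply T x) y = cnj (cinner (bop_apply T y) x)"
proof -
  have "Im (cinner (bop_apply T x) y) + Im (cinner (bop_apply T y) x) = 0"
    using assms[of "x + y"] assms[of x] assms[of y] by (simp add: cinner_add_left cinner_add_right)
  moreover have "Re (cinner (bop_apply T y) x) - Re (cinner (bop_apply T x) y) = 0"
    using assms[of "x + \<i> *\<^sub>C y"] assms[of x] assms[of y]
    by (simp add: cinner_add_left cinner_add_right)
  ultimately show ?thesis by (intro complex_eqI) auto
qed

lemma Gram_Schmidt:
  fixes T :: "'a::complex_inner bop" and w :: "nat \<Rightarrow> 'a"
  assumes herm: "\<And>x. Im (cinner (bop_apply T x) x) = 0"
    and pos: "\<And>x. x \<noteq> 0 \<Longrightarrow> 0 < Re (cinner (bop_apply T x) x)"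
  obtains m and v :: "nat \<Rightarrow> 'a" where
    "\<And>k l. k < m \<Longrightarrow> l < m \<Longrightarrow> cinner (bop_apply T (v k)) (v l) = (if k = l then 1 else 0)"
    "\<And>l. l < m \<Longrightarrow> v l \<in> complex_span (w ` {..<n})"
    "\<And>i. i < n \<Longrightarrow> w i \<in> complex_span (v ` {..<m})"
proof -
  have "\<exists>m (v :: nat \<Rightarrow> 'a). (\<forall>k<m. \<forall>l<m. cinner (bop_apply T (v k)) (v l) = (if k = l then 1 else 0)) \<and>
    (\<forall>l<m. v l \<in> complex_span (w ` {..<n})) \<and> (\<forall>i<n. w i \<in> complex_span (v ` {..<m}))"
  proof (induction n)
    case (Suc n)
    then obtain m and v :: "nat \<Rightarrow> 'a" where "(\<forall>k<m. \<forall>l<m. cinner (bop_apply T (v k)) (v l) = (if k = l then 1 else 0)) \<and>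
      (\<forall>l<m. v l \<in> complex_span (w ` {..<n})) \<and> (\<forall>i<n. w i \<in> complex_span (v ` {..<m}))" by (elim exE) (rule that)
    then have orth: "\<And>k l. k < m \<Longrightarrow> l < m \<Longrightarrow> cinner (bop_apply T (v k)) (v l) = (if k = l then 1 else 0)"
      and v: "\<And>l. l < m \<Longrightarrow> v l \<in> complex_span (w ` {..<n})"
      and w: "\<And>i. i < n \<Longrightarrow> w i \<in> complex_span (v ` {..<m})" by auto
    define s where "s = (\<Sum>l<m. cinner (bop_apply T (w n)) (v l) *\<^sub>C v l)"
    define r where "r = w n - s"
    have v': "v l \<in> complex_span (w ` {..<Suc n})" if "l < m" for l
      by (rule complex_span_mono[OF _ v[OF that]]) auto
    have s: "s \<in> complex_span (v ` {..<m})" "s \<in> complex_span (w ` {..<Suc n})"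
      unfolding s_def by (auto intro!: complex_span_sum complex_span.scale v' intro: complex_span.base)
    have r: "r \<in> complex_span (w ` {..<Suc n})"
      unfolding r_def by (intro complex_span_diff s complex_span.base) auto
    have Tr: "cinner (bop_apply T r) (v k) = 0" if "k < m" for k
    proof -
      have "cinner (bop_apply T s) (v k) = (\<Sum>l<m. cinner (bop_apply T (w n)) (v l) * cinner (bop_apply T (v l)) (v k))"
        unfolding s_def by (simp add: bop_apply_sum cinner_sum_left)
      also have "\<dots> = (\<Sum>l<m. if l = k then cinner (bop_apply T (w n)) (v l) else 0)"
        by (rule sum.cong) (use orth that in auto)
      finally show ?thesis using that by (simp add: r_def cinner_diff_left)
    qed
    show ?case
    proof (cases "r = 0")
      case True
      then have "w n \<in> complex_span (v ` {..<m})" using s by (simp add: r_def)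
      then show ?thesis using orth v' w less_Suc_eq by (intro exI[of _ m] exI[of _ v]) auto
    next
      case False
      define q where "q = Re (cinner (bop_apply T r) r)"
      have q: "q > 0" "cinner (bop_apply T r) r = of_real q"
        using pos[OF False] herm[of r] by (auto simp: q_def complex_eq_iff)
      define u where "u = (1 / sqrt q) *\<^sub>R r"
      define v1 where "v1 = v(m := u)"
      have u: "u \<in> complex_span (w ` {..<Suc n})"
        unfolding u_def scaleC_of_real[symmetric] by (rule complex_span.scale[OF r])
      have Tu: "cinner (bop_apply T u) (v k) = 0" if "k < m" for k
        using Tr[OF that] by (simp add: u_def)
      have uT: "cinner (bop_apply T (v k)) u = 0" if "k < m" for k
        using self_adjoint_of_real_form[OF herm, of "v k" u] Tu[OF that] by simp
      have uu: "cinner (bop_apply T u) u = 1"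
        using q by (simp add: u_def flip: of_real_mult of_real_divide)
      have v1: "v1 ` {..<m} = v ` {..<m}" "v1 m = u" "\<And>l. l < m \<Longrightarrow> v1 l = v l"
        by (auto simp: v1_def)
      have span: "complex_span (v ` {..<m}) \<subseteq> complex_span (v1 ` {..<Suc m})"
      proof
        fix x assume "x \<in> complex_span (v ` {..<m})"
        then show "x \<in> complex_span (v1 ` {..<Suc m})"
          unfolding v1(1)[symmetric] by (rule complex_span_mono[rotated]) auto
      qed
      have "w n = s + of_real (sqrt q) *\<^sub>C u"
        using q unfolding u_def scaleC_of_real by (simp add: r_def)
      moreover have "u \<in> complex_span (v1 ` {..<Suc m})"
        by (rule complex_span.base) (use v1(2) in \<open>auto simp: image_iff intro!: bexI[of _ m]\<close>)
      ultimately have "w n \<in> complex_span (v1 ` {..<Suc m})"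
        using s span by (auto intro!: complex_span.add complex_span.scale)
      then have "\<forall>i<Suc n. w i \<in> complex_span (v1 ` {..<Suc m})"
        using w span by (auto simp: less_Suc_eq)
      moreover have "\<forall>l<Suc m. v1 l \<in> complex_span (w ` {..<Suc n})"
        using v' u v1 by (auto simp: less_Suc_eq)
      moreover have "\<forall>k<Suc m. \<forall>l<Suc m. cinner (bop_apply T (v1 k)) (v1 l) = (if k = l then 1 else 0)"
        using orth Tu uT uu v1 by (auto simp: less_Suc_eq)
      ultimately show ?thesis by blast
    qed
  qed (auto intro: exI[of _ 0])
  then obtain m and v :: "nat \<Rightarrow> 'a" where "(\<forall>k<m. \<forall>l<m. cinner (bop_apply T (v k)) (v l) = (if k = l then 1 else 0)) \<and>
    (\<forall>l<m. v l \<in> complex_span (w ` {..<n})) \<and> (\<forall>i<n. w i \<in> complex_span (v ` {..<m}))" by (elim exE) (rule that)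
  then show ?thesis by (intro that[of m v]) auto
qed

section \<open>Right creation operators\<close>

text \<open>Reversal of words is a unitary that exchanges left and right creation operators.\<close>

lemma ex_flip: "\<exists>U :: 'd fock bop. \<forall>x \<alpha>. ell2_coeff (bop_apply U x) \<alpha> = ell2_coeff x (rev \<alpha>)"
proof -
  have "\<exists>G. ell2_coeff G = (\<lambda>\<alpha>. ell2_coeff F (rev \<alpha>)) \<and> norm G \<le> norm F" for F :: "'d fock"
    by (rule ex_ell2_rev[of F]) blast
  then obtain u :: "'d fock \<Rightarrow> 'd fock" where
    "\<forall>F. ell2_coeff (u F) = (\<lambda>\<alpha>. ell2_coeff F (rev \<alpha>)) \<and> norm (u F) \<le> norm F"
    using choice[of "\<lambda>F G. ell2_coeff G = (\<lambda>\<alpha>. ell2_coeff F (rev \<alpha>)) \<and> norm G \<le> norm F"] by blast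
  then have u: "\<And>F \<alpha>. ell2_coeff (u F) \<alpha> = ell2_coeff F (rev \<alpha>)" "\<And>F. norm (u F) \<le> norm F"
    by auto
  have "u (x + y) = u x + u y" "u (c *\<^sub>C x) = c *\<^sub>C u x" for x y c
    by (auto simp: ell2_coeff_inject[symmetric] u plus_ell2.rep_eq scaleC_ell2.rep_eq)
  moreover have "norm (u x) \<le> 1 * norm x" for x using u(2) by simp
  ultimately obtain U where "\<And>x. bop_apply U x = u x" by (rule Abs_bop_apply) (rule that)
  then show ?thesis using u by (intro exI[of _ U]) simp
qed

definition flip_op :: "'d fock bop"
  where "flip_op = (SOME U. \<forall>x \<alpha>. ell2_coeff (bop_apply U x) \<alpha> = ell2_coeff x (rev \<alpha>))"

lemma flip_op [simp]: "ell2_coeff (bop_apply flip_op x) \<alpha> = ell2_coeff x (rev \<alpha>)"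
  using someI_ex[OF ex_flip] unfolding flip_op_def by blast

lemma flip_flip [simp]: "bop_apply flip_op (bop_apply flip_op x) = x"
  by (simp add: ell2_coeff_inject[symmetric] fun_eq_iff)

lemma cinner_flip_flip: "cinner (bop_apply flip_op x) (bop_apply flip_op y) = cinner x y"
proof -
  have "bij (rev :: 'a list \<Rightarrow> 'a list)" by (rule involuntory_imp_bij) simp
  then show ?thesis
    unfolding cinner_ell2_def flip_op
    by (rule infsum_reindex_bij_betw[of rev UNIV UNIV "\<lambda>\<alpha>. cinner (ell2_coeff x \<alpha>) (ell2_coeff y \<alpha>)"])
qed

definition right_word :: "'d list \<Rightarrow> 'd fock bop"
  where "right_word \<alpha> = flip_op * creation_word \<alpha> * flip_op"

lemma right_word_append: "right_word (\<alpha> @ \<beta>) = right_word \<beta> * right_word \<alpha>"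
  by (rule bop_eqI) (simp add: right_word_def)

lemma right_word_Nil [simp]: "right_word [] = 1"
  by (rule bop_eqI) (simp add: right_word_def)

lemma creation_kernel_same_length:
  "length \<alpha> = length \<beta> \<Longrightarrow> creation_kernel \<alpha> \<beta> = (if \<alpha> = \<beta> then 1 else 0)"
proof (induction \<alpha> arbitrary: \<beta> rule: rev_induct)
  case (snoc k \<alpha>)
  then show ?case by (cases \<beta> rule: rev_cases) (auto simp: creation_kernel_snoc)
qed simp

lemma cinner_right_word:
  assumes "length \<alpha> = length \<beta>"
  shows "cinner (bop_apply (right_word \<alpha>) x) (bop_apply (right_word \<beta>) y) = (if \<alpha> = \<beta> then cinner x y else 0)"
proof -
  have "cinner (bop_apply (right_word \<alpha>) x) (bop_apply (right_word \<beta>) y)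
      = cinner (bop_apply (creation_kernel \<beta> \<alpha>) (bop_apply flip_op x)) (bop_apply flip_op y)"
    by (simp add: right_word_def cinner_flip_flip creation_kernel_def cinner_adjoint')
  then show ?thesis using assms by (auto simp: creation_kernel_same_length cinner_flip_flip)
qed

lemma ell2_coeff_creation:
  "ell2_coeff (bop_apply (creation k) x) \<gamma> = (if \<gamma> \<noteq> [] \<and> hd \<gamma> = k then ell2_coeff x (tl \<gamma>) else 0)"
  by (simp add: bop_apply_creation shift_ell2.rep_eq)

lemma ell2_coeff_creation_word_short:
  "length \<gamma> < length \<alpha> \<Longrightarrow> ell2_coeff (bop_apply (creation_word \<alpha>) x) \<gamma> = 0"
proof (induction \<alpha> arbitrary: \<gamma> rule: rev_induct)
  case (snoc k \<alpha>)
  then show ?case by (cases \<gamma>) (auto simp: ell2_coeff_creation)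
qed simp

lemma ell2_coeff_right_word_short:
  "length \<gamma> < length \<alpha> \<Longrightarrow> ell2_coeff (bop_apply (right_word \<alpha>) x) \<gamma> = 0"
  by (simp add: right_word_def ell2_coeff_creation_word_short)

lemma flip_fock_basis: "bop_apply flip_op (fock_basis \<alpha>) = fock_basis (rev \<alpha>)"
  by (auto simp: ell2_coeff_inject[symmetric] fun_eq_iff fock_basis.rep_eq)

lemma right_word_fock_basis: "bop_apply (right_word \<alpha>) (fock_basis \<beta>) = fock_basis (\<beta> @ \<alpha>)"
  by (simp add: right_word_def flip_fock_basis creation_word_fock_basis)

lemma ell2_coeff_right_word:
  assumes "length \<alpha> = length \<beta>"
  shows "ell2_coeff (bop_apply (right_word \<alpha>) x) (\<delta> @ \<beta>) = (if \<alpha> = \<beta> then ell2_coeff x \<delta> else 0)"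
  using cinner_right_word[OF assms, of x "fock_basis \<delta>"]
  by (simp add: right_word_fock_basis cinner_fock_basis)

lemma right_word_adjoint_coeff:
  "ell2_coeff (bop_apply ((right_word \<alpha>)\<^sup>\<dagger>) x) \<delta> = ell2_coeff x (\<delta> @ \<alpha>)"
  by (simp add: cinner_fock_basis[symmetric] cinner_adjoint' right_word_fock_basis)

lemma ell2_coeff_sum: "ell2_coeff (\<Sum>i\<in>I. f i) \<gamma> = (\<Sum>i\<in>I. ell2_coeff (f i) \<gamma>)"
  by (induction I rule: infinite_finite_induct) (auto simp: zero_ell2.rep_eq plus_ell2.rep_eq)

text \<open>Sort the words by their last \<open>m\<close> letters.\<close>

lemma right_word_decomposition:
  fixes x :: "'d::finite fock"
  assumes "\<And>\<gamma>. length \<gamma> < m \<Longrightarrow> ell2_coeff x \<gamma> = 0"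
  shows "x = (\<Sum>\<alpha> | length \<alpha> = m. bop_apply (right_word \<alpha>) (bop_apply ((right_word \<alpha>)\<^sup>\<dagger>) x))"
  unfolding ell2_coeff_inject[symmetric]
proof
  fix \<gamma> :: "'d list"
  show "ell2_coeff x \<gamma> = ell2_coeff (\<Sum>\<alpha> | length \<alpha> = m. bop_apply (right_word \<alpha>) (bop_apply ((right_word \<alpha>)\<^sup>\<dagger>) x)) \<gamma>"
  proof (cases "length \<gamma> < m")
    case True
    then show ?thesis using assms by (simp add: ell2_coeff_sum ell2_coeff_right_word_short)
  next
    case False
    define \<delta> \<beta> where "\<delta> = take (length \<gamma> - m) \<gamma>" and "\<beta> = drop (length \<gamma> - m) \<gamma>"
    have \<gamma>: "\<gamma> = \<delta> @ \<beta>" "length \<beta> = m" using False by (auto simp: \<delta>_def \<beta>_def)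
    have "(\<Sum>\<alpha> | length \<alpha> = m. ell2_coeff (bop_apply (right_word \<alpha>) (bop_apply ((right_word \<alpha>)\<^sup>\<dagger>) x)) \<gamma>)
        = (\<Sum>\<alpha> | length \<alpha> = m. if \<alpha> = \<beta> then ell2_coeff x \<gamma> else 0)"
      unfolding \<gamma>(1) by (rule sum.cong) (auto simp: ell2_coeff_right_word \<gamma>(2) right_word_adjoint_coeff)
    then show ?thesis using \<gamma>(2) by (simp add: ell2_coeff_sum)
  qed
qed

lemma creation_right_creation_commute: "creation k * right_word [l] = right_word [l] * creation k"
proof (rule bop_eqI, unfold ell2_coeff_inject[symmetric], rule ext)
  fix x and \<gamma> :: "'a list"
  have right: "ell2_coeff (bop_apply (right_word [l]) x) \<gamma>
      = (if \<gamma> \<noteq> [] \<and> last \<gamma> = l then ell2_coeff x (butlast \<gamma>) else 0)" for x \<gamma>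
    by (cases \<gamma> rule: rev_cases) (auto simp: right_word_def ell2_coeff_creation)
  show "ell2_coeff (bop_apply (creation k * right_word [l]) x) \<gamma> = ell2_coeff (bop_apply (right_word [l] * creation k) x) \<gamma>"
  proof (cases \<gamma>)
    case (Cons j \<delta>)
    then show ?thesis by (cases \<delta> rule: rev_cases) (auto simp: right ell2_coeff_creation)
  qed (simp add: right ell2_coeff_creation)
qed

lemma creation_word_right_word_commute: "creation_word \<alpha> * right_word \<beta> = right_word \<beta> * creation_word \<alpha>"
proof (induction \<alpha>)
  case (Cons k \<alpha>)
  have k: "creation k * right_word \<beta> = right_word \<beta> * creation k" for \<beta>
  proof (induction \<beta> rule: rev_induct)
    case (snoc l \<beta>)
    have "creation k * right_word (\<beta> @ [l]) = (creation k * right_word [l]) * right_word \<beta>"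
      by (simp add: right_word_append mult.assoc)
    also have "\<dots> = right_word [l] * (creation k * right_word \<beta>)"
      by (simp add: creation_right_creation_commute mult.assoc)
    also have "\<dots> = right_word (\<beta> @ [l]) * creation k"
      by (simp add: snoc right_word_append mult.assoc)
    finally show ?case .
  qed simp
  have "creation_word (k # \<alpha>) * right_word \<beta> = creation_word \<alpha> * (creation k * right_word \<beta>)"
    by (simp add: creation_word_Cons mult.assoc)
  also have "\<dots> = (creation_word \<alpha> * right_word \<beta>) * creation k" by (simp add: k mult.assoc)
  finally show ?case by (simp add: Cons creation_word_Cons mult.assoc)
qed simp

lemma creation_word_right_word_apply:
  "bop_apply (creation_word \<alpha>) (bop_apply (right_word \<beta>) x) = bop_apply (right_word \<beta>) (bop_apply (creation_word \<alpha>) x)"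
  by (simp only: creation_word_right_word_commute flip: bop_apply_simps(7))

text \<open>Left creation operators commute with right ones, so Toeplitz polynomials are Toeplitz with
  respect to the right creation operators.\<close>

lemma toeplitz_poly_right_words:
  assumes a: "toeplitz_poly N a" and len: "length \<rho> = length \<sigma>"
  shows "cinner (bop_apply a (bop_apply (right_word \<rho>) x)) (bop_apply (right_word \<sigma>) y)
    = (if \<rho> = \<sigma> then cinner (bop_apply a x) y else 0)"
proof -
  note a = a[unfolded toeplitz_poly_def]
  have "cinner (bop_apply (creation_kernel \<alpha> \<beta>) (bop_apply (right_word \<rho>) x)) (bop_apply (right_word \<sigma>) y)
      = (if \<rho> = \<sigma> then cinner (bop_apply (creation_kernel \<alpha> \<beta>) x) y else 0)" for \<alpha> \<beta>
    by (simp add: creation_kernel_def cinner_adjoint' creation_word_right_word_apply cinner_right_word[OF len])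
  then show ?thesis
    by (subst (1 2) a) (simp add: bop_apply_sum_op cinner_sum_left case_prod_unfold)
qed

text \<open>A Toeplitz polynomial of degree \<open>N\<close> maps the vacuum vector into the span of the words of length at
  most \<open>N\<close>, and the range of a right word vanishes on words that are shorter than it.\<close>

lemma toeplitz_poly_vacuum_right_word:
  assumes a: "toeplitz_poly N a" and len: "N < length \<sigma>"
  shows "cinner (bop_apply a (fock_basis [])) (bop_apply (right_word \<sigma>) y) = 0"
proof -
  note a = a[unfolded toeplitz_poly_def]
  have "cinner (bop_apply (creation_kernel \<alpha> \<beta>) (fock_basis [])) (bop_apply (right_word \<sigma>) y) = 0"
    if "(\<alpha>, \<beta>) \<in> star_pairs N" for \<alpha> \<beta>
    using that len
    by (simp add: creation_kernel_def cinner_adjoint' creation_word_right_word_apply creation_word_fock_basis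
        cinner_fock_basis' ell2_coeff_right_word_short star_pairs_def)
  then show ?thesis
    by (subst a) (auto simp: bop_apply_sum_op cinner_sum_left case_prod_unfold intro!: sum.neutral)
qed


section \<open>Direct sums of copies of a Hilbert space\<close>

definition ampliation :: "'a::complex_inner bop \<Rightarrow> ('i, 'a) ell2 \<Rightarrow> ('i, 'a) ell2"
  where "ampliation A z = Abs_ell2 (\<lambda>i. bop_apply A (ell2_coeff z i))"

lemma ell2_coeff_ampliation [simp]: "ell2_coeff (ampliation A z) i = bop_apply A (ell2_coeff z i)"
proof -
  have "(\<lambda>i. (norm (bop_apply A (ell2_coeff z i)))\<^sup>2) summable_on UNIV"
  proof (rule square_summable_comparison)
    show "(\<lambda>i. (norm A)\<^sup>2 * (norm (ell2_coeff z i))\<^sup>2) summable_on UNIV"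
      by (rule summable_on_cmult_right[OF ell2_summable])
    show "norm ((norm (bop_apply A (ell2_coeff z i)))\<^sup>2) \<le> (norm A)\<^sup>2 * (norm (ell2_coeff z i))\<^sup>2" for i
      using power_mono[OF norm_bop_apply_le[of A "ell2_coeff z i"], of 2] by (simp add: power_mult_distrib)
  qed
  then show ?thesis unfolding ampliation_def by (simp add: Abs_ell2_inverse)
qed

lemma ell2_eqI: "(\<And>i. ell2_coeff x i = ell2_coeff y i) \<Longrightarrow> x = y"
  by (simp add: ell2_coeff_inject[symmetric] fun_eq_iff)

lemma ampliation_linear:
  "ampliation A (x + y) = ampliation A x + ampliation A y"
  "ampliation A (c *\<^sub>C x) = c *\<^sub>C ampliation A x"
  "ampliation A 0 = 0"
  "ampliation (A * B) x = ampliation A (ampliation B x)"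
  "ampliation 1 x = x"
  by (auto intro!: ell2_eqI simp: plus_ell2.rep_eq scaleC_ell2.rep_eq zero_ell2.rep_eq)

lemma ampliation_sum: "ampliation A (\<Sum>i\<in>I. f i) = (\<Sum>i\<in>I. ampliation A (f i))"
  by (induction I rule: infinite_finite_induct) (auto simp: ampliation_linear)

lemma cinner_ampliation_right_words:
  assumes "length \<rho> = length \<sigma>"
  shows "cinner (ampliation (right_word \<rho>) x) (ampliation (right_word \<sigma>) y) = (if \<rho> = \<sigma> then cinner x y else 0)"
  unfolding cinner_ell2_def[of "ampliation _ _"] ell2_coeff_ampliation cinner_right_word[OF assms]
  by (auto simp: cinner_ell2_def[of x y])

definition ell2_single :: "'i \<Rightarrow> 'a::complex_inner \<Rightarrow> ('i, 'a) ell2"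
  where "ell2_single i x = Abs_ell2 (\<lambda>j. if j = i then x else 0)"

lemma ell2_coeff_single: "ell2_coeff (ell2_single i x) j = (if j = i then x else 0)"
proof -
  have "(\<lambda>j. (norm (if j = i then x else 0))\<^sup>2) summable_on UNIV"
    by (rule summable_on_cong_neutral[THEN iffD1, OF _ _ _ summable_on_finite[of "{i}"]]) auto
  then show ?thesis unfolding ell2_single_def by (simp add: Abs_ell2_inverse)
qed

lemma cinner_ell2_single: "cinner (ell2_single i x) z = cinner x (ell2_coeff z i)"
proof -
  have "cinner (ell2_single i x) z = (\<Sum>\<^sub>\<infinity>j\<in>{i}. cinner x (ell2_coeff z j))"
    unfolding cinner_ell2_def by (rule infsum_cong_neutral) (auto simp: ell2_coeff_single)
  then show ?thesis by simp
qed

lemma norm_ell2_single [simp]: "norm (ell2_single i x) = norm x"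
proof -
  have "complex_of_real ((norm (ell2_single i x))\<^sup>2) = complex_of_real ((norm x)\<^sup>2)"
    unfolding cinner_same[symmetric] cinner_ell2_single by (simp add: ell2_coeff_single)
  then show ?thesis by (simp add: power2_eq_iff_nonneg flip: of_real_power)
qed

lemma ell2_single_linear:
  "ell2_single i (x + y) = ell2_single i x + ell2_single i y"
  "ell2_single i (c *\<^sub>C x) = c *\<^sub>C ell2_single i x"
  by (auto intro!: ell2_eqI simp: ell2_coeff_single plus_ell2.rep_eq scaleC_ell2.rep_eq)

lemma ampliation_single: "ampliation A (ell2_single i x) = ell2_single i (bop_apply A x)"
  by (rule ell2_eqI) (simp add: ell2_coeff_single)

section \<open>Factorisation of positive Toeplitz polynomials\<close>

locale positive_toeplitz_matrix =
  fixes n N :: nat and P :: "nat \<Rightarrow> nat \<Rightarrow> 'd::finite fock bop" and e :: real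
  assumes poly: "\<And>i j. i < n \<Longrightarrow> j < n \<Longrightarrow> toeplitz_poly N (P i j)"
    and positive: "positive_operator_matrix n P"
    and e_pos: "0 < e"
begin

lemma ex_block_op: "\<exists>T. \<forall>z. bop_apply T z
    = (\<Sum>i<n. \<Sum>j<n. ell2_single i (bop_apply (P i j) (ell2_coeff z j))) + e *\<^sub>R z"
proof -
  define f where "f z = (\<Sum>i<n. \<Sum>j<n. ell2_single i (bop_apply (P i j) (ell2_coeff z j))) + e *\<^sub>R z"
    for z :: "(nat, 'd fock) ell2"
  have 1: "f (x + y) = f x + f y" for x y
    by (simp add: f_def plus_ell2.rep_eq ell2_single_linear sum.distrib scaleR_add_right)
  have 2: "f (c *\<^sub>C x) = c *\<^sub>C f x" for c x
    by (simp add: f_def scaleC_ell2.rep_eq ell2_single_linear scaleC_sum_right scaleC_add_right scaleC_scaleR)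
  have 3: "norm (f x) \<le> ((\<Sum>i<n. \<Sum>j<n. norm (P i j)) + e) * norm x" for x
  proof -
    have "norm (bop_apply (P i j) (ell2_coeff x j)) \<le> norm (P i j) * norm x" for i j
      using norm_bop_apply_le[of "P i j" "ell2_coeff x j"]
        mult_left_mono[OF norm_ell2_coeff_le[of x j], of "norm (P i j)"] by simp
    then have "norm (\<Sum>i<n. \<Sum>j<n. ell2_single i (bop_apply (P i j) (ell2_coeff x j)))
        \<le> (\<Sum>i<n. \<Sum>j<n. norm (P i j) * norm x)"
      by (intro sum_norm_le) simp
    then have "norm (f x) \<le> (\<Sum>i<n. \<Sum>j<n. norm (P i j) * norm x) + e * norm x"
      unfolding f_def using e_pos by (intro norm_triangle_le add_mono) auto
    then show ?thesis by (simp add: sum_distrib_right distrib_right)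
  qed
  obtain T where "\<And>z. bop_apply T z = f z" by (rule Abs_bop_apply[OF 1 2 3]) (rule that)
  then show ?thesis unfolding f_def by (intro exI[of _ T]) simp
qed

text \<open>The operator matrix acts on the first \<open>n\<close> summands of the infinite direct sum; the multiple \<open>e\<close> of
  the identity makes it coercive on all of them.\<close>

definition block_op :: "(nat, 'd fock) ell2 bop"
  where "block_op = (SOME T. \<forall>z. bop_apply T z
    = (\<Sum>i<n. \<Sum>j<n. ell2_single i (bop_apply (P i j) (ell2_coeff z j))) + e *\<^sub>R z)"

lemma block_op_apply: "bop_apply block_op z
    = (\<Sum>i<n. \<Sum>j<n. ell2_single i (bop_apply (P i j) (ell2_coeff z j))) + e *\<^sub>R z"
  using someI_ex[OF ex_block_op] unfolding block_op_def by blast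

definition form :: "(nat, 'd fock) ell2 \<Rightarrow> (nat, 'd fock) ell2 \<Rightarrow> complex"
  where "form x y = cinner (bop_apply block_op x) y"

lemma form_eq: "form x y
    = (\<Sum>i<n. \<Sum>j<n. cinner (bop_apply (P i j) (ell2_coeff x j)) (ell2_coeff y i)) + of_real e * cinner x y"
  by (simp add: form_def block_op_apply cinner_add_left cinner_sum_left cinner_ell2_single)

lemma form_linear:
  "form (x + y) z = form x z + form y z" "form (c *\<^sub>C x) z = c * form x z" "form (x - y) z = form x z - form y z"
  "form x (y + z) = form x y + form x z" "form x (c *\<^sub>C y) = cnj c * form x y" "form x 0 = 0"
  "form (\<Sum>i\<in>I. f i) z = (\<Sum>i\<in>I. form (f i) z)" "form z (\<Sum>i\<in>I. f i) = (\<Sum>i\<in>I. form z (f i))"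
  by (simp_all add: form_def cinner_add_left cinner_add_right cinner_diff_left bop_apply_sum
      cinner_sum_left cinner_sum_right)

lemma form_coercive: "Im (form x x) = 0" "e * (norm x)\<^sup>2 \<le> Re (form x x)"
proof -
  have "(\<Sum>i<n. \<Sum>j<n. cinner (bop_apply (P i j) (ell2_coeff x j)) (ell2_coeff x i)) \<in> \<real>\<^sub>\<ge>\<^sub>0"
    using positive unfolding positive_operator_matrix_def by blast
  then show "Im (form x x) = 0" "e * (norm x)\<^sup>2 \<le> Re (form x x)"
    by (auto simp: form_eq cinner_same complex_nonneg_Reals_iff simp flip: of_real_mult)
qed

lemma form_hermitian: "form x y = cnj (form y x)"
  unfolding form_def by (rule self_adjoint_of_real_form) (use form_coercive(1) in \<open>simp add: form_def\<close>)

lemma form_right_words: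
  assumes "length \<rho> = length \<sigma>"
  shows "form (ampliation (right_word \<rho>) x) (ampliation (right_word \<sigma>) y) = (if \<rho> = \<sigma> then form x y else 0)"
proof -
  have "cinner (bop_apply (P i j) (bop_apply (right_word \<rho>) (ell2_coeff x j))) (bop_apply (right_word \<sigma>) (ell2_coeff y i))
      = (if \<rho> = \<sigma> then cinner (bop_apply (P i j) (ell2_coeff x j)) (ell2_coeff y i) else 0)"
    if "i < n" "j < n" for i j
    by (rule toeplitz_poly_right_words[OF poly[OF that] assms])
  then show ?thesis by (simp add: form_eq cinner_ampliation_right_words[OF assms])
qed

abbreviation vacuum :: "nat \<Rightarrow> (nat, 'd fock) ell2"
  where "vacuum i \<equiv> ell2_single i (fock_basis [])"

lemma cinner_vacuum_right_word:
  "\<alpha> \<noteq> [] \<Longrightarrow> cinner (vacuum i) (ampliation (right_word \<alpha>) y) = 0"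
  by (simp add: cinner_ell2_single cinner_fock_basis' ell2_coeff_right_word_short)

lemma form_vacuum_right_word:
  assumes "j < n" "N < length \<alpha>"
  shows "form (vacuum j) (ampliation (right_word \<alpha>) y) = 0"
proof -
  have "cinner (bop_apply (P i k) (ell2_coeff (vacuum j) k)) (bop_apply (right_word \<alpha>) (ell2_coeff y i)) = 0"
    if "i < n" "k < n" for i k
    using toeplitz_poly_vacuum_right_word[OF poly assms(2), of i j] that(1) assms(1)
    by (simp add: ell2_coeff_single)
  moreover have "\<alpha> \<noteq> []" using assms(2) by auto
  ultimately show ?thesis by (simp add: form_eq cinner_vacuum_right_word)
qed

text \<open>The vectors \<open>w\<^sub>i = T\<inverse> (e\<^sub>\<emptyset> \<otimes> \<epsilon>\<^sub>i)\<close>, where \<open>T\<close> is the block operator, span the wandering space of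
  the right creation operators in the inner product \<open>\<langle>T x, y\<rangle>\<close>. An orthonormal basis \<open>v\<close> of this space
  yields the orthonormal system \<open>R\<^sup>\<alpha> v\<^sub>l\<close>. It is total: a vector \<open>y\<close> that is orthogonal to it has
  vanishing coefficients at all words, by induction on their length, since on vectors supported on words
  of length at least \<open>m\<close> the form \<open>\<langle>T R\<^sup>\<alpha> w\<^sub>i, y\<rangle>\<close> is the conjugate of the coefficient of the \<open>i\<close>-th
  component of \<open>y\<close> at the word \<open>\<alpha>\<close> of length \<open>m\<close>.\<close>

lemma wandering_basis:
  obtains m and v :: "nat \<Rightarrow> (nat, 'd fock) ell2" where
    "\<And>\<alpha> \<beta> k l. k < m \<Longrightarrow> l < m \<Longrightarrow> form (ampliation (right_word \<alpha>) (v k)) (ampliation (right_word \<beta>) (v l))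
      = (if \<alpha> = \<beta> \<and> k = l then 1 else 0)"
    "\<And>l i. l < m \<Longrightarrow> n \<le> i \<Longrightarrow> ell2_coeff (v l) i = 0"
    "\<And>y. \<forall>i\<ge>n. ell2_coeff y i = 0 \<Longrightarrow>
      \<forall>\<alpha>. \<forall>l<m. form y (ampliation (right_word \<alpha>) (v l)) = 0 \<Longrightarrow> y = 0"
proof -
  obtain Y where Y: "block_op * Y = 1"
    using Lax_Milgram[OF e_pos, of block_op] form_coercive(2) unfolding form_def by blast
  define w where "w i = bop_apply Y (vacuum i)" for i
  have Tw: "bop_apply block_op (w i) = vacuum i" for i
    unfolding w_def using Y by (metis bop_apply_simps(2,7))
  have form_w: "form (w i) y = cinner (vacuum i) y" for i y
    unfolding form_def Tw ..
  have w_supp: "ell2_coeff (w i) j = 0" if "i < n" "n \<le> j" for i j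
  proof -
    have "ell2_coeff (bop_apply block_op (w i)) j = e *\<^sub>R ell2_coeff (w i) j"
      unfolding block_op_apply using that
      by (simp add: plus_ell2.rep_eq scaleR_ell2.rep_eq ell2_coeff_single zero_ell2.rep_eq ell2_coeff_sum)
    then show ?thesis using that e_pos by (simp add: Tw ell2_coeff_single)
  qed
  have pos: "0 < Re (cinner (bop_apply block_op x) x)" if "x \<noteq> 0" for x
  proof -
    have "0 < e * (norm x)\<^sup>2" using that e_pos by simp
    then show ?thesis using form_coercive(2)[of x] by (simp add: form_def)
  qed
  obtain m and v :: "nat \<Rightarrow> (nat, 'd fock) ell2" where
    orth: "\<And>k l. k < m \<Longrightarrow> l < m \<Longrightarrow> form (v k) (v l) = (if k = l then 1 else 0)"
    and v: "\<And>l. l < m \<Longrightarrow> v l \<in> complex_span (w ` {..<n})"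
    and w: "\<And>i. i < n \<Longrightarrow> w i \<in> complex_span (v ` {..<m})"
    unfolding form_def
    by (rule Gram_Schmidt[of block_op w n])
      (use form_coercive(1) pos that in \<open>auto simp: form_def\<close>)
  show ?thesis
  proof (rule that)
    have v_vac: "form x (ampliation (right_word \<beta>) y) = 0"
      if "x \<in> complex_span (w ` {..<n})" "\<beta> \<noteq> []" for x \<beta> y
      using that(1)
    proof induction
      case (base x)
      then show ?case using that(2) by (auto simp: form_w cinner_vacuum_right_word)
    qed (auto simp: form_linear, simp add: form_def)
    have less: "form (ampliation (right_word \<alpha>) (v k)) (ampliation (right_word \<beta>) y) = 0"
      if "k < m" "length \<alpha> < length \<beta>" for \<alpha> \<beta> k y
    proof -
      define \<beta>1 \<beta>2 where "\<beta>1 = take (length \<beta> - length \<alpha>) \<beta>" and "\<beta>2 = drop (length \<beta> - length \<alpha>) \<beta>"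
      have \<beta>: "\<beta> = \<beta>1 @ \<beta>2" "length \<alpha> = length \<beta>2" "\<beta>1 \<noteq> []"
        using that(2) by (auto simp: \<beta>1_def \<beta>2_def)
      show ?thesis
        unfolding \<beta>(1) right_word_append ampliation_linear(4) form_right_words[OF \<beta>(2)]
        using v_vac[OF v[OF that(1)] \<beta>(3)] by simp
    qed
    fix \<alpha> \<beta> k l assume kl: "k < m" "l < m"
    show "form (ampliation (right_word \<alpha>) (v k)) (ampliation (right_word \<beta>) (v l)) = (if \<alpha> = \<beta> \<and> k = l then 1 else 0)"
    proof (cases "length \<alpha>" "length \<beta>" rule: linorder_cases)
      case equal
      then show ?thesis by (simp add: form_right_words orth kl)
    next
      case greater
      then show ?thesis
        using less[OF kl(2) greater] form_hermitian[of "ampliation (right_word \<alpha>) (v k)"] by auto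
    qed (use less[OF kl(1)] in auto)
  next
    fix l i assume "l < m" "n \<le> i"
    from v[OF this(1)] show "ell2_coeff (v l) i = 0"
      by induction (use w_supp \<open>n \<le> i\<close> in \<open>auto simp: zero_ell2.rep_eq plus_ell2.rep_eq scaleC_ell2.rep_eq\<close>)
  next
    fix y
    assume supp: "\<forall>i\<ge>n. ell2_coeff y i = 0"
      and y: "\<forall>\<alpha>. \<forall>l<m. form y (ampliation (right_word \<alpha>) (v l)) = 0"
    have "form y (ampliation (right_word \<alpha>) x) = 0" if "x \<in> complex_span (v ` {..<m})" for \<alpha> x
      using that by induction (auto simp: y form_linear ampliation_linear)
    then have yw: "form (ampliation (right_word \<alpha>) (w i)) y = 0" if "i < n" for \<alpha> i
      using w[OF that] form_hermitian[of _ y] by (metis complex_cnj_zero)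
    have zero: "ell2_coeff (ell2_coeff y i) \<gamma> = 0" if "i < n" for i \<gamma>
      using that
    proof (induction "length \<gamma>" arbitrary: \<gamma> i rule: less_induct)
      case less
      let ?m = "length \<gamma>"
      have "y = (\<Sum>\<alpha> | length \<alpha> = ?m. ampliation (right_word \<alpha>) (ampliation ((right_word \<alpha>)\<^sup>\<dagger>) y))"
      proof (rule ell2_eqI)
        fix j
        show "ell2_coeff y j
            = ell2_coeff (\<Sum>\<alpha> | length \<alpha> = ?m. ampliation (right_word \<alpha>) (ampliation ((right_word \<alpha>)\<^sup>\<dagger>) y)) j"
        proof (cases "j < n")
          case True
          then show ?thesis
            using right_word_decomposition[of ?m "ell2_coeff y j"] less.hyps
            by (simp add: ell2_coeff_sum)
        qed (simp add: supp ell2_coeff_sum)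
      qed
      then have "form (ampliation (right_word \<gamma>) (w i)) y
          = (\<Sum>\<alpha> | length \<alpha> = ?m. form (ampliation (right_word \<gamma>) (w i))
              (ampliation (right_word \<alpha>) (ampliation ((right_word \<alpha>)\<^sup>\<dagger>) y)))"
        by (metis form_linear(8))
      also have "\<dots> = (\<Sum>\<alpha> | length \<alpha> = ?m. if \<alpha> = \<gamma> then form (w i) (ampliation ((right_word \<gamma>)\<^sup>\<dagger>) y) else 0)"
        by (rule sum.cong) (auto simp: form_right_words)
      also have "\<dots> = form (w i) (ampliation ((right_word \<gamma>)\<^sup>\<dagger>) y)" by simp
      also have "\<dots> = cnj (ell2_coeff (ell2_coeff y i) \<gamma>)"
        by (simp add: form_w cinner_ell2_single cinner_fock_basis' right_word_adjoint_coeff)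
      finally show ?case using yw[OF less.prems] by simp
    qed
    show "y = 0"
    proof (rule ell2_eqI)
      fix i
      have "ell2_coeff y i = 0"
        using zero[of i] supp by (cases "i < n") (auto intro!: ell2_eqI simp: zero_ell2.rep_eq)
      then show "ell2_coeff y i = ell2_coeff 0 i" by (simp add: zero_ell2.rep_eq)
    qed
  qed
qed

text \<open>This is the noncommutative Fejer-Riesz theorem: in operator terms \<open>P + e = A\<^sup>\<dagger> A\<close>, where \<open>A\<close> is the
  analytic matrix polynomial whose entry in row \<open>l\<close> and column \<open>j\<close> is the sum of the \<open>c\<^sub>j\<^sub>,\<^sub>\<rho>\<^sub>,\<^sub>l L\<^sup>\<rho>\<close>. The
  coefficients \<open>c\<close> are those of the expansion of the vacuum vectors in the system \<open>R\<^sup>\<rho> v\<^sub>l\<close>; it stops at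
  words of length \<open>N\<close> because \<open>P\<close> has degree \<open>N\<close>.\<close>

lemma Fejer_Riesz:
  obtains m and c :: "nat \<Rightarrow> 'd list \<Rightarrow> nat \<Rightarrow> complex" where
    "\<And>i j \<alpha> \<beta>. i < n \<Longrightarrow> j < n \<Longrightarrow>
      symbol_coeff (P i j) \<alpha> \<beta> + (if i = j \<and> \<alpha> = \<beta> then of_real e else 0)
      = (\<Sum>l<m. \<Sum>\<rho>\<in>words N. \<Sum>\<sigma>\<in>words N. if \<rho> @ rev \<alpha> = \<sigma> @ rev \<beta> then c j \<rho> l * cnj (c i \<sigma> l) else 0)"
proof -
  obtain m and v :: "nat \<Rightarrow> (nat, 'd fock) ell2" where
    orth: "\<And>\<alpha> \<beta> k l. k < m \<Longrightarrow> l < m \<Longrightarrow> form (ampliation (right_word \<alpha>) (v k)) (ampliation (right_word \<beta>) (v l))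
      = (if \<alpha> = \<beta> \<and> k = l then 1 else 0)"
    and supp: "\<And>l i. l < m \<Longrightarrow> n \<le> i \<Longrightarrow> ell2_coeff (v l) i = 0"
    and total: "\<And>y. \<forall>i\<ge>n. ell2_coeff y i = 0 \<Longrightarrow>
      \<forall>\<alpha>. \<forall>l<m. form y (ampliation (right_word \<alpha>) (v l)) = 0 \<Longrightarrow> y = 0"
    by (rule wandering_basis) (rule that)
  define c where "c j \<alpha> l = form (vacuum j) (ampliation (right_word \<alpha>) (v l))" for j \<alpha> l
  have vacuum: "vacuum j = (\<Sum>\<rho>\<in>words N. \<Sum>l<m. c j \<rho> l *\<^sub>C ampliation (right_word \<rho>) (v l))" (is "_ = ?s")
    if j: "j < n" for j
  proof -
    have "vacuum j - ?s = 0"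
    proof (rule total; intro allI impI)
      fix i assume "n \<le> i"
      then show "ell2_coeff (vacuum j - ?s) i = 0"
        using j supp
        by (auto simp: minus_ell2.rep_eq ell2_coeff_sum scaleC_ell2.rep_eq ell2_coeff_single intro!: sum.neutral)
    next
      fix \<alpha> k assume k: "k < m"
      have "form ?s (ampliation (right_word \<alpha>) (v k))
          = (\<Sum>\<rho>\<in>words N. \<Sum>l<m. if l = k then if \<rho> = \<alpha> then c j \<rho> k else 0 else 0)"
        unfolding form_linear
        by (intro sum.cong refl) (use k in \<open>auto simp: orth\<close>)
      also have "\<dots> = (if \<alpha> \<in> words N then c j \<alpha> k else 0)" using k by simp
      also have "\<dots> = c j \<alpha> k"
        using form_vacuum_right_word[OF j, of \<alpha> "v k"] by (auto simp: c_def words_def)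
      finally show "form (vacuum j - ?s) (ampliation (right_word \<alpha>) (v k)) = 0"
        by (simp add: form_linear c_def)
    qed
    then show ?thesis by simp
  qed
  show ?thesis
  proof (rule that)
    fix i j \<alpha> \<beta> assume ij: "i < n" "j < n"
    have basis: "ell2_single j (fock_basis (rev \<alpha>))
        = (\<Sum>\<rho>\<in>words N. \<Sum>l<m. c j \<rho> l *\<^sub>C ampliation (right_word (\<rho> @ rev \<alpha>)) (v l))"
      if "j < n" for j \<alpha>
    proof -
      have "ell2_single j (fock_basis (rev \<alpha>)) = ampliation (right_word (rev \<alpha>)) (vacuum j)"
        by (simp add: ampliation_single right_word_fock_basis)
      then show ?thesis
        unfolding vacuum[OF that] by (simp add: ampliation_sum ampliation_linear right_word_append)
    qed
    have delta: "(\<Sum>j'<n. f j' (ell2_coeff (ell2_single j x) j')) = f j x"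
      if "j < n" "\<And>j'. f j' 0 = 0" for j x and f :: "nat \<Rightarrow> 'd fock \<Rightarrow> complex"
    proof -
      have "(\<Sum>j'<n. f j' (ell2_coeff (ell2_single j x) j')) = (\<Sum>j'<n. if j' = j then f j x else 0)"
        by (rule sum.cong) (auto simp: ell2_coeff_single that)
      then show ?thesis using that by simp
    qed
    have "form (ell2_single j (fock_basis (rev \<alpha>))) (ell2_single i (fock_basis (rev \<beta>)))
        = symbol_coeff (P i j) \<alpha> \<beta> + (if i = j \<and> \<alpha> = \<beta> then of_real e else 0)"
    proof -
      have "(\<Sum>i'<n. \<Sum>j'<n. cinner (bop_apply (P i' j') (ell2_coeff (ell2_single j (fock_basis (rev \<alpha>))) j'))
            (ell2_coeff (ell2_single i (fock_basis (rev \<beta>))) i'))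
          = (\<Sum>i'<n. cinner (bop_apply (P i' j) (fock_basis (rev \<alpha>))) (ell2_coeff (ell2_single i (fock_basis (rev \<beta>))) i'))"
        by (intro sum.cong refl delta[where f="\<lambda>j' x. cinner (bop_apply (P _ j') x) _"]) (use ij in auto)
      also have "\<dots> = symbol_coeff (P i j) \<alpha> \<beta>"
        unfolding symbol_coeff_def
        by (rule delta[where f="\<lambda>i' y. cinner (bop_apply (P i' j) (fock_basis (rev \<alpha>))) y"]) (use ij in auto)
      finally show ?thesis
        by (simp add: form_eq cinner_ell2_single ell2_coeff_single cinner_fock_basis fock_basis.rep_eq)
    qed
    moreover have "form (ell2_single j (fock_basis (rev \<alpha>))) (ell2_single i (fock_basis (rev \<beta>)))
        = (\<Sum>l<m. \<Sum>\<rho>\<in>words N. \<Sum>\<sigma>\<in>words N. if \<rho> @ rev \<alpha> = \<sigma> @ rev \<beta> then c j \<rho> l * cnj (c i \<sigma> l) else 0)"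
    proof -
      have "form (ell2_single j (fock_basis (rev \<alpha>))) (ell2_single i (fock_basis (rev \<beta>)))
          = (\<Sum>\<rho>\<in>words N. \<Sum>l<m. \<Sum>\<sigma>\<in>words N. \<Sum>k<m.
              c j \<rho> l * cnj (c i \<sigma> k) * (if \<rho> @ rev \<alpha> = \<sigma> @ rev \<beta> \<and> l = k then 1 else 0))"
        unfolding basis[OF ij(1)] basis[OF ij(2)] form_linear(2,7) unfolding form_linear(5,8)
        by (intro sum.cong refl) (simp add: orth sum_distrib_left mult.assoc)
      also have "\<dots> = (\<Sum>\<rho>\<in>words N. \<Sum>l<m. \<Sum>\<sigma>\<in>words N. \<Sum>k<m.
              if k = l then if \<rho> @ rev \<alpha> = \<sigma> @ rev \<beta> then c j \<rho> l * cnj (c i \<sigma> l) else 0 else 0)"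
        by (intro sum.cong refl) auto
      also have "\<dots> = (\<Sum>\<rho>\<in>words N. \<Sum>l<m. \<Sum>\<sigma>\<in>words N.
              if \<rho> @ rev \<alpha> = \<sigma> @ rev \<beta> then c j \<rho> l * cnj (c i \<sigma> l) else 0)"
        by (intro sum.cong refl) simp
      also have "\<dots> = (\<Sum>l<m. \<Sum>\<rho>\<in>words N. \<Sum>\<sigma>\<in>words N.
              if \<rho> @ rev \<alpha> = \<sigma> @ rev \<beta> then c j \<rho> l * cnj (c i \<sigma> l) else 0)"
        by (rule sum.swap)
      finally show ?thesis .
    qed
    ultimately show "symbol_coeff (P i j) \<alpha> \<beta> + (if i = j \<and> \<alpha> = \<beta> then of_real e else 0)
      = (\<Sum>l<m. \<Sum>\<rho>\<in>words N. \<Sum>\<sigma>\<in>words N. if \<rho> @ rev \<alpha> = \<sigma> @ rev \<beta> then c j \<rho> l * cnj (c i \<sigma> l) else 0)"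
      by simp
  qed
qed

end


section \<open>From Herglotz functions to completely positive maps\<close>

definition symbol_map ::
    "('d list \<Rightarrow> 'd list \<Rightarrow> 'h::complex_inner bop) \<Rightarrow> nat \<Rightarrow> 'd::finite fock bop \<Rightarrow> 'h bop"
  where "symbol_map K N a = (\<Sum>(\<alpha>, \<beta>)\<in>star_pairs N. cscale (symbol_coeff a \<alpha> \<beta>) (K \<alpha> \<beta>))"

lemma sum_nonneg_Reals: "(\<And>i. i \<in> I \<Longrightarrow> f i \<in> \<real>\<^sub>\<ge>\<^sub>0) \<Longrightarrow> (\<Sum>i\<in>I. f i) \<in> \<real>\<^sub>\<ge>\<^sub>0"
  by (induction I rule: infinite_finite_induct) (auto intro: nonneg_Reals_add_I)

lemma symbol_map_mono:
  assumes a: "toeplitz_poly N a" and "N \<le> M"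
  shows "symbol_map K M a = symbol_map K N a"
  unfolding symbol_map_def using star_pairs_mono[OF \<open>N \<le> M\<close>]
  by (intro sum.mono_neutral_right) (auto simp: symbol_coeff_outside[OF a])

lemma symbol_map_linear:
  "symbol_map K N (a + b) = symbol_map K N a + symbol_map K N b"
  "symbol_map K N (cscale c a) = cscale c (symbol_map K N a)"
  by (simp_all add: symbol_map_def symbol_coeff_linear cscale_add_left sum.distrib case_prod_unfold cscale_sum_right)

lemma sum_rotate: "(\<Sum>i\<in>I. \<Sum>j\<in>J. \<Sum>l\<in>L. f i j l) = (\<Sum>l\<in>L. \<Sum>i\<in>I. \<Sum>j\<in>J. f i j l)"
  by (rule trans[OF sum.cong[OF refl sum.swap] sum.swap])

text \<open>By the factorisation, the quadratic form of \<open>\<phi>(P)\<close> is a sum of values of the quadratic form of the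
  kernel; the star-shaped sum reassembles the kernel from its first row and column.\<close>

lemma symbol_map_positive:
  fixes K :: "'d::finite list \<Rightarrow> 'd list \<Rightarrow> 'h::complex_inner bop"
  assumes K: "toeplitz_kernel K" "positive_kernel K"
    and P: "positive_toeplitz_matrix n N P e"
  shows "(\<Sum>i<n. \<Sum>j<n. cinner (bop_apply (symbol_map K N (P i j)) (x j)) (x i))
    + of_real e * (\<Sum>i<n. cinner (bop_apply (K [] []) (x i)) (x i)) \<in> \<real>\<^sub>\<ge>\<^sub>0"
proof -
  interpret positive_toeplitz_matrix n N P e by (rule P)
  obtain m and c :: "nat \<Rightarrow> 'd list \<Rightarrow> nat \<Rightarrow> complex" where c: "\<And>i j \<alpha> \<beta>. i < n \<Longrightarrow> j < n \<Longrightarrow>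
      symbol_coeff (P i j) \<alpha> \<beta> + (if i = j \<and> \<alpha> = \<beta> then of_real e else 0)
      = (\<Sum>l<m. \<Sum>\<rho>\<in>words N. \<Sum>\<sigma>\<in>words N. if \<rho> @ rev \<alpha> = \<sigma> @ rev \<beta> then c j \<rho> l * cnj (c i \<sigma> l) else 0)"
    by (rule Fejer_Riesz) (rule that)
  define \<kappa> where "\<kappa> i j \<alpha> \<beta> = cinner (bop_apply (K \<alpha> \<beta>) (x j)) (x i)" for i j \<alpha> \<beta>
  define h where "h l \<rho> = (\<Sum>j<n. c j \<rho> l *\<^sub>C x j)" for l \<rho>
  have entry: "cinner (bop_apply (symbol_map K N (P i j)) (x j)) (x i) + (if i = j then of_real e * \<kappa> i i [] [] else 0)
      = (\<Sum>l<m. \<Sum>\<rho>\<in>words N. \<Sum>\<sigma>\<in>words N. c j \<rho> l * cnj (c i \<sigma> l) * \<kappa> i j (rev \<sigma>) (rev \<rho>))"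
    if ij: "i < n" "j < n" for i j
  proof -
    have diag: "(\<Sum>(\<alpha>, \<beta>)\<in>star_pairs N. (if i = j \<and> \<alpha> = \<beta> then of_real e else 0) * \<kappa> i j \<alpha> \<beta>)
        = (if i = j then of_real e * \<kappa> i i [] [] else 0)"
    proof -
      have "(\<Sum>(\<alpha>, \<beta>)\<in>star_pairs N. (if i = j \<and> \<alpha> = \<beta> then of_real e else 0) * \<kappa> i j \<alpha> \<beta>)
          = (\<Sum>p\<in>(star_pairs N :: ('d list \<times> 'd list) set). if p = ([], []) then if i = j then of_real e * \<kappa> i i [] [] else 0 else 0)"
        by (rule sum.cong) (auto simp: star_pairs_def split: if_splits)
      moreover have "([], []) \<in> (star_pairs N :: ('d list \<times> 'd list) set)" by (simp add: star_pairs_def)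
      ultimately show ?thesis by simp
    qed
    define \<mu> where "\<mu> \<rho> \<sigma> = (\<lambda>(\<alpha>, \<beta>). if \<rho> @ rev \<alpha> = \<sigma> @ rev \<beta> then \<kappa> i j \<alpha> \<beta> else 0)" for \<rho> \<sigma>
    have regroup: "(\<Sum>p\<in>star_pairs N. \<mu> \<rho> \<sigma> p) = \<kappa> i j (rev \<sigma>) (rev \<rho>)"
      if "\<rho> \<in> words N" "\<sigma> \<in> words N" for \<rho> \<sigma>
    proof -
      have eq: "\<alpha> @ rev \<rho> = \<beta> @ rev \<sigma> \<longleftrightarrow> \<rho> @ rev \<alpha> = \<sigma> @ rev \<beta>" for \<alpha> \<beta>
        by (metis rev_append rev_rev_ident)
      have "K (rev \<sigma>) (rev \<rho>) = (\<Sum>(\<alpha>, \<beta>)\<in>star_pairs N. if \<alpha> @ rev \<rho> = \<beta> @ rev \<sigma> then K \<alpha> \<beta> else 0)"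
        by (rule toeplitz_kernel_star_expansion[OF K(1)]) (use that in \<open>auto simp: words_def\<close>)
      then have "\<kappa> i j (rev \<sigma>) (rev \<rho>)
          = (\<Sum>p\<in>star_pairs N. cinner (bop_apply (case p of (\<alpha>, \<beta>) \<Rightarrow> if \<alpha> @ rev \<rho> = \<beta> @ rev \<sigma> then K \<alpha> \<beta> else 0) (x j)) (x i))"
        by (simp add: \<kappa>_def bop_apply_sum_op cinner_sum_left)
      also have "\<dots> = (\<Sum>p\<in>star_pairs N. \<mu> \<rho> \<sigma> p)"
        by (rule sum.cong) (auto simp: \<kappa>_def \<mu>_def eq)
      finally show ?thesis ..
    qed
    have "cinner (bop_apply (symbol_map K N (P i j)) (x j)) (x i)
        = (\<Sum>(\<alpha>, \<beta>)\<in>star_pairs N. symbol_coeff (P i j) \<alpha> \<beta> * \<kappa> i j \<alpha> \<beta>)"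
      by (simp add: symbol_map_def \<kappa>_def bop_apply_sum_op cinner_sum_left case_prod_unfold)
    then have "cinner (bop_apply (symbol_map K N (P i j)) (x j)) (x i) + (if i = j then of_real e * \<kappa> i i [] [] else 0)
        = (\<Sum>(\<alpha>, \<beta>)\<in>star_pairs N. (symbol_coeff (P i j) \<alpha> \<beta> + (if i = j \<and> \<alpha> = \<beta> then of_real e else 0)) * \<kappa> i j \<alpha> \<beta>)"
      unfolding diag[symmetric] by (simp add: distrib_right sum.distrib case_prod_unfold)
    also have "\<dots> = (\<Sum>p\<in>star_pairs N. \<Sum>l<m. \<Sum>\<rho>\<in>words N. \<Sum>\<sigma>\<in>words N. c j \<rho> l * cnj (c i \<sigma> l) * \<mu> \<rho> \<sigma> p)"
      unfolding c[OF ij] sum_distrib_right \<mu>_def by (intro sum.cong refl) (auto intro!: sum.cong)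
    also have "\<dots> = (\<Sum>l<m. \<Sum>p\<in>star_pairs N. \<Sum>\<rho>\<in>words N. \<Sum>\<sigma>\<in>words N. c j \<rho> l * cnj (c i \<sigma> l) * \<mu> \<rho> \<sigma> p)"
      by (rule sum.swap)
    also have "\<dots> = (\<Sum>l<m. \<Sum>\<rho>\<in>words N. \<Sum>\<sigma>\<in>words N. \<Sum>p\<in>star_pairs N. c j \<rho> l * cnj (c i \<sigma> l) * \<mu> \<rho> \<sigma> p)"
      by (intro sum.cong[OF refl] sum_rotate[symmetric])
    also have "\<dots> = (\<Sum>l<m. \<Sum>\<rho>\<in>words N. \<Sum>\<sigma>\<in>words N. c j \<rho> l * cnj (c i \<sigma> l) * \<kappa> i j (rev \<sigma>) (rev \<rho>))"
      by (intro sum.cong refl) (simp add: regroup[symmetric] sum_distrib_left \<mu>_def)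
    finally show ?thesis .
  qed
  have "(\<Sum>i<n. \<Sum>j<n. cinner (bop_apply (symbol_map K N (P i j)) (x j)) (x i))
      + of_real e * (\<Sum>i<n. cinner (bop_apply (K [] []) (x i)) (x i))
    = (\<Sum>i<n. (\<Sum>j<n. cinner (bop_apply (symbol_map K N (P i j)) (x j)) (x i))
        + (\<Sum>j<n. if i = j then of_real e * \<kappa> i i [] [] else 0))"
    by (simp add: sum.distrib sum_distrib_left \<kappa>_def)
  also have "\<dots> = (\<Sum>i<n. \<Sum>j<n. \<Sum>l<m. \<Sum>\<rho>\<in>words N. \<Sum>\<sigma>\<in>words N. c j \<rho> l * cnj (c i \<sigma> l) * \<kappa> i j (rev \<sigma>) (rev \<rho>))"
    unfolding sum.distrib[symmetric] by (intro sum.cong refl entry) auto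
  also have "\<dots> = (\<Sum>l<m. \<Sum>\<rho>\<in>words N. \<Sum>\<sigma>\<in>words N. \<Sum>i<n. \<Sum>j<n. c j \<rho> l * cnj (c i \<sigma> l) * \<kappa> i j (rev \<sigma>) (rev \<rho>))"
    by (rule trans[OF sum_rotate sum.cong[OF refl trans[OF sum_rotate sum.cong[OF refl sum_rotate]]]])
  also have "\<dots> = (\<Sum>l<m. \<Sum>\<rho>\<in>words N. \<Sum>\<sigma>\<in>words N. cinner (bop_apply (K (rev \<sigma>) (rev \<rho>)) (h l \<rho>)) (h l \<sigma>))"
    unfolding h_def \<kappa>_def
    by (simp add: bop_apply_sum cinner_sum_left cinner_sum_right sum_distrib_left mult_ac)
  also have "\<dots> = (\<Sum>l<m. \<Sum>\<alpha>\<in>words N. \<Sum>\<beta>\<in>words N. cinner (bop_apply (K \<alpha> \<beta>) (h l (rev \<beta>))) (h l (rev \<alpha>)))"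
  proof (rule sum.cong[OF refl])
    fix l
    have rev_words: "(\<Sum>\<alpha>\<in>words N. f (rev \<alpha>)) = (\<Sum>\<alpha>\<in>words N. f \<alpha>)" for f :: "'d list \<Rightarrow> complex"
      by (rule sum.reindex_bij_witness[where i=rev and j=rev]) (auto simp: words_def)
    have "(\<Sum>\<rho>\<in>words N. \<Sum>\<sigma>\<in>words N. cinner (bop_apply (K (rev \<sigma>) (rev \<rho>)) (h l \<rho>)) (h l \<sigma>))
        = (\<Sum>\<sigma>\<in>words N. \<Sum>\<rho>\<in>words N. cinner (bop_apply (K (rev \<sigma>) (rev \<rho>)) (h l (rev (rev \<rho>)))) (h l (rev (rev \<sigma>))))"
      by (subst sum.swap) simp
    also have "\<dots> = (\<Sum>\<alpha>\<in>words N. \<Sum>\<rho>\<in>words N. cinner (bop_apply (K \<alpha> (rev \<rho>)) (h l (rev (rev \<rho>)))) (h l (rev \<alpha>)))"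
      by (rule rev_words[of "\<lambda>\<alpha>. \<Sum>\<rho>\<in>words N. cinner (bop_apply (K \<alpha> (rev \<rho>)) (h l (rev (rev \<rho>)))) (h l (rev \<alpha>))"])
    also have "\<dots> = (\<Sum>\<alpha>\<in>words N. \<Sum>\<beta>\<in>words N. cinner (bop_apply (K \<alpha> \<beta>) (h l (rev \<beta>))) (h l (rev \<alpha>)))"
      by (intro sum.cong[OF refl] rev_words[of "\<lambda>\<beta>. cinner (bop_apply (K _ \<beta>) (h l (rev \<beta>))) (h l (rev _))"])
    finally show "(\<Sum>\<rho>\<in>words N. \<Sum>\<sigma>\<in>words N. cinner (bop_apply (K (rev \<sigma>) (rev \<rho>)) (h l \<rho>)) (h l \<sigma>))
        = (\<Sum>\<alpha>\<in>words N. \<Sum>\<beta>\<in>words N. cinner (bop_apply (K \<alpha> \<beta>) (h l (rev \<beta>))) (h l (rev \<alpha>)))" .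
  qed
  also have "\<dots> \<in> \<real>\<^sub>\<ge>\<^sub>0"
    using K(2) finite_words by (auto intro!: sum_nonneg_Reals[of "{..<m}"] simp: positive_kernel_def)
  finally show ?thesis .
qed

lemma nonneg_Reals_limit:
  fixes k s :: complex
  assumes "k \<in> \<real>\<^sub>\<ge>\<^sub>0" "\<And>e. 0 < e \<Longrightarrow> s + of_real e * k \<in> \<real>\<^sub>\<ge>\<^sub>0"
  shows "s \<in> \<real>\<^sub>\<ge>\<^sub>0"
proof -
  have k: "Im k = 0" "0 \<le> Re k" using assms(1) by (auto simp: complex_nonneg_Reals_iff)
  have s: "0 \<le> Re s + e * Re k" "Im s = 0" if "0 < e" for e
    using assms(2)[OF that] k by (auto simp: complex_nonneg_Reals_iff)
  have "0 \<le> Re s"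
  proof (rule field_le_epsilon)
    fix d :: real assume d: "0 < d"
    have "d / (Re k + 1) * Re k \<le> d" using k(2) d by (simp add: field_simps)
    then show "0 \<le> Re s + d" using s(1)[of "d / (Re k + 1)"] k(2) d by auto
  qed
  then show ?thesis using s(2)[of 1] by (simp add: complex_nonneg_Reals_iff)
qed

text \<open>The degree is not part of a Toeplitz polynomial; the least one is used, but every admissible degree
  gives the same value.\<close>

definition poly_map ::
    "('d list \<Rightarrow> 'd list \<Rightarrow> 'h::complex_inner bop) \<Rightarrow> 'd::finite fock bop \<Rightarrow> 'h bop"
  where "poly_map K a = symbol_map K (LEAST N. toeplitz_poly N a) a"

lemma poly_map_eq: "toeplitz_poly N a \<Longrightarrow> poly_map K a = symbol_map K N a"
  unfolding poly_map_def by (rule symbol_map_mono[symmetric]) (auto intro: LeastI Least_le)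

lemma cp_on_poly_map:
  fixes K :: "'d::finite list \<Rightarrow> 'd list \<Rightarrow> 'h::complex_inner bop"
  assumes K: "toeplitz_kernel K" "positive_kernel K"
  shows "cp_on toeplitz_polys (poly_map K)"
  unfolding cp_on_def
proof (intro conjI ballI allI impI)
  fix a b :: "'d fock bop" assume "a \<in> toeplitz_polys" "b \<in> toeplitz_polys"
  then obtain N M where "toeplitz_poly N a" "toeplitz_poly M b" unfolding toeplitz_polys_def by blast
  then have "toeplitz_poly (max N M) a" "toeplitz_poly (max N M) b" by (auto intro: toeplitz_poly_mono)
  then show "poly_map K (a + b) = poly_map K a + poly_map K b"
    by (simp add: poly_map_eq toeplitz_poly_add symbol_map_linear poly_map_eq[OF toeplitz_poly_add])
next
  fix c and a :: "'d fock bop" assume "a \<in> toeplitz_polys"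
  then obtain N where "toeplitz_poly N a" unfolding toeplitz_polys_def by blast
  then show "poly_map K (cscale c a) = cscale c (poly_map K a)"
    by (simp add: poly_map_eq symbol_map_linear poly_map_eq[OF toeplitz_poly_cscale])
next
  fix n and P :: "nat \<Rightarrow> nat \<Rightarrow> 'd fock bop"
  assume "\<forall>i<n. \<forall>j<n. P i j \<in> toeplitz_polys" and pos: "positive_operator_matrix n P"
  then obtain f where f: "\<And>i j. i < n \<Longrightarrow> j < n \<Longrightarrow> toeplitz_poly (f i j) (P i j)"
    unfolding toeplitz_polys_def mem_Collect_eq by metis
  define N where "N = (\<Sum>i<n. \<Sum>j<n. f i j)"
  have "f i j \<le> N" if "i < n" "j < n" for i j
  proof -
    have "f i j \<le> (\<Sum>j<n. f i j)" using that by (intro member_le_sum) auto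
    also have "\<dots> \<le> N" unfolding N_def using that by (intro member_le_sum) auto
    finally show ?thesis .
  qed
  then have N: "toeplitz_poly N (P i j)" if "i < n" "j < n" for i j
    using toeplitz_poly_mono[OF f[OF that]] that by blast
  show "positive_operator_matrix n (\<lambda>i j. poly_map K (P i j))"
    unfolding positive_operator_matrix_def
  proof
    fix x :: "nat \<Rightarrow> 'h"
    have "cinner (bop_apply (K [] []) u) u \<in> \<real>\<^sub>\<ge>\<^sub>0" for u
      using K(2)[unfolded positive_kernel_def, rule_format, of "{[]}" "\<lambda>_. u"] by simp
    then have k: "(\<Sum>i<n. cinner (bop_apply (K [] []) (x i)) (x i)) \<in> \<real>\<^sub>\<ge>\<^sub>0"
      by (intro sum_nonneg_Reals)
    have "(\<Sum>i<n. \<Sum>j<n. cinner (bop_apply (symbol_map K N (P i j)) (x j)) (x i)) \<in> \<real>\<^sub>\<ge>\<^sub>0"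
      by (rule nonneg_Reals_limit[OF k], rule symbol_map_positive[OF K])
        (use N pos in \<open>auto simp: positive_toeplitz_matrix_def\<close>)
    then show "(\<Sum>i<n. \<Sum>j<n. cinner (bop_apply (poly_map K (P i j)) (x j)) (x i)) \<in> \<real>\<^sub>\<ge>\<^sub>0"
      by (simp add: poly_map_eq[OF N])
  qed
qed

section \<open>Extension of completely positive maps to the closure\<close>

lemma hermitian_part_form:
  fixes A :: "nat \<Rightarrow> nat \<Rightarrow> 'a::chilbert_space bop"
  shows "(\<Sum>i<n. \<Sum>j<n. cinner (bop_apply (cscale (u / 2) (A i j) + cscale (cnj u / 2) ((A j i)\<^sup>\<dagger>)
        + (if i = j then r *\<^sub>R B else 0)) (x j)) (x i))
    = of_real (Re (u * (\<Sum>i<n. \<Sum>j<n. cinner (bop_apply (A i j) (x j)) (x i))))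
      + of_real r * (\<Sum>i<n. cinner (bop_apply B (x i)) (x i))"
proof -
  define s where "s = (\<Sum>i<n. \<Sum>j<n. cinner (bop_apply (A i j) (x j)) (x i))"
  have adj: "(\<Sum>i<n. \<Sum>j<n. cinner (bop_apply ((A j i)\<^sup>\<dagger>) (x j)) (x i)) = cnj s"
  proof -
    have "(\<Sum>i<n. \<Sum>j<n. cinner (bop_apply ((A j i)\<^sup>\<dagger>) (x j)) (x i))
        = (\<Sum>i<n. \<Sum>j<n. cnj (cinner (bop_apply (A j i) (x i)) (x j)))"
      unfolding cinner_adjoint' by (intro sum.cong refl) (rule cinner_commute)
    also have "\<dots> = cnj s" unfolding s_def by (subst sum.swap) simp
    finally show ?thesis .
  qed
  have diag: "(\<Sum>i<n. \<Sum>j<n. cinner (bop_apply (if i = j then r *\<^sub>R B else 0) (x j)) (x i))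
      = of_real r * (\<Sum>i<n. cinner (bop_apply B (x i)) (x i))"
  proof -
    have "(\<Sum>i<n. \<Sum>j<n. cinner (bop_apply (if i = j then r *\<^sub>R B else 0) (x j)) (x i))
        = (\<Sum>i<n. \<Sum>j<n. if i = j then of_real r * cinner (bop_apply B (x i)) (x i) else 0)"
      by (intro sum.cong refl) auto
    then show ?thesis by (simp add: sum_distrib_left)
  qed
  have half: "(u / 2) * s + (cnj u / 2) * cnj s = of_real (Re (u * s))"
    using complex_add_cnj[of "u * s"] by (simp add: field_simps)
  have "(\<Sum>i<n. \<Sum>j<n. cinner (bop_apply (cscale (u / 2) (A i j) + cscale (cnj u / 2) ((A j i)\<^sup>\<dagger>)
        + (if i = j then r *\<^sub>R B else 0)) (x j)) (x i))
      = (u / 2) * s + (cnj u / 2) * (\<Sum>i<n. \<Sum>j<n. cinner (bop_apply ((A j i)\<^sup>\<dagger>) (x j)) (x i))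
        + (\<Sum>i<n. \<Sum>j<n. cinner (bop_apply (if i = j then r *\<^sub>R B else 0) (x j)) (x i))"
    unfolding s_def by (simp add: cinner_add_left sum.distrib sum_distrib_left)
  then show ?thesis unfolding adj diag half unfolding s_def .
qed

lemma form_perturbation:
  fixes Q T :: "nat \<Rightarrow> nat \<Rightarrow> 'a::complex_inner bop"
  assumes close: "\<And>i j. i < n \<Longrightarrow> j < n \<Longrightarrow> norm (Q i j - T i j) \<le> d"
  shows "cmod ((\<Sum>i<n. \<Sum>j<n. cinner (bop_apply (Q i j) (y j)) (y i))
      - (\<Sum>i<n. \<Sum>j<n. cinner (bop_apply (T i j) (y j)) (y i))) \<le> real n * d * (\<Sum>i<n. (norm (y i))\<^sup>2)"
proof -
  have entry: "cmod (cinner (bop_apply (Q i j - T i j) (y j)) (y i)) \<le> d * (((norm (y j))\<^sup>2 + (norm (y i))\<^sup>2) / 2)"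
    if "i < n" "j < n" for i j
  proof -
    have d: "0 \<le> d" using close[OF that] norm_ge_zero order_trans by blast
    have "cmod (cinner (bop_apply (Q i j - T i j) (y j)) (y i)) \<le> norm (bop_apply (Q i j - T i j) (y j)) * norm (y i)"
      by (rule cinner_Cauchy_Schwarz)
    also have "\<dots> \<le> (d * norm (y j)) * norm (y i)"
      using norm_bop_apply_le[of "Q i j - T i j" "y j"] mult_right_mono[OF close[OF that], of "norm (y j)"]
      by (intro mult_right_mono) auto
    also have "\<dots> \<le> d * (((norm (y j))\<^sup>2 + (norm (y i))\<^sup>2) / 2)"
      using d sum_squares_bound[of "norm (y j)" "norm (y i)"]
      unfolding mult.assoc by (intro mult_left_mono) auto
    finally show ?thesis .
  qed
  have "cmod ((\<Sum>i<n. \<Sum>j<n. cinner (bop_apply (Q i j) (y j)) (y i))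
      - (\<Sum>i<n. \<Sum>j<n. cinner (bop_apply (T i j) (y j)) (y i)))
    = cmod (\<Sum>i<n. \<Sum>j<n. cinner (bop_apply (Q i j - T i j) (y j)) (y i))"
    by (simp add: cinner_diff_left sum_subtractf)
  also have "\<dots> \<le> (\<Sum>i<n. \<Sum>j<n. d * (((norm (y j))\<^sup>2 + (norm (y i))\<^sup>2) / 2))"
    by (intro sum_norm_le entry) auto
  also have "\<dots> = real n * d * (\<Sum>i<n. (norm (y i))\<^sup>2)"
    by (simp add: sum_distrib_left[symmetric] sum_divide_distrib[symmetric] sum.distrib algebra_simps)
  finally show ?thesis .
qed

text \<open>Entries of a positive matrix over the closure are approximated by entries in the system; the
  approximating matrix need not be hermitian, but the hermitian part of its multiple by \<open>u\<close> becomes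
  positive after adding a small multiple of the identity.\<close>

lemma cp_on_approximate_positive:
  fixes f :: "'a::chilbert_space bop \<Rightarrow> 'h::chilbert_space bop"
  assumes f: "cp_on X f" and X: "operator_system X"
    and Q: "\<And>i j. Q i j \<in> X" and T: "positive_operator_matrix n T"
    and close: "\<And>i j. i < n \<Longrightarrow> j < n \<Longrightarrow> norm (Q i j - T i j) \<le> d"
    and u: "cmod u = 1" "0 \<le> Re u"
  shows "0 \<le> Re (u * (\<Sum>i<n. \<Sum>j<n. cinner (bop_apply (f (Q i j)) (x j)) (x i)))
    + real n * d * Re (\<Sum>i<n. cinner (bop_apply (f 1) (x i)) (x i))"
proof -
  define E where "E i j = cscale (u / 2) (Q i j) + cscale (cnj u / 2) ((Q j i)\<^sup>\<dagger>)
    + (if i = j then (real n * d) *\<^sub>R 1 else 0)" for i j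
  note XD = operator_systemD[OF X]
  have scaled: "r *\<^sub>R 1 \<in> X" "f (r *\<^sub>R 1) = r *\<^sub>R f 1" for r
    using XD(1,3) cp_on_cscale[OF f XD(1)] by (metis cscale_of_real)+
  have EX: "E i j \<in> X" for i j
    unfolding E_def using Q scaled(1) operator_system_0[OF X] by (auto intro!: XD(2-4))
  have "positive_operator_matrix n E"
    unfolding positive_operator_matrix_def
  proof
    fix y :: "nat \<Rightarrow> 'a"
    define q where "q = (\<Sum>i<n. \<Sum>j<n. cinner (bop_apply (Q i j) (y j)) (y i))"
    define t where "t = (\<Sum>i<n. \<Sum>j<n. cinner (bop_apply (T i j) (y j)) (y i))"
    define Y where "Y = (\<Sum>i<n. (norm (y i))\<^sup>2)"
    have t: "Im t = 0" "0 \<le> Re t"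
      using T unfolding positive_operator_matrix_def t_def by (auto simp: complex_nonneg_Reals_iff)
    have "cmod (u * (q - t)) \<le> real n * d * Y"
      using form_perturbation[OF close] u(1) unfolding q_def t_def Y_def by (simp add: norm_mult)
    then have "- (real n * d * Y) \<le> Re (u * (q - t))" using abs_Re_le_cmod[of "u * (q - t)"] by linarith
    moreover have "0 \<le> Re (u * t)" using t u(2) by simp
    ultimately have nn: "0 \<le> Re (u * q) + real n * d * Y" by (simp add: algebra_simps)
    have "(\<Sum>i<n. \<Sum>j<n. cinner (bop_apply (E i j) (y j)) (y i)) = of_real (Re (u * q) + real n * d * Y)"
      unfolding E_def hermitian_part_form q_def[symmetric] Y_def by (simp add: cinner_same)
    then show "(\<Sum>i<n. \<Sum>j<n. cinner (bop_apply (E i j) (y j)) (y i)) \<in> \<real>\<^sub>\<ge>\<^sub>0"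
      using nn by (simp only: of_real_nonneg)
  qed
  then have "positive_operator_matrix n (\<lambda>i j. f (E i j))" by (intro cp_on_positive[OF f] EX)
  moreover have "f (E i j) = cscale (u / 2) (f (Q i j)) + cscale (cnj u / 2) ((f (Q j i))\<^sup>\<dagger>)
    + (if i = j then (real n * d) *\<^sub>R f 1 else 0)" for i j
  proof -
    have add: "f (a + b) = f a + f b" if "a \<in> X" "b \<in> X" for a b
      using f that unfolding cp_on_def by blast
    have "(if i = j then (real n * d) *\<^sub>R 1 else 0) \<in> X" using scaled(1) operator_system_0[OF X] by auto
    then have "f (E i j) = f (cscale (u / 2) (Q i j)) + f (cscale (cnj u / 2) ((Q j i)\<^sup>\<dagger>))
        + f (if i = j then (real n * d) *\<^sub>R 1 else 0)"
      unfolding E_def using Q by (simp only: add XD(2-4))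
    then show ?thesis
      using cp_on_cscale[OF f] Q XD(4) cp_on_adjoint[OF f X Q] scaled(2) cp_on_0[OF f X] by auto
  qed
  ultimately have "(\<Sum>i<n. \<Sum>j<n. cinner (bop_apply (cscale (u / 2) (f (Q i j)) + cscale (cnj u / 2) ((f (Q j i))\<^sup>\<dagger>)
        + (if i = j then (real n * d) *\<^sub>R f 1 else 0)) (x j)) (x i)) \<in> \<real>\<^sub>\<ge>\<^sub>0"
    unfolding positive_operator_matrix_def by simp
  then show ?thesis
    unfolding hermitian_part_form by (simp add: complex_nonneg_Reals_iff)
qed

text \<open>A completely positive map is Lipschitz continuous, so it extends continuously; positivity passes
  to the limit in the approximations of the preceding lemma.\<close>

lemma cp_on_extend_closure:
  fixes f :: "'a::chilbert_space bop \<Rightarrow> 'h::chilbert_space bop"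
  assumes f: "cp_on X f" and X: "operator_system X"
  obtains g where "cp_on (closure X) g" "\<And>a. a \<in> X \<Longrightarrow> g a = f a"
proof -
  have "uniformly_continuous_on X f"
    unfolding uniformly_continuous_on_def
  proof (intro allI impI)
    fix e :: real assume e: "0 < e"
    define C where "C = norm (f 1) + 1"
    have C: "0 < C" "norm (f 1) \<le> C" unfolding C_def using norm_ge_zero[of "f 1"] by linarith+
    have "dist (f b) (f a) < e" if "a \<in> X" "b \<in> X" "dist b a < e / C" for a b
    proof -
      have "norm (f b - f a) \<le> norm (f 1) * norm (b - a)"
        using cp_on_bound[OF f X operator_system_diff[OF X that(2,1)]] by (simp add: cp_on_diff[OF f X that(2,1)])
      also have "\<dots> \<le> C * norm (b - a)" using C by (intro mult_right_mono) auto
      also have "\<dots> < e" using that(3) C by (simp add: dist_norm field_simps)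
      finally show ?thesis by (simp add: dist_norm)
    qed
    then show "\<exists>d>0. \<forall>a\<in>X. \<forall>b\<in>X. dist b a < d \<longrightarrow> dist (f b) (f a) < e"
      using e C by (intro exI[of _ "e / C"]) auto
  qed
  then obtain g where g: "uniformly_continuous_on (closure X) g" "\<And>a. a \<in> X \<Longrightarrow> f a = g a"
    using uniformly_continuous_on_extension_on_closure by metis
  have lim: "(\<lambda>k. f (h k)) \<longlonglongrightarrow> g a" if "\<And>k. h k \<in> X" "h \<longlonglongrightarrow> a" for h a
  proof -
    have a: "a \<in> closure X" using that unfolding closure_sequential by blast
    have "(\<lambda>k. g (h k)) \<longlonglongrightarrow> g a"
      using uniformly_continuous_imp_continuous[OF g(1)] a that closure_subset
      unfolding continuous_on_sequentially o_def by blast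
    then show ?thesis using g(2) that(1) by simp
  qed
  have "cp_on (closure X) g"
    unfolding cp_on_def
  proof (intro conjI ballI allI impI)
    fix a b assume "a \<in> closure X" "b \<in> closure X"
    then obtain h k where hk: "\<And>i. h i \<in> X" "h \<longlonglongrightarrow> a" "\<And>i. k i \<in> X" "k \<longlonglongrightarrow> b"
      unfolding closure_sequential by blast
    have "(\<lambda>i. f (h i + k i)) \<longlonglongrightarrow> g (a + b)"
      using hk operator_systemD(2)[OF X] by (intro lim tendsto_add) auto
    moreover have "(\<lambda>i. f (h i + k i)) = (\<lambda>i. f (h i) + f (k i))"
      using f hk unfolding cp_on_def by blast
    moreover have "(\<lambda>i. f (h i) + f (k i)) \<longlonglongrightarrow> g a + g b" by (intro tendsto_add lim hk)
    ultimately show "g (a + b) = g a + g b" using LIMSEQ_unique by metis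
  next
    fix c a assume "a \<in> closure X"
    then obtain h where h: "\<And>i. h i \<in> X" "h \<longlonglongrightarrow> a" unfolding closure_sequential by blast
    have "(\<lambda>i. f (cscale c (h i))) \<longlonglongrightarrow> g (cscale c a)"
      using h operator_systemD(3)[OF X] by (intro lim bounded_linear.tendsto[OF bounded_linear_cscale]) auto
    moreover have "(\<lambda>i. f (cscale c (h i))) = (\<lambda>i. cscale c (f (h i)))"
      using cp_on_cscale[OF f h(1)] by auto
    moreover have "(\<lambda>i. cscale c (f (h i))) \<longlonglongrightarrow> cscale c (g a)"
      by (intro bounded_linear.tendsto[OF bounded_linear_cscale] lim h)
    ultimately show "g (cscale c a) = cscale c (g a)" using LIMSEQ_unique by metis
  next
    fix n and T :: "nat \<Rightarrow> nat \<Rightarrow> 'a bop"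
    assume TX: "\<forall>i<n. \<forall>j<n. T i j \<in> closure X" and pos: "positive_operator_matrix n T"
    have "\<exists>Q\<in>X. i < n \<and> j < n \<longrightarrow> norm (Q - T i j) \<le> inverse (real (Suc k))" for i j k
    proof (cases "i < n \<and> j < n")
      case True
      have "0 < inverse (real (Suc k))" by simp
      then obtain Q where "Q \<in> X" "dist Q (T i j) < inverse (real (Suc k))"
        using True TX closure_approachable by metis
      then show ?thesis by (intro bexI[of _ Q]) (auto simp: dist_norm)
    qed (use operator_systemD(1)[OF X] in auto)
    then obtain Q where Q: "\<And>i j k. Q i j k \<in> X"
      and close: "\<And>i j k. i < n \<Longrightarrow> j < n \<Longrightarrow> norm (Q i j k - T i j) \<le> inverse (real (Suc k))"
      by metis
    have Q_lim: "(\<lambda>k. Q i j k) \<longlonglongrightarrow> T i j" if "i < n" "j < n" for i j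
    proof (rule Lim_null_comparison[THEN LIM_zero_cancel])
      show "\<forall>\<^sub>F k in sequentially. norm (Q i j k - T i j) \<le> inverse (real (Suc k))"
        using close[OF that] by auto
    qed (rule LIMSEQ_inverse_real_of_nat)
    show "positive_operator_matrix n (\<lambda>i j. g (T i j))"
      unfolding positive_operator_matrix_def
    proof
      fix x :: "nat \<Rightarrow> 'h"
      define s where "s = (\<Sum>i<n. \<Sum>j<n. cinner (bop_apply (g (T i j)) (x j)) (x i))"
      define s' where "s' k = (\<Sum>i<n. \<Sum>j<n. cinner (bop_apply (f (Q i j k)) (x j)) (x i))" for k
      define c where "c = Re (\<Sum>i<n. cinner (bop_apply (f 1) (x i)) (x i))"
      have bl: "bounded_linear (\<lambda>A. cinner (bop_apply A u) v)" for u v :: 'h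
      proof (rule bounded_linear_intro[where K="norm u * norm v"])
        fix A :: "'h bop"
        have "cmod (cinner (bop_apply A u) v) \<le> norm (bop_apply A u) * norm v" by (rule cinner_Cauchy_Schwarz)
        also have "\<dots> \<le> (norm A * norm u) * norm v" by (intro mult_right_mono norm_bop_apply_le) simp
        finally show "cmod (cinner (bop_apply A u) v) \<le> norm A * (norm u * norm v)" by (simp add: mult.assoc)
      qed (auto simp: cinner_add_left scaleR_conv_of_real)
      have s': "s' \<longlonglongrightarrow> s"
        unfolding s_def s'_def
        by (intro tendsto_sum bounded_linear.tendsto[OF bl] lim Q Q_lim) auto
      have ge: "0 \<le> Re (u * s)" if u: "cmod u = 1" "0 \<le> Re u" for u
      proof (rule LIMSEQ_le_const)
        have "(\<lambda>k. Re (u * s' k) + real n * inverse (real (Suc k)) * c) \<longlonglongrightarrow> Re (u * s) + real n * 0 * c"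
          by (intro tendsto_intros s' LIMSEQ_inverse_real_of_nat)
        then show "(\<lambda>k. Re (u * s' k) + real n * inverse (real (Suc k)) * c) \<longlonglongrightarrow> Re (u * s)" by simp
        have "0 \<le> Re (u * s' k) + real n * inverse (real (Suc k)) * c" for k
          unfolding s'_def c_def
          by (rule cp_on_approximate_positive[OF f X Q pos close u])
        then show "\<exists>M. \<forall>k\<ge>M. 0 \<le> Re (u * s' k) + real n * inverse (real (Suc k)) * c" by blast
      qed
      \<comment> \<open>The values \<open>\<i>\<close> and \<open>- \<i>\<close> of \<open>u\<close> show that the form, which is not known to be real, has no imaginary part.\<close>
      have "0 \<le> Re s" "Im s = 0" using ge[of 1] ge[of \<i>] ge[of "- \<i>"] by auto
      then show "(\<Sum>i<n. \<Sum>j<n. cinner (bop_apply (g (T i j)) (x j)) (x i)) \<in> \<real>\<^sub>\<ge>\<^sub>0"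
        unfolding s_def[symmetric] by (simp add: complex_nonneg_Reals_iff)
    qed
  qed
  then show ?thesis by (rule that) (simp add: g(2))
qed

lemma ex_cp_map_of_kernel:
  fixes K :: "'d::finite list \<Rightarrow> 'd list \<Rightarrow> 'h::chilbert_space bop"
  assumes K: "toeplitz_kernel K" "positive_kernel K"
  obtains \<phi> where "\<phi> \<in> cp_maps free_disk_system" "\<And>\<alpha> \<beta>. \<phi> (creation_kernel \<alpha> \<beta>) = K \<alpha> \<beta>"
proof -
  obtain g where "cp_on (closure toeplitz_polys) g" "\<And>a. a \<in> toeplitz_polys \<Longrightarrow> g a = poly_map K a"
    by (rule cp_on_extend_closure[OF cp_on_poly_map[OF K] operator_system_toeplitz_polys]) (rule that)
  note g = this[folded free_disk_system_eq]
  define \<phi> where "\<phi> = restrict g free_disk_system"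
  note S = operator_system_free_disk_system
  have "cp_on free_disk_system \<phi>"
    using g(1) operator_systemD(2,3)[OF S] unfolding cp_on_def \<phi>_def
    by (auto simp: positive_operator_matrix_def)
  then have cp: "\<phi> \<in> cp_maps free_disk_system" by (simp add: cp_maps_iff \<phi>_def)
  have star: "\<phi> (creation_kernel \<alpha> \<beta>) = K \<alpha> \<beta>" if "\<alpha> = [] \<or> \<beta> = []" for \<alpha> \<beta>
  proof -
    define N where "N = max (length \<alpha>) (length \<beta>)"
    have p: "(\<alpha>, \<beta>) \<in> star_pairs N" using that by (auto simp: star_pairs_def N_def)
    have poly: "toeplitz_poly N (creation_kernel \<alpha> \<beta>)" by (rule toeplitz_poly_creation_kernel[OF p])
    then have "creation_kernel \<alpha> \<beta> \<in> toeplitz_polys" by (auto simp: toeplitz_polys_def)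
    then have "\<phi> (creation_kernel \<alpha> \<beta>) = symbol_map K N (creation_kernel \<alpha> \<beta>)"
      using g(2) creation_kernel_free_disk_system[of \<alpha> \<beta>] by (simp add: \<phi>_def poly_map_eq[OF poly])
    also have "\<dots> = (\<Sum>q\<in>star_pairs N. if q = (\<alpha>, \<beta>) then K \<alpha> \<beta> else 0)"
      unfolding symbol_map_def by (rule sum.cong) (auto simp: symbol_coeff_star[OF p] split: if_splits)
    also have "\<dots> = K \<alpha> \<beta>" using p by simp
    finally show ?thesis .
  qed
  have "toeplitz_kernel (\<lambda>\<alpha> \<beta>. \<phi> (creation_kernel \<alpha> \<beta>))"
    using cp_on_0[OF \<open>cp_on free_disk_system \<phi>\<close> S] by (auto simp: toeplitz_kernel_def creation_kernel_snoc)
  then have "\<phi> (creation_kernel \<alpha> \<beta>) = K \<alpha> \<beta>" for \<alpha> \<beta>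
    using toeplitz_kernel_eqI[OF _ K(1), of "\<lambda>\<alpha> \<beta>. \<phi> (creation_kernel \<alpha> \<beta>)"] star by blast
  then show ?thesis using cp by (rule that[rotated])
qed


section \<open>Imaginary constants and the parametrisation by completely positive maps\<close>

lemma Im_op_self_adjoint: "(Im_op A)\<^sup>\<dagger> = Im_op A"
  for A :: "'a::chilbert_space bop"
proof -
  have "cscale (cnj (1 / (2 * \<i>))) (A\<^sup>\<dagger> - A) = cscale (1 / (2 * \<i>)) (A - A\<^sup>\<dagger>)"
    by (rule bop_eqI) (simp add: scaleC_diff_right scaleC_minus_left)
  then show ?thesis by (simp add: Im_op_def)
qed

lemma Im_op_decomposition: "(1/2) *\<^sub>R (A + A\<^sup>\<dagger>) + cscale \<i> (Im_op A) = A"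
  for A :: "'a::chilbert_space bop"
proof (rule bop_eqI)
  fix x
  have "bop_apply ((1/2) *\<^sub>R (A + A\<^sup>\<dagger>) + cscale \<i> (Im_op A)) x
      = (1/2) *\<^sub>R (bop_apply A x + bop_apply (A\<^sup>\<dagger>) x) + (1/2) *\<^sub>R (bop_apply A x - bop_apply (A\<^sup>\<dagger>) x)"
    using scaleC_of_real[of "1/2" "bop_apply A x - bop_apply (A\<^sup>\<dagger>) x"]
    by (simp add: Im_op_def scaleC_scaleC)
  also have "\<dots> = bop_apply A x" by (simp flip: scaleR_add_right)
  finally show "bop_apply ((1/2) *\<^sub>R (A + A\<^sup>\<dagger>) + cscale \<i> (Im_op A)) x = bop_apply A x" .
qed

lemma Im_op_of_parts:
  fixes R C :: "'a::chilbert_space bop"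
  assumes "R\<^sup>\<dagger> = R" "C\<^sup>\<dagger> = C"
  shows "Im_op (R + cscale \<i> C) = C"
proof -
  have "(R + cscale \<i> C) - (R + cscale \<i> C)\<^sup>\<dagger> = cscale (2 * \<i>) C"
    using assms by (simp add: cscale_minus_left flip: cscale_add_left)
  then show ?thesis unfolding Im_op_def by simp
qed

lemma herglotz_series_add_const:
  "herglotz_series \<phi> (A + B) = (\<lambda>\<alpha>. herglotz_series \<phi> A \<alpha> + series_const (cscale \<i> B) \<alpha>)"
  by (rule ext) (simp add: herglotz_series_def series_const_def cscale_add_right)

lemma left_herglotz_kernel_imaginary_constant:
  fixes C :: "'a::chilbert_space bop"
  assumes "C\<^sup>\<dagger> = C"
  shows "left_herglotz_kernel (\<lambda>\<alpha>. H \<alpha> + series_const (cscale \<i> C) \<alpha>) = left_herglotz_kernel H"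
proof (intro ext, rule toeplitz_kernel_eqI[OF toeplitz_left_herglotz_kernel toeplitz_left_herglotz_kernel])
  show "left_herglotz_kernel (\<lambda>\<alpha>. H \<alpha> + series_const (cscale \<i> C) \<alpha>) \<alpha> [] = left_herglotz_kernel H \<alpha> []" for \<alpha>
    using assms by (simp add: left_herglotz_kernel_Nil series_const_def cscale_minus_left)
  show "left_herglotz_kernel (\<lambda>\<alpha>. H \<alpha> + series_const (cscale \<i> C) \<alpha>) [] \<alpha> = left_herglotz_kernel H [] \<alpha>" for \<alpha>
    using assms by (simp add: left_herglotz_kernel_Nil series_const_def cscale_minus_left)
qed

lemma imaginary_constant_rel_iff:
  fixes HL HR GL GR :: "('d::finite, 'h::chilbert_space) series"
  shows "((HL, HR), (GL, GR)) \<in> imaginary_constant_rel \<longleftrightarrow> (HL, HR) \<in> herglotz_pairs \<and>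
    (\<exists>C. C\<^sup>\<dagger> = C \<and> GL = (\<lambda>\<alpha>. HL \<alpha> + series_const (cscale \<i> C) \<alpha>)) \<and> GR = series_transpose GL"
  unfolding imaginary_constant_rel_def
  by (auto simp: herglotz_pairs_iff left_herglotz_kernel_imaginary_constant)

lemma equiv_imaginary_constant_rel:
  "equiv (herglotz_pairs :: (('d::finite, 'h::chilbert_space) series \<times> ('d, 'h) series) set) imaginary_constant_rel"
proof (rule equivI)
  show "(imaginary_constant_rel :: ((('d, 'h) series \<times> ('d, 'h) series) \<times> _) set) \<subseteq> herglotz_pairs \<times> herglotz_pairs"
    by (auto simp: imaginary_constant_rel_def)
  show "refl_on herglotz_pairs (imaginary_constant_rel :: ((('d, 'h) series \<times> ('d, 'h) series) \<times> _) set)"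
  proof (rule refl_onI, safe)
    fix HL HR :: "('d, 'h) series" assume H: "(HL, HR) \<in> herglotz_pairs"
    have "HL = (\<lambda>\<alpha>. HL \<alpha> + series_const (cscale \<i> 0) \<alpha>)" by (rule ext) (simp add: series_const_def)
    then show "((HL, HR), HL, HR) \<in> imaginary_constant_rel"
      using H unfolding imaginary_constant_rel_iff by (metis cadj_simps(7) herglotz_pairs_iff)
  qed
  show "sym (imaginary_constant_rel :: ((('d, 'h) series \<times> ('d, 'h) series) \<times> _) set)"
  proof (rule symI, safe)
    fix HL HR GL GR :: "('d, 'h) series"
    assume rel: "((HL, HR), (GL, GR)) \<in> imaginary_constant_rel"
    then obtain C where C: "C\<^sup>\<dagger> = C" "GL = (\<lambda>\<alpha>. HL \<alpha> + series_const (cscale \<i> C) \<alpha>)"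
      unfolding imaginary_constant_rel_iff by blast
    have "HL = (\<lambda>\<alpha>. GL \<alpha> + series_const (cscale \<i> (cscale (- 1) C)) \<alpha>)"
      unfolding C(2) by (rule ext) (simp add: series_const_def cscale_minus_left cscale_minus_right)
    moreover have "(cscale (- 1) C)\<^sup>\<dagger> = cscale (- 1) C" using C(1) by simp
    ultimately show "((GL, GR), (HL, HR)) \<in> imaginary_constant_rel"
      using rel unfolding imaginary_constant_rel_def by blast
  qed
  show "trans (imaginary_constant_rel :: ((('d, 'h) series \<times> ('d, 'h) series) \<times> _) set)"
  proof (rule transI, safe)
    fix HL HR GL GR FL FR :: "('d, 'h) series"
    assume rel: "((HL, HR), (GL, GR)) \<in> imaginary_constant_rel" "((GL, GR), (FL, FR)) \<in> imaginary_constant_rel"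
    obtain C D where C: "C\<^sup>\<dagger> = C" "GL = (\<lambda>\<alpha>. HL \<alpha> + series_const (cscale \<i> C) \<alpha>)"
      and D: "D\<^sup>\<dagger> = D" "FL = (\<lambda>\<alpha>. GL \<alpha> + series_const (cscale \<i> D) \<alpha>)"
      using rel unfolding imaginary_constant_rel_iff by blast
    have "FL = (\<lambda>\<alpha>. HL \<alpha> + series_const (cscale \<i> (C + D)) \<alpha>)"
      unfolding C(2) D(2) by (rule ext) (simp add: series_const_def cscale_add_right)
    moreover have "(C + D)\<^sup>\<dagger> = C + D" using C(1) D(1) by simp
    ultimately show "((HL, HR), (FL, FR)) \<in> imaginary_constant_rel"
      using rel unfolding imaginary_constant_rel_def by blast
  qed
qed

definition herglotz_class ::
    "('d::finite fock bop \<Rightarrow> 'h::complex_inner bop) \<Rightarrow> (('d, 'h) series \<times> ('d, 'h) series) set"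
  where "herglotz_class \<phi> = {(HL, HR) \<in> herglotz_pairs.
    HL = herglotz_series \<phi> (Im_op (HL [])) \<and> HR = series_transpose HL}"

lemma herglotz_class_iff:
  fixes \<phi> :: "'d::finite fock bop \<Rightarrow> 'h::chilbert_space bop"
  assumes \<phi>: "\<phi> \<in> cp_maps free_disk_system"
  shows "(HL, HR) \<in> herglotz_class \<phi> \<longleftrightarrow>
    (\<exists>C. C\<^sup>\<dagger> = C \<and> HL = herglotz_series \<phi> C) \<and> HR = series_transpose HL"
proof -
  have cp: "cp_on free_disk_system \<phi>" using \<phi> by (simp add: cp_maps_iff)
  have "Im_op (herglotz_series \<phi> C []) = C" if "C\<^sup>\<dagger> = C" for C
    using Im_op_of_parts[OF cp_on_one_self_adjoint[OF cp] that] by (simp add: herglotz_series_eq[OF cp])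
  then show ?thesis
    unfolding herglotz_class_def
    using Im_op_self_adjoint positive_kernel_herglotz_series[OF cp]
    by (auto simp: herglotz_pairs_iff)
qed

lemma herglotz_class_eq_Image:
  fixes \<phi> :: "'d::finite fock bop \<Rightarrow> 'h::chilbert_space bop"
  assumes \<phi>: "\<phi> \<in> cp_maps free_disk_system"
  shows "(herglotz_series \<phi> 0, series_transpose (herglotz_series \<phi> 0)) \<in> herglotz_pairs"
    and "herglotz_class \<phi> = imaginary_constant_rel `` {(herglotz_series \<phi> 0, series_transpose (herglotz_series \<phi> 0))}"
proof -
  have cp: "cp_on free_disk_system \<phi>" using \<phi> by (simp add: cp_maps_iff)
  show H: "(herglotz_series \<phi> 0, series_transpose (herglotz_series \<phi> 0)) \<in> herglotz_pairs"
    using positive_kernel_herglotz_series[OF cp, of 0] by (simp add: herglotz_pairs_iff)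
  have const: "herglotz_series \<phi> C = (\<lambda>\<alpha>. herglotz_series \<phi> 0 \<alpha> + series_const (cscale \<i> C) \<alpha>)" for C
    using herglotz_series_add_const[of \<phi> 0 C] by (simp only: add_0)
  have "p \<in> herglotz_class \<phi> \<longleftrightarrow> p \<in> imaginary_constant_rel `` {(herglotz_series \<phi> 0, series_transpose (herglotz_series \<phi> 0))}" for p
  proof (cases p)
    case (Pair HL HR)
    show ?thesis
      unfolding Pair herglotz_class_iff[OF \<phi>] Image_singleton_iff imaginary_constant_rel_iff
      using H by (simp only: const[symmetric] simp_thms)
  qed
  then show "herglotz_class \<phi> = imaginary_constant_rel `` {(herglotz_series \<phi> 0, series_transpose (herglotz_series \<phi> 0))}"
    by blast
qed

text \<open>The coefficients of \<open>H\<close> determine the coefficient kernel, hence \<open>\<phi>\<close> on the creation kernel, hence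
  \<open>\<phi>\<close>; an imaginary constant does not change the kernel.\<close>

lemma inj_on_herglotz_class:
  "inj_on herglotz_class (cp_maps free_disk_system :: ('d::finite fock bop \<Rightarrow> 'h::chilbert_space bop) set)"
proof (rule inj_onI)
  fix \<phi> \<psi> :: "'d fock bop \<Rightarrow> 'h bop"
  assume \<phi>: "\<phi> \<in> cp_maps free_disk_system" and \<psi>: "\<psi> \<in> cp_maps free_disk_system"
    and eq: "herglotz_class \<phi> = herglotz_class \<psi>"
  have cp: "cp_on free_disk_system \<phi>" "cp_on free_disk_system \<psi>"
    using \<phi> \<psi> by (auto simp: cp_maps_iff)
  have "(herglotz_series \<phi> 0, series_transpose (herglotz_series \<phi> 0)) \<in> herglotz_class \<psi>"
    unfolding eq[symmetric] herglotz_class_iff[OF \<phi>] by (auto intro!: exI[of _ 0])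
  then obtain C where C: "C\<^sup>\<dagger> = C" "herglotz_series \<phi> 0 = herglotz_series \<psi> C"
    unfolding herglotz_class_iff[OF \<psi>] by blast
  have "\<phi> (creation_kernel \<alpha> \<beta>) = \<psi> (creation_kernel \<alpha> \<beta>)" for \<alpha> \<beta>
    using herglotz_series_kernel[OF cp(1), of 0 \<alpha> \<beta>] herglotz_series_kernel[OF cp(2) C(1), of \<alpha> \<beta>]
    by (simp add: C(2))
  then have "\<phi> a = \<psi> a" if "a \<in> free_disk_system" for a
    by (rule cp_on_free_disk_system_eqI[OF cp _ that])
  then show "\<phi> = \<psi>"
    using \<phi> \<psi> by (intro extensionalityI[of \<phi> free_disk_system]) (auto simp: cp_maps_iff)
qed

lemma ex_herglotz_representation:
  fixes HL HR :: "('d::finite, 'h::chilbert_space) series"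
  assumes H: "(HL, HR) \<in> herglotz_pairs"
  obtains \<phi> where "\<phi> \<in> cp_maps free_disk_system" "(HL, HR) \<in> herglotz_class \<phi>"
proof -
  have "positive_kernel (left_herglotz_kernel HL)" and HR: "HR = series_transpose HL"
    using H by (auto simp: herglotz_pairs_iff)
  then obtain \<phi> where \<phi>: "\<phi> \<in> cp_maps free_disk_system"
    and K: "\<And>\<alpha> \<beta>. \<phi> (creation_kernel \<alpha> \<beta>) = left_herglotz_kernel HL \<alpha> \<beta>"
    using ex_cp_map_of_kernel[OF toeplitz_left_herglotz_kernel] by blast
  have cp: "cp_on free_disk_system \<phi>" using \<phi> by (simp add: cp_maps_iff)
  have "HL \<alpha> = herglotz_series \<phi> (Im_op (HL [])) \<alpha>" for \<alpha>
    using K[of \<alpha> "[]"] Im_op_decomposition[of "HL []"]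
    by (auto simp: herglotz_series_eq[OF cp] left_herglotz_kernel_Nil)
  then have "HL = herglotz_series \<phi> (Im_op (HL []))" by (rule ext)
  then have "(HL, HR) \<in> herglotz_class \<phi>"
    unfolding herglotz_class_def using H HR by blast
  with \<phi> show ?thesis by (rule that)
qed

lemma bij_betw_herglotz_class:
  "bij_betw herglotz_class (cp_maps free_disk_system :: ('d::finite fock bop \<Rightarrow> 'h::chilbert_space bop) set)
    (herglotz_pairs // imaginary_constant_rel)"
  unfolding bij_betw_def
proof (intro conjI inj_on_herglotz_class equalityI subsetI)
  fix X assume "X \<in> herglotz_class ` (cp_maps free_disk_system :: ('d fock bop \<Rightarrow> 'h bop) set)"
  then show "X \<in> herglotz_pairs // imaginary_constant_rel"
    by (auto simp: herglotz_class_eq_Image intro!: quotientI)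
next
  fix X :: "(('d, 'h) series \<times> ('d, 'h) series) set"
  assume "X \<in> herglotz_pairs // imaginary_constant_rel"
  then obtain HL HR where H: "(HL, HR) \<in> herglotz_pairs" and X: "X = imaginary_constant_rel `` {(HL, HR)}"
    by (auto elim!: quotientE)
  obtain \<phi> where \<phi>: "\<phi> \<in> cp_maps free_disk_system" and "(HL, HR) \<in> herglotz_class \<phi>"
    using ex_herglotz_representation[OF H] .
  then have "((herglotz_series \<phi> 0, series_transpose (herglotz_series \<phi> 0)), (HL, HR)) \<in> imaginary_constant_rel"
    by (simp add: herglotz_class_eq_Image)
  then have "X = herglotz_class \<phi>"
    unfolding X herglotz_class_eq_Image(2)[OF \<phi>] by (rule equiv_class_eq[OF equiv_imaginary_constant_rel, symmetric])
  then show "X \<in> herglotz_class ` cp_maps free_disk_system" using \<phi> by blast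
qed

theorem theorem4p6:
  "let schur = (nonunital_schur_pairs :: (('d::finite, 'h::chilbert_space) series \<times> ('d, 'h) series) set);
       herglotz = (herglotz_pairs :: (('d, 'h) series \<times> ('d, 'h) series) set);
       CP = (cp_maps free_disk_system :: ('d fock bop \<Rightarrow> 'h bop) set)
   in
     (\<forall>(BL, BR)\<in>schur. series_invertible (\<lambda>\<alpha>. series_const 1 \<alpha> - BL \<alpha>)) \<and>
     (\<forall>(HL, HR)\<in>herglotz. series_invertible (\<lambda>\<alpha>. HL \<alpha> + series_const 1 \<alpha>)) \<and>
     bij_betw schur_to_herglotz schur herglotz \<and>
     bij_betw herglotz_to_schur herglotz schur \<and>
     (\<forall>B\<in>schur. herglotz_to_schur (schur_to_herglotz B) = B) \<and>
     (\<forall>H\<in>herglotz. schur_to_herglotz (herglotz_to_schur H) = H) \<and>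
     equiv herglotz imaginary_constant_rel \<and>
     bij_betw
       (\<lambda>\<phi>. {(HL, HR) \<in> herglotz.
          HL = herglotz_series \<phi> (Im_op (HL [])) \<and> HR = series_transpose HL})
       CP (herglotz // imaginary_constant_rel)"
  unfolding Let_def
proof (intro conjI)
  show "\<forall>(BL, BR)\<in>(nonunital_schur_pairs :: (('d, 'h) series \<times> ('d, 'h) series) set).
      series_invertible (\<lambda>\<alpha>. series_const 1 \<alpha> - BL \<alpha>)"
    using schur_inverse_pair by (fastforce simp: series_invertible_def nonunital_schur_pairs_iff)
  show "\<forall>(HL, HR)\<in>(herglotz_pairs :: (('d, 'h) series \<times> ('d, 'h) series) set).
      series_invertible (\<lambda>\<alpha>. HL \<alpha> + series_const 1 \<alpha>)"
    using herglotz_inverse_pair by (fastforce simp: series_invertible_def herglotz_pairs_iff)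
  show "bij_betw (\<lambda>\<phi>. {(HL, HR) \<in> herglotz_pairs.
      HL = herglotz_series \<phi> (Im_op (HL [])) \<and> HR = series_transpose HL})
    (cp_maps free_disk_system :: ('d fock bop \<Rightarrow> 'h bop) set) (herglotz_pairs // imaginary_constant_rel)"
    using bij_betw_herglotz_class unfolding herglotz_class_def[abs_def] .
qed (auto simp: bij_betw_schur_to_herglotz bij_betw_herglotz_to_schur equiv_imaginary_constant_rel
    schur_to_herglotz_pair herglotz_to_schur_pair)

end
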